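(* Let $u$ be an almost minimizer for $J$ or $J^+$ in $\Omega$ (with constant $\kappa$ and exponent $\alpha$). For each choice of $\rho_0>0$ and $L\ge1$, there are constants $\eta_0>0$ and $r_0>0$, that depend only on $\rho_0$, $L$, $n$, $\alpha$, $\kappa$ and $\|q_\pm\|_\infty$, such that if $x\in\Omega$ and $0<r\le r_0$ are such that $\overline B(x,r)\subset\Omega$, $$\frac{1}{\mathcal{H}^{n-1}(\partial B(x,r))}\int_{\partial B(x,r)}u^+\,d\mathcal{H}^{n-1}\le r\,\eta_0,$$ $u$ is $L$-Lipschitz on $B(x,r)$, and $q_+(y)\ge\rho_0$ for $y\in B(x,r)$, then $u(y)\le0$ for all $y\in B(x,r/4)$.
   Context: Let $n\ge 2$, let $\Omega\subset\mathbb{R}^n$ be a domain (open set), let $q_+,q_-\in L^\infty(\Omega)$ be bounded real-valued functions, and let $\kappa\in(0,\infty)$, $\alpha\in(0,1]$. Set $K_{\mathrm{loc}}(\Omega)=\{u\in L^1_{\mathrm{loc}}(\Omega): \nabla u\in L^2(B(x,r))$ for every open ball $B(x,r)\subset\Omega\}$ and $K^+_{\mathrm{loc}}(\Omega)=\{u\in K_{\mathrm{loc}}(\Omega): u\ge 0$ a.e. on $\Omega\}$. Let $$J_{x,r}(v)=\int_{B(x,r)}|\nabla v|^2+q_+^2\,\chi_{\{v>0\}}+q_-^2\,\chi_{\{v<0\}},\qquad J^+_{x,r}(v)=\int_{B(x,r)}|\nabla v|^2+q_+^2\,\chi_{\{v>0\}}.$$ $u$ is an almost minimizer for $J$ in $\Omega$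 (with constant $\kappa$ and exponent $\alpha$) if $u\in K_{\mathrm{loc}}(\Omega)$ and $J_{x,r}(u)\le(1+\kappa r^\alpha)J_{x,r}(v)$ for every ball $B(x,r)\subset\Omega$ and every $v\in L^1(B(x,r))$ with $\nabla v\in L^2(B(x,r))$ and $v=u$ on $\partial B(x,r)$ (equality of traces). $u$ is an almost minimizer for $J^+$ in $\Omega$ if $u\in K^+_{\mathrm{loc}}(\Omega)$ and $J^+_{x,r}(u)\le(1+\kappa r^\alpha)J^+_{x,r}(v)$ for every ball with $\overline B(x,r)\subset\Omega$ and every such $v$. Almost minimizers agree a.e. with a continuous (indeed locally Lipschitz) function and are identified with it. Notation: $u^+=\max(u,0)$. *)

theory Defs
  imports "HOL-Analysis.Analysis" "HOL-Probability.Essential_Supremum"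
begin

section \<open>Hausdorff measure\<close>

text \<open>
  The normalisation makes the \<open>n\<close>-dimensional measure on \<open>\<real>\<^sup>n\<close> Lebesgue measure, and the
  \<open>(n - 1)\<close>-dimensional measure the usual surface area. The library's \<^const>\<open>diameter\<close> is
  meaningful for bounded sets only, hence the boundedness requirement on coverings; the empty set
  has to cost nothing also for \<open>k = 0\<close>.
\<close>

definition hausdorff_gauge :: "nat \<Rightarrow> 'a::metric_space set \<Rightarrow> ennreal" where
  "hausdorff_gauge k S =
     (if S = {} then 0 else ennreal (unit_ball_vol (real k) * (diameter S / 2) ^ k))"

definition hausdorff_content :: "nat \<Rightarrow> real \<Rightarrow> 'a::metric_space set \<Rightarrow> ennreal" where
  "hausdorff_content k \<delta> A =
     (INF S\<in>{S :: nat \<Rightarrow> 'a set. A \<subseteq> (\<Union>i. S i) \<and> (\<forall>i. bounded (S i) \<and> diameter (S i) \<le> \<delta>)}.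
        \<Sum>i. hausdorff_gauge k (S i))"

definition hausdorff_outer :: "nat \<Rightarrow> 'a::metric_space set \<Rightarrow> ennreal" where
  "hausdorff_outer k A = (SUP \<delta>\<in>{0<..}. hausdorff_content k \<delta> A)"

definition hausdorff_measure :: "nat \<Rightarrow> 'a::metric_space measure" where
  "hausdorff_measure k = measure_of UNIV (sets borel) (hausdorff_outer k)"


section \<open>Function spaces and weak gradients\<close>

primrec Ck :: "nat \<Rightarrow> ('a::euclidean_space \<Rightarrow> real) \<Rightarrow> bool" where
  "Ck 0 f \<longleftrightarrow> continuous_on UNIV f"
| "Ck (Suc k) f \<longleftrightarrow>
     f differentiable_on UNIV \<and> (\<forall>b\<in>Basis. Ck k (\<lambda>x. frechet_derivative f (at x) b))"

definition test_functions :: "'a::euclidean_space set \<Rightarrow> ('a \<Rightarrow> real) set" where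
  "test_functions U =
     {\<phi>. (\<forall>k. Ck k \<phi>) \<and> compact (closure {x. \<phi> x \<noteq> 0}) \<and> closure {x. \<phi> x \<noteq> 0} \<subseteq> U}"

definition L1 :: "'a::euclidean_space set \<Rightarrow> ('a \<Rightarrow> 'b::euclidean_space) set" where
  "L1 U = {f. integrable (lebesgue_on U) f}"

definition L1_loc :: "'a::euclidean_space set \<Rightarrow> ('a \<Rightarrow> 'b::euclidean_space) set" where
  "L1_loc U = {f. \<forall>K. compact K \<and> K \<subseteq> U \<longrightarrow> f \<in> L1 K}"

definition L2 :: "'a::euclidean_space set \<Rightarrow> ('a \<Rightarrow> 'b::euclidean_space) set" where
  "L2 U = {f. f \<in> borel_measurable (lebesgue_on U) \<and>
              integrable (lebesgue_on U) (\<lambda>y. (norm (f y))\<^sup>2)}"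

definition Linf_norm :: "'a::euclidean_space set \<Rightarrow> ('a \<Rightarrow> real) \<Rightarrow> ereal" where
  "Linf_norm U q = esssup (lebesgue_on U) (\<lambda>y. ereal \<bar>q y\<bar>)"

definition Linf :: "'a::euclidean_space set \<Rightarrow> ('a \<Rightarrow> real) set" where
  "Linf U = {q. q \<in> borel_measurable (lebesgue_on U) \<and> Linf_norm U q < \<infinity>}"

definition has_weak_gradient ::
    "'a::euclidean_space set \<Rightarrow> ('a \<Rightarrow> real) \<Rightarrow> ('a \<Rightarrow> 'a) \<Rightarrow> bool" where
  "has_weak_gradient U v g \<longleftrightarrow> v \<in> L1_loc U \<and> g \<in> L1_loc U \<and>
     (\<forall>\<phi>\<in>test_functions U. \<forall>b\<in>Basis.
        (\<integral>y. v y * frechet_derivative \<phi> (at y) b \<partial>lebesgue_on U) =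
        - (\<integral>y. (g y \<bullet> b) * \<phi> y \<partial>lebesgue_on U))"

text \<open>For open \<open>U\<close> the weak gradient is unique up to null sets, so the choice is immaterial below.\<close>

definition weak_gradient :: "'a::euclidean_space set \<Rightarrow> ('a \<Rightarrow> real) \<Rightarrow> 'a \<Rightarrow> 'a" where
  "weak_gradient U v = (SOME g. has_weak_gradient U v g)"

definition gradient_in_L2 :: "'a::euclidean_space set \<Rightarrow> ('a \<Rightarrow> real) \<Rightarrow> bool" where
  "gradient_in_L2 U v \<longleftrightarrow> (\<exists>g. has_weak_gradient U v g \<and> g \<in> L2 U)"

definition K_loc :: "'a::euclidean_space set \<Rightarrow> ('a \<Rightarrow> real) set" where
  "K_loc \<Omega> = {u \<in> L1_loc \<Omega>. \<forall>x r. 0 < r \<and> ball x r \<subseteq> \<Omega> \<longrightarrow> gradient_in_L2 (ball x r) u}"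

definition K_loc_plus :: "'a::euclidean_space set \<Rightarrow> ('a \<Rightarrow> real) set" where
  "K_loc_plus \<Omega> = {u \<in> K_loc \<Omega>. AE y in lebesgue_on \<Omega>. 0 \<le> u y}"


section \<open>Traces on spheres\<close>

text \<open>
  The trace operator on a ball \<open>B\<close> is the continuous map from \<open>W\<^sup>1\<^sup>,\<^sup>2(B)\<close> to \<open>L\<^sup>2(\<partial>B)\<close> that extends
  restriction to \<open>\<partial>B\<close> of functions in \<open>W\<^sup>1\<^sup>,\<^sup>2(B)\<close> continuous up to the boundary; \<open>g\<close> is the trace
  of \<open>v\<close> if it is the limit of the restrictions of such functions converging to \<open>v\<close>. On a ball,
  functions in \<open>L\<^sup>1\<close> (or \<open>L\<^sup>1\<close> locally) with gradient in \<open>L\<^sup>2\<close> are in \<open>W\<^sup>1\<^sup>,\<^sup>2\<close>. The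
  distances are nonnegative integrals, so that they are infinite, not \<open>0\<close>, in the absence of
  square integrability.
\<close>

definition has_trace ::
    "'a::euclidean_space \<Rightarrow> real \<Rightarrow> ('a \<Rightarrow> real) \<Rightarrow> ('a \<Rightarrow> real) \<Rightarrow> bool" where
  "has_trace x r v g \<longleftrightarrow>
     gradient_in_L2 (ball x r) v \<and> g \<in> borel_measurable borel \<and>
     (\<exists>\<phi> :: nat \<Rightarrow> 'a \<Rightarrow> real.
        (\<forall>k. continuous_on (cball x r) (\<phi> k) \<and> gradient_in_L2 (ball x r) (\<phi> k)) \<and>
        (\<lambda>k. \<integral>\<^sup>+y. ennreal ((\<phi> k y - v y)\<^sup>2) \<partial>lebesgue_on (ball x r)) \<longlonglongrightarrow> 0 \<and>
        (\<lambda>k. \<integral>\<^sup>+y. ennreal ((norm (weak_gradient (ball x r) (\<phi> k) y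
                                - weak_gradient (ball x r) v y))\<^sup>2) \<partial>lebesgue_on (ball x r))
          \<longlonglongrightarrow> 0 \<and>
        (\<lambda>k. \<integral>\<^sup>+y\<in>sphere x r. ennreal ((\<phi> k y - g y)\<^sup>2) \<partial>hausdorff_measure (DIM('a) - 1))
          \<longlonglongrightarrow> 0)"

definition same_trace ::
    "'a::euclidean_space \<Rightarrow> real \<Rightarrow> ('a \<Rightarrow> real) \<Rightarrow> ('a \<Rightarrow> real) \<Rightarrow> bool" where
  "same_trace x r v w \<longleftrightarrow> (\<exists>g. has_trace x r v g \<and> has_trace x r w g)"


section \<open>The functionals and their almost minimizers\<close>

definition J_fun ::
    "('a \<Rightarrow> real) \<Rightarrow> ('a \<Rightarrow> real) \<Rightarrow> 'a::euclidean_space \<Rightarrow> real \<Rightarrow> ('a \<Rightarrow> real) \<Rightarrow> real" where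
  "J_fun qp qm x r v =
     (\<integral>y. (norm (weak_gradient (ball x r) v y))\<^sup>2
        + (qp y)\<^sup>2 * indicator {z. v z > 0} y
        + (qm y)\<^sup>2 * indicator {z. v z < 0} y \<partial>lebesgue_on (ball x r))"

definition J_plus ::
    "('a \<Rightarrow> real) \<Rightarrow> 'a::euclidean_space \<Rightarrow> real \<Rightarrow> ('a \<Rightarrow> real) \<Rightarrow> real" where
  "J_plus qp x r v =
     (\<integral>y. (norm (weak_gradient (ball x r) v y))\<^sup>2
        + (qp y)\<^sup>2 * indicator {z. v z > 0} y \<partial>lebesgue_on (ball x r))"

definition competitor ::
    "('a \<Rightarrow> real) \<Rightarrow> 'a::euclidean_space \<Rightarrow> real \<Rightarrow> ('a \<Rightarrow> real) \<Rightarrow> bool" where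
  "competitor u x r v \<longleftrightarrow>
     v \<in> L1 (ball x r) \<and> gradient_in_L2 (ball x r) v \<and> same_trace x r v u"

definition almost_minimizer_J ::
    "real \<Rightarrow> real \<Rightarrow> ('a \<Rightarrow> real) \<Rightarrow> ('a \<Rightarrow> real) \<Rightarrow> 'a::euclidean_space set \<Rightarrow> ('a \<Rightarrow> real) \<Rightarrow> bool"
  where
  "almost_minimizer_J \<kappa> \<alpha> qp qm \<Omega> u \<longleftrightarrow> u \<in> K_loc \<Omega> \<and>
     (\<forall>x r v. 0 < r \<and> ball x r \<subseteq> \<Omega> \<and> competitor u x r v \<longrightarrow>
        J_fun qp qm x r u \<le> (1 + \<kappa> * r powr \<alpha>) * J_fun qp qm x r v)"

definition almost_minimizer_J_plus ::
    "real \<Rightarrow> real \<Rightarrow> ('a \<Rightarrow> real) \<Rightarrow> 'a::euclidean_space set \<Rightarrow> ('a \<Rightarrow> real) \<Rightarrow> bool" where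
  "almost_minimizer_J_plus \<kappa> \<alpha> qp \<Omega> u \<longleftrightarrow> u \<in> K_loc_plus \<Omega> \<and>
     (\<forall>x r v. 0 < r \<and> cball x r \<subseteq> \<Omega> \<and> competitor u x r v \<longrightarrow>
        J_plus qp x r u \<le> (1 + \<kappa> * r powr \<alpha>) * J_plus qp x r v)"

definition sphere_average :: "'a::euclidean_space \<Rightarrow> real \<Rightarrow> ('a \<Rightarrow> real) \<Rightarrow> real" where
  "sphere_average x r f =
     (LINT y:sphere x r|hausdorff_measure (DIM('a) - 1). f y)
       / measure (hausdorff_measure (DIM('a) - 1)) (sphere x r)"

end

theory Submission
  imports Defs
begin

text \<open>
  No harmonic replacement or Poincare inequality is needed: \<open>u\<close> is compared with
  \<open>min u h\<close>, where \<open>h\<close> is a multiple of \<open>|z - y|\<^sup>2 - s\<^sup>2\<close>, cut off at \<open>0\<close>, that dominates \<open>u\<close> on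
  \<open>\<partial>B(y,t)\<close>. If \<open>u \<le> \<epsilon> t\<close> there, this gives
  \<open>\<rho>0\<^sup>2 |{u > 0} \<inter> B(y,s)| \<le> C \<epsilon>\<^sup>2 |{u > 0} \<inter> B(y,t)| + C t\<^sup>n\<^sup>+\<^sup>\<alpha>\<close>, since truncation gains the
  measure of the positivity set in \<open>B(y,s)\<close> and costs only \<open>|\<nabla>h|\<^sup>2\<close> on the positivity set in \<open>B(y,t)\<close>.
  After \<open>n\<close> iterations between two fixed radii the positivity set has density at most
  \<open>(C \<epsilon>\<^sup>2)\<^sup>n + C t\<^sup>\<alpha>\<close>. On the other hand \<open>u(z) > \<epsilon> t / 4\<close> forces density at least \<open>(\<epsilon> / 4L)\<^sup>n\<close>, as \<open>u\<close> is
  \<open>L\<close>-Lipschitz. For small \<open>\<epsilon>\<close> and \<open>t\<close> the bound \<open>u \<le> \<epsilon> t\<close> is therefore inherited by the concentric ball of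
  half the radius, hence by all of them, and \<open>u \<le> 0\<close> at the center. To start, \<open>u \<le> \<epsilon>' r\<close> on the
  sphere follows from the small average, because a point where it fails comes with a cap of
  comparable size; one comparison then bounds \<open>u\<close> on \<open>B(x,r/2)\<close>.
\<close>

section \<open>Smooth functions and test functions\<close>

text \<open>Iteration is forced by the exponents: for n >= 2, one comparison gives a density of
  order \<epsilon>^2, which need not be below the (\<epsilon> / 4L)^n that a positive value forces,
  whereas n comparisons give \<epsilon>^(2n). The error from almost minimality does not shrink under
  iteration. But one and the same \<epsilon> serves at all scales, so errors of different scales are
  never added up, and a bound on the radius absorbs them.

  All competitors are continuous up to the sphere, so that traces are restrictions, and they arise
  from Lipschitz functions by truncation. The Sobolev fact behind this, the weak gradient of a
  positive part, is obtained from difference quotients. As \<open>weak_gradient\<close> is an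
  arbitrary choice, uniqueness up to null sets must precede any evaluation of an energy.

  Surface measure enters only through the initial average. That average is a quotient, and
  \<open>measure\<close> is 0 on sets of infinite measure; hence the proofs that spheres have finite
  and positive measure, and that the outer measure is countably additive on Borel sets.\<close>

lemma Ck_SucI:
  assumes "\<And>x. (f has_derivative f' x) (at x)" and "\<And>b. b \<in> Basis \<Longrightarrow> Ck k (\<lambda>x. f' x b)"
  shows "Ck (Suc k) f"
proof -
  have "frechet_derivative f (at x) = f' x" for x
    using frechet_derivative_at[OF assms(1)] by simp
  moreover have "f differentiable_on UNIV"
    using assms(1) by (auto simp: differentiable_on_def differentiable_def)
  ultimately show ?thesis
    using assms(2) by simp
qed

lemma Ck_Suc_has_derivative:
  "Ck (Suc k) f \<Longrightarrow> (f has_derivative frechet_derivative f (at x)) (at x)"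
  by (simp add: differentiable_on_def frechet_derivative_works)

lemma Ck_SucD: "Ck (Suc k) f \<Longrightarrow> Ck k f"
proof (induction k arbitrary: f)
  case 0
  then show ?case
    by (simp add: differentiable_imp_continuous_on)
next
  case (Suc k)
  then show ?case
    by (metis Ck.simps(2))
qed

lemma Ck_continuous_on: "Ck k f \<Longrightarrow> continuous_on UNIV f"
  by (induction k) (auto dest: Ck_SucD simp: differentiable_imp_continuous_on)

lemma Ck_const: "Ck k (\<lambda>x. c)"
proof (induction k arbitrary: c)
  case (Suc k)
  show ?case
    by (rule Ck_SucI[where f' = "\<lambda>_ _. 0"]) (auto intro!: derivative_eq_intros Suc)
qed simp

lemma Ck_bounded_linear:
  assumes "bounded_linear f"
  shows "Ck k f"
proof (cases k)
  case 0
  then show ?thesis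
    using assms by (simp add: linear_continuous_on)
next
  case (Suc m)
  then show ?thesis
    using Ck_SucI[of f "\<lambda>_. f" m] assms Ck_const bounded_linear_imp_has_derivative by blast
qed

lemma Ck_add: "Ck k f \<Longrightarrow> Ck k g \<Longrightarrow> Ck k (\<lambda>x. f x + g x)"
proof (induction k arbitrary: f g)
  case 0
  then show ?case
    by (simp add: continuous_on_add)
next
  case (Suc k)
  show ?case
    by (rule Ck_SucI[OF has_derivative_add[OF Suc.prems[THEN Ck_Suc_has_derivative]]])
      (use Suc in auto)
qed

lemma Ck_mult: "Ck k f \<Longrightarrow> Ck k g \<Longrightarrow> Ck k (\<lambda>x. f x * g x)"
proof (induction k arbitrary: f g)
  case 0
  then show ?case
    by (simp add: continuous_on_mult)
next
  case (Suc k)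
  note D = Ck_SucD[OF Suc.prems(1)] Ck_SucD[OF Suc.prems(2)]
  show ?case
    by (rule Ck_SucI[OF has_derivative_mult[OF Suc.prems[THEN Ck_Suc_has_derivative]]])
      (use Suc D in \<open>auto intro!: Ck_add\<close>)
qed

lemma Ck_prod: "finite I \<Longrightarrow> (\<And>i. i \<in> I \<Longrightarrow> Ck k (f i)) \<Longrightarrow> Ck k (\<lambda>x. \<Prod>i\<in>I. f i x)"
  by (induction I rule: finite_induct) (auto intro: Ck_const Ck_mult)

lemma Ck_real_polynomial_function: "real_polynomial_function p \<Longrightarrow> Ck k p"
  by (induction rule: real_polynomial_function.induct)
    (auto intro: Ck_const Ck_bounded_linear Ck_add Ck_mult)

text \<open>The powers of \<open>1/t\<close> are included so that the family is closed under differentiation.\<close>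

definition exp_recip :: "real \<Rightarrow> nat \<Rightarrow> real \<Rightarrow> real" where
  "exp_recip c m t = (if t > 0 then (1 / t) ^ m * exp (- c / t) else 0)"

lemma tendsto_exp_recip_0:
  assumes "c > 0"
  shows "(exp_recip c m \<longlongrightarrow> 0) (at_right 0)"
proof -
  have "((\<lambda>s. (c * s) ^ m / exp (c * s) / c ^ m) \<longlongrightarrow> 0 / c ^ m) at_top"
    by (intro tendsto_divide tendsto_const filterlim_compose[OF tendsto_power_div_exp_0]
        filterlim_tendsto_pos_mult_at_top[OF tendsto_const assms filterlim_ident])
       (use assms in auto)
  then have "((\<lambda>t. (c * inverse t) ^ m / exp (c * inverse t) / c ^ m) \<longlongrightarrow> 0) (at_right 0)"
    using filterlim_compose[OF _ filterlim_inverse_at_top_right] by fastforce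
  moreover have "\<forall>\<^sub>F t in at_right 0.
      (c * inverse t) ^ m / exp (c * inverse t) / c ^ m = exp_recip c m t"
    using eventually_at_right_less[of 0]
    by eventually_elim
      (use assms in \<open>auto simp: exp_recip_def exp_minus field_simps power_mult_distrib\<close>)
  ultimately show ?thesis
    by (rule Lim_transform_eventually)
qed

text \<open>The delicate point is the origin, where the difference quotient from the right is again
  a member of the family, with \<open>m\<close> raised by one, and the one from the left
  vanishes.\<close>

lemma exp_recip_has_derivative:
  assumes "c > 0"
  shows "(exp_recip c m has_real_derivative
           c * exp_recip c (m + 2) t - real m * exp_recip c (m + 1) t) (at t)"
proof -
  consider "t < 0" | "t = 0" | "t > 0" by linarith
  then show ?thesis
  proof cases
    case 1
    have "(exp_recip c m has_real_derivative 0) (at t)"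
      by (rule has_field_derivative_transform_within_open[where S = "{..<0}" and f = "\<lambda>_. 0"])
        (use 1 in \<open>auto simp: exp_recip_def\<close>)
    then show ?thesis
      using 1 by (simp add: exp_recip_def)
  next
    case 2
    have "((\<lambda>h. exp_recip c m h / h) \<longlongrightarrow> 0) (at_right 0)"
      by (rule Lim_transform_eventually[OF tendsto_exp_recip_0[OF assms, of "Suc m"]])
        (auto simp: exp_recip_def eventually_at_filter)
    moreover have "((\<lambda>h. exp_recip c m h / h) \<longlongrightarrow> 0) (at_left 0)"
      by (rule Lim_transform_eventually[OF tendsto_const])
        (auto simp: exp_recip_def eventually_at_filter)
    ultimately have "((\<lambda>h. exp_recip c m h / h) \<longlongrightarrow> 0) (at 0)"
      by (simp add: filterlim_at_split)
    then show ?thesis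
      using 2 by (simp add: has_field_derivative_iff exp_recip_def)
  next
    case 3
    have "((\<lambda>t. 1 / t) has_real_derivative - (1 / t)\<^sup>2) (at t)"
      using 3 by (auto intro!: derivative_eq_intros simp: power2_eq_square)
    from DERIV_power[OF this, of m]
    have "((\<lambda>t. (1 / t) ^ m) has_real_derivative - real m * (1 / t) ^ (m + 1)) (at t)"
      by (rule DERIV_cong)
        (cases m; simp only: power2_eq_square mult_minus_left mult_minus_right; simp)
    moreover have "((\<lambda>t. exp (- c / t)) has_real_derivative exp (- c / t) * (c * (1 / t)\<^sup>2)) (at t)"
      using 3 by (auto intro!: derivative_eq_intros simp: power2_eq_square)
    ultimately have "((\<lambda>t. (1 / t) ^ m * exp (- c / t)) has_real_derivative
        - real m * (1 / t) ^ (m + 1) * exp (- c / t) + exp (- c / t) * (c * (1 / t)\<^sup>2) * (1 / t) ^ m)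
        (at t)"
      by (rule DERIV_mult)
    then have "((\<lambda>t. (1 / t) ^ m * exp (- c / t)) has_real_derivative
        c * exp_recip c (m + 2) t - real m * exp_recip c (m + 1) t) (at t)"
      by (rule DERIV_cong) (use 3 in \<open>simp add: exp_recip_def power_add power2_eq_square algebra_simps\<close>)
    then show ?thesis
      by (rule has_field_derivative_transform_within_open[where S = "{0<..}"])
        (use 3 in \<open>auto simp: exp_recip_def\<close>)
  qed
qed

text \<open>The induction must treat all \<open>m\<close> at once, since differentiation raises the
  power of \<open>1 / t\<close>. Affine arguments are what the two opposite faces of a box call
  for.\<close>

lemma Ck_exp_recip:
  fixes l :: "'a::euclidean_space"
  assumes "c > 0"
  shows "Ck k (\<lambda>x. exp_recip c m (x \<bullet> l + d))"
proof (induction k arbitrary: m)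
  case 0
  have "continuous_on UNIV (exp_recip c m)"
    using DERIV_isCont[OF exp_recip_has_derivative[OF assms]]
    by (simp add: continuous_at_imp_continuous_on)
  then have "continuous_on UNIV (\<lambda>x. exp_recip c m (x \<bullet> l + d))"
    by (rule continuous_on_compose2) (auto intro!: continuous_intros)
  then show ?case
    by simp
next
  case (Suc k)
  show ?case
  proof (rule Ck_SucI)
    fix x
    have "((\<lambda>x. x \<bullet> l + d) has_derivative (\<lambda>h. h \<bullet> l)) (at x)"
      by (auto intro!: derivative_eq_intros)
    from has_derivative_compose[OF this
        exp_recip_has_derivative[OF assms, unfolded has_field_derivative_def]]
    show "((\<lambda>x. exp_recip c m (x \<bullet> l + d)) has_derivative
       (\<lambda>h. (c * exp_recip c (m + 2) (x \<bullet> l + d) - real m * exp_recip c (m + 1) (x \<bullet> l + d))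
              * (h \<bullet> l))) (at x)" .
  next
    fix b :: 'a
    have "Ck k (\<lambda>x. (c * (b \<bullet> l)) * exp_recip c (m + 2) (x \<bullet> l + d) +
        (- real m * (b \<bullet> l)) * exp_recip c (m + 1) (x \<bullet> l + d))"
      by (intro Ck_add Ck_mult Ck_const Suc)
    then show "Ck k (\<lambda>x. (c * exp_recip c (m + 2) (x \<bullet> l + d)
        - real m * exp_recip c (m + 1) (x \<bullet> l + d)) * (b \<bullet> l))"
      by (simp add: algebra_simps)
  qed
qed

lemma compact_closure_subset:
  fixes K :: "'a::metric_space set"
  assumes "compact K" "A \<subseteq> K"
  shows "compact (closure A)" "closure A \<subseteq> K"
proof -
  show *: "closure A \<subseteq> K"
    using assms by (simp add: closure_minimal compact_imp_closed)
  show "compact (closure A)"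
    using compact_Int_closed[OF assms(1) closed_closure[of A]] * by (simp add: inf.absorb2)
qed

text \<open>Smooth, positive exactly on the open box, and increasing to its indicator function
  as \<open>c\<close> decreases to \<open>0\<close>.\<close>

definition box_bump :: "real \<Rightarrow> 'a::euclidean_space \<Rightarrow> 'a \<Rightarrow> 'a \<Rightarrow> real" where
  "box_bump c a b x =
     (\<Prod>i\<in>Basis. exp_recip c 0 (x \<bullet> i - a \<bullet> i) * exp_recip c 0 (b \<bullet> i - x \<bullet> i))"

lemma exp_recip_bounds: "c > 0 \<Longrightarrow> 0 \<le> exp_recip c 0 t \<and> exp_recip c 0 t \<le> 1"
  by (auto simp: exp_recip_def)

lemma box_bump_bounds:
  assumes "c > 0"
  shows "0 \<le> box_bump c a b x" "box_bump c a b x \<le> 1"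
  unfolding box_bump_def
  using exp_recip_bounds[OF assms] by (auto intro!: prod_nonneg prod_le_1 mult_le_one)

lemma box_bump_eq_0: "x \<notin> box a b \<Longrightarrow> box_bump c a b x = 0"
  unfolding box_bump_def exp_recip_def by (force simp: mem_box not_less)

lemma Ck_box_bump:
  assumes "c > 0"
  shows "Ck k (box_bump c a b)"
proof -
  have "Ck k (\<lambda>x. \<Prod>i\<in>Basis. exp_recip c 0 (x \<bullet> i + (- (a \<bullet> i))) *
      exp_recip c 0 (x \<bullet> (- i) + b \<bullet> i))"
    by (intro Ck_prod Ck_mult Ck_exp_recip assms finite_Basis)
  moreover have "box_bump c a b = (\<lambda>x. \<Prod>i\<in>Basis. exp_recip c 0 (x \<bullet> i + (- (a \<bullet> i))) *
      exp_recip c 0 (x \<bullet> (- i) + b \<bullet> i))"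
    by (auto simp: box_bump_def fun_eq_iff)
  ultimately show ?thesis by simp
qed

lemma box_bump_test_function:
  assumes "c > 0" "cbox a b \<subseteq> U"
  shows "box_bump c a b \<in> test_functions U"
proof -
  have "{x. box_bump c a b x \<noteq> 0} \<subseteq> cbox a b"
    using box_bump_eq_0[of _ a b c] box_subset_cbox[of a b] by auto
  note compact_closure_subset[OF compact_cbox this]
  with assms Ck_box_bump show ?thesis
    by (auto simp: test_functions_def)
qed

lemma tendsto_box_bump:
  "(\<lambda>k. box_bump (1 / real (Suc k)) a b x) \<longlonglongrightarrow> indicator (box a b) x"
proof (cases "x \<in> box a b")
  case True
  have "(\<lambda>k. exp_recip (1 / real (Suc k)) 0 t) \<longlonglongrightarrow> 1" if "t > 0" for t
  proof -
    have "(\<lambda>k. exp (- (1 / real (Suc k)) / t)) \<longlonglongrightarrow> exp (- 0 / t)"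
      by (intro tendsto_intros LIMSEQ_Suc[OF lim_1_over_n]) (use that in auto)
    then show ?thesis
      using that by (simp add: exp_recip_def)
  qed
  then have "(\<lambda>k. box_bump (1 / real (Suc k)) a b x) \<longlonglongrightarrow> (\<Prod>i\<in>(Basis::'a set). 1 * 1)"
    unfolding box_bump_def using True by (intro tendsto_prod tendsto_mult) (auto simp: mem_box)
  then show ?thesis
    using True by simp
qed (simp add: box_bump_eq_0)

lemma test_function_mult:
  assumes "\<phi> \<in> test_functions U" and "\<And>k. Ck k p"
  shows "(\<lambda>x. p x * \<phi> x) \<in> test_functions U"
proof -
  have "{x. p x * \<phi> x \<noteq> 0} \<subseteq> closure {x. \<phi> x \<noteq> 0}"
    using closure_subset[of "{x. \<phi> x \<noteq> 0}"] by auto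
  note compact_closure_subset[OF _ this]
  then show ?thesis
    using assms by (auto simp: test_functions_def intro!: Ck_mult)
qed

lemma test_function_Ck: "\<phi> \<in> test_functions U \<Longrightarrow> Ck k \<phi>"
  by (simp add: test_functions_def)

lemma test_function_continuous_on: "\<phi> \<in> test_functions U \<Longrightarrow> continuous_on A \<phi>"
  using test_function_Ck Ck_continuous_on continuous_on_subset by blast

lemma test_function_support:
  assumes "\<phi> \<in> test_functions U"
  obtains K where "compact K" "K \<subseteq> U" "\<And>z. z \<notin> K \<Longrightarrow> \<phi> z = 0"
proof (rule that)
  show "compact (closure {x. \<phi> x \<noteq> 0})" "closure {x. \<phi> x \<noteq> 0} \<subseteq> U"
    using assms by (auto simp: test_functions_def)
  show "\<phi> z = 0" if "z \<notin> closure {x. \<phi> x \<noteq> 0}" for z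
    using that closure_subset[of "{x. \<phi> x \<noteq> 0}"] by auto
qed

lemma test_function_bounded:
  assumes "\<phi> \<in> test_functions U"
  obtains B where "B \<ge> 0" "\<And>z. \<bar>\<phi> z\<bar> \<le> B"
proof -
  obtain K where K: "compact K" "K \<subseteq> U" "\<And>z. z \<notin> K \<Longrightarrow> \<phi> z = 0"
    using test_function_support[OF assms] by blast
  have "bounded (\<phi> ` K)"
    using K test_function_continuous_on[OF assms] compact_continuous_image compact_imp_bounded by blast
  then obtain B where "\<And>z. z \<in> K \<Longrightarrow> \<bar>\<phi> z\<bar> \<le> B"
    by (auto simp: bounded_iff)
  then have "\<bar>\<phi> z\<bar> \<le> max B 0" for z
    using K by (cases "z \<in> K") force+
  then show ?thesis
    using that[of "max B 0"] by auto
qed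

lemma test_function_has_derivative:
  "\<phi> \<in> test_functions U \<Longrightarrow> (\<phi> has_derivative frechet_derivative \<phi> (at x)) (at x)"
  using Ck_Suc_has_derivative test_function_Ck by blast

lemma test_function_deriv:
  assumes "\<phi> \<in> test_functions U" "b \<in> Basis"
  shows "(\<lambda>z. frechet_derivative \<phi> (at z) b) \<in> test_functions U"
proof -
  let ?K = "closure {x. \<phi> x \<noteq> 0}"
  have "frechet_derivative \<phi> (at z) b = 0" if "z \<notin> ?K" for z
  proof -
    have "(\<phi> has_derivative (\<lambda>_. 0)) (at z)"
      by (rule has_derivative_transform_within_open[where s = "- ?K" and f = "\<lambda>_. 0"])
        (use that closure_subset[of "{x. \<phi> x \<noteq> 0}"] in \<open>auto simp: open_Compl\<close>)
    from frechet_derivative_at[OF this] show ?thesis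
      by metis
  qed
  then have "{z. frechet_derivative \<phi> (at z) b \<noteq> 0} \<subseteq> ?K"
    by auto
  note compact_closure_subset[OF _ this]
  moreover have "Ck k (\<lambda>z. frechet_derivative \<phi> (at z) b)" for k
    using test_function_Ck[OF assms(1), of "Suc k"] assms(2) by simp
  ultimately show ?thesis
    using assms by (auto simp: test_functions_def)
qed

lemma test_function_measurable:
  assumes "\<phi> \<in> test_functions U"
  shows "\<phi> \<in> borel_measurable borel" "\<phi> \<in> borel_measurable (lebesgue_on A)"
proof -
  show "\<phi> \<in> borel_measurable borel"
    using test_function_continuous_on[OF assms] by (rule borel_measurable_continuous_onI)
  then show "\<phi> \<in> borel_measurable (lebesgue_on A)"
    by (simp add: measurable_completion measurable_restrict_space1)
qed

section \<open>Locally integrable functions and the fundamental lemma of the calculus of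
  variations\<close>

lemma L1_loc_inner: "g \<in> L1_loc U \<Longrightarrow> (\<lambda>z. g z \<bullet> b) \<in> L1_loc U"
  by (auto simp: L1_loc_def L1_def)

text \<open>\<open>L1_loc\<close> speaks of compact subsets only; measurability is glued along a
  countable cover of the open set by closed boxes.\<close>

lemma L1_loc_measurable:
  fixes f :: "'a::euclidean_space \<Rightarrow> 'b::euclidean_space"
  assumes "open U" "f \<in> L1_loc U"
  shows "f \<in> borel_measurable (lebesgue_on U)"
proof -
  obtain D where D: "countable D" "D \<subseteq> Pow U" "\<And>X. X \<in> D \<Longrightarrow> \<exists>a b. X = cbox a b" "\<Union>D = U"
    using open_countable_Union_open_cbox[OF assms(1)] by blast
  show ?thesis
  proof (rule measurable_piecewise_restrict[OF D(1)])
    fix X assume X: "X \<in> D"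
    obtain a b where ab: "X = cbox a b"
      using D(3) X by blast
    then show "X \<inter> space (lebesgue_on U) \<in> sets (lebesgue_on U)"
      using D(2) X assms(1) by (auto simp: sets_restrict_space_iff)
    have "X \<subseteq> U"
      using D X by auto
    then have "f \<in> borel_measurable (lebesgue_on X)"
      using assms(2) ab borel_measurable_integrable[of "lebesgue_on X" f]
      by (auto simp: L1_loc_def L1_def)
    then show "f \<in> borel_measurable (restrict_space (lebesgue_on U) X)"
      using \<open>X \<subseteq> U\<close> ab assms(1) by (simp add: restrict_restrict_space inf.absorb2)
  qed (use D in auto)
qed

lemma integrable_on_compact_support:
  fixes f :: "'a::euclidean_space \<Rightarrow> 'b::euclidean_space"
  assumes "open U" "compact K" "K \<subseteq> U" "integrable (lebesgue_on K) f" "\<And>z. z \<notin> K \<Longrightarrow> f z = 0"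
  shows "integrable (lebesgue_on U) f"
proof -
  have "(\<lambda>x. indicator K x *\<^sub>R f x) = (\<lambda>x. indicator U x *\<^sub>R f x)"
    using assms(3,5) by (force simp: indicator_def fun_eq_iff)
  moreover have "integrable lebesgue (\<lambda>x. indicator K x *\<^sub>R f x)"
    using assms(2,4) by (simp add: integrable_restrict_space compact_imp_closed)
  ultimately show ?thesis
    using assms(1) by (simp add: integrable_restrict_space)
qed

lemma integrable_L1_loc_times_bounded:
  fixes f :: "'a::euclidean_space \<Rightarrow> real"
  assumes "open U" "f \<in> L1_loc U" "compact K" "K \<subseteq> U"
    and "h \<in> borel_measurable (lebesgue_on U)" "\<And>z. z \<in> U \<Longrightarrow> \<bar>h z\<bar> \<le> B" "\<And>z. z \<notin> K \<Longrightarrow> h z = 0"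
  shows "integrable (lebesgue_on U) (\<lambda>z. f z * h z)"
proof -
  have fK: "integrable (lebesgue_on K) f"
    using assms by (simp add: L1_loc_def L1_def)
  have "integrable (lebesgue_on K) (\<lambda>z. f z * h z)"
  proof (rule Bochner_Integration.integrable_bound[where f = "\<lambda>z. B * f z"])
    have "h \<in> borel_measurable (lebesgue_on K)"
      using measurable_restrict_space1[OF assms(5), of K] assms(1,4)
      by (simp add: restrict_restrict_space inf.absorb2 assms(3) compact_imp_closed)
    then show "(\<lambda>z. f z * h z) \<in> borel_measurable (lebesgue_on K)"
      using fK by measurable
    show "AE x in lebesgue_on K. norm (f x * h x) \<le> norm (B * f x)"
    proof (rule AE_I2)
      fix x assume "x \<in> space (lebesgue_on K)"
      then have "\<bar>h x\<bar> \<le> \<bar>B\<bar>"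
        using assms(4,6) by force
      then show "norm (f x * h x) \<le> norm (B * f x)"
        by (simp add: abs_mult mult.commute[of "\<bar>B\<bar>"] mult_left_mono)
    qed
  qed (use fK in simp)
  then show ?thesis
    by (rule integrable_on_compact_support[OF assms(1,3,4)]) (simp add: assms(7))
qed

lemma integrable_times_test:
  fixes f :: "'a::euclidean_space \<Rightarrow> real"
  assumes "open U" "f \<in> L1_loc U" "\<phi> \<in> test_functions U"
  shows "integrable (lebesgue_on U) (\<lambda>z. f z * \<phi> z)"
  using test_function_support[OF assms(3)] test_function_bounded[OF assms(3)]
    test_function_measurable(2)[OF assms(3)] integrable_L1_loc_times_bounded[OF assms(1,2)]
  by (metis (no_types, lifting))

text \<open>The bumps converge to the indicator of the open box and are dominated by that of the
  closed box, on which \<open>f\<close> is integrable; the faces are negligible.\<close>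

lemma integral_cbox_nonpos_if_test_nonpos:
  fixes f :: "'a::euclidean_space \<Rightarrow> real"
  assumes "open U" "f \<in> L1_loc U" "cbox a b \<subseteq> U"
    and "\<And>\<phi>. \<phi> \<in> test_functions U \<Longrightarrow> (\<And>z. 0 \<le> \<phi> z) \<Longrightarrow> (\<integral>z. f z * \<phi> z \<partial>lebesgue_on U) \<le> 0"
  shows "integral (cbox a b) f \<le> 0"
proof -
  let ?\<phi> = "\<lambda>k. box_bump (1 / real (Suc k)) a b"
  have test: "?\<phi> k \<in> test_functions U" for k
    using assms(3) by (intro box_bump_test_function) auto
  have fb: "integrable (lebesgue_on U) (\<lambda>z. f z * indicator (cbox a b) z)"
    by (rule integrable_L1_loc_times_bounded[OF assms(1,2) compact_cbox assms(3), where B = 1])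
      (auto simp: indicator_def measurable_completion measurable_restrict_space1)
  have "(\<lambda>k. \<integral>z. f z * ?\<phi> k z \<partial>lebesgue_on U)
      \<longlonglongrightarrow> (\<integral>z. f z * indicator (box a b) z \<partial>lebesgue_on U)"
  proof (rule integral_dominated_convergence[where w = "\<lambda>z. \<bar>f z * indicator (cbox a b) z\<bar>"])
    show "AE z in lebesgue_on U. (\<lambda>k. f z * ?\<phi> k z) \<longlonglongrightarrow> f z * indicator (box a b) z"
      by (intro AE_I2 tendsto_mult tendsto_const tendsto_box_bump)
    show "AE z in lebesgue_on U. norm (f z * ?\<phi> k z) \<le> \<bar>f z * indicator (cbox a b) z\<bar>" for k
    proof (rule AE_I2)
      fix z
      show "norm (f z * ?\<phi> k z) \<le> \<bar>f z * indicator (cbox a b) z\<bar>"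
        using box_bump_bounds[of "1 / real (Suc k)" a b z] box_bump_eq_0[of z a b "1 / real (Suc k)"]
          subsetD[OF box_subset_cbox[of a b], of z]
        by (cases "z \<in> box a b") (auto simp: abs_mult intro: mult_left_le)
    qed
    show "(\<lambda>z. f z * indicator (box a b) z) \<in> borel_measurable (lebesgue_on U)"
      using L1_loc_measurable[OF assms(1,2)]
      by (intro borel_measurable_times) (auto simp: measurable_completion measurable_restrict_space1)
    show "(\<lambda>z. f z * ?\<phi> k z) \<in> borel_measurable (lebesgue_on U)" for k
      using L1_loc_measurable[OF assms(1,2)] test_function_measurable(2)[OF test]
      by (intro borel_measurable_times)
  qed (use fb in auto)
  moreover have "(\<integral>z. f z * ?\<phi> k z \<partial>lebesgue_on U) \<le> 0" for k
    by (intro assms(4)[OF test] box_bump_bounds(1)) simp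
  ultimately have "(\<integral>z. f z * indicator (box a b) z \<partial>lebesgue_on U) \<le> 0"
    by (intro LIMSEQ_le_const2) auto
  also have "(\<integral>z. f z * indicator (box a b) z \<partial>lebesgue_on U) = (LINT z:box a b|lebesgue. f z)"
    using assms(1) subset_trans[OF box_subset_cbox assms(3)]
    by (auto simp: integral_restrict_space set_lebesgue_integral_def indicator_def
        intro!: Bochner_Integration.integral_cong)
  also have "\<dots> = integral (box a b) f"
  proof (rule set_lebesgue_integral_eq_integral(2))
    have "integrable (lebesgue_on (cbox a b)) f"
      using assms by (simp add: L1_loc_def L1_def)
    then have "set_integrable lebesgue (cbox a b) f"
      by (simp add: integrable_restrict_space set_integrable_def)
    then show "set_integrable lebesgue (box a b) f"
      by (rule set_integrable_subset) (auto simp: box_subset_cbox)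
  qed
  finally show ?thesis
    by (simp add: integral_open_interval)
qed

text \<open>Lebesgue differentiation along small cubes with corner \<open>x\<close>. The one-sided
  form is what turns a bound on integrals against nonnegative test functions into a pointwise bound
  on a weak gradient.\<close>

lemma AE_nonpos_if_test_nonpos:
  fixes f :: "'a::euclidean_space \<Rightarrow> real"
  assumes "open U" "f \<in> L1_loc U"
    and test: "\<And>\<phi>. \<phi> \<in> test_functions U \<Longrightarrow> (\<And>z. 0 \<le> \<phi> z)
      \<Longrightarrow> (\<integral>z. f z * \<phi> z \<partial>lebesgue_on U) \<le> 0"
  shows "AE z in lebesgue_on U. f z \<le> 0"
proof -
  obtain D where D: "countable D" "D \<subseteq> Pow U" "\<And>X. X \<in> D \<Longrightarrow> \<exists>a b. X = cbox a b" "\<Union>D = U"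
    using open_countable_Union_open_cbox[OF assms(1)] by blast
  have "\<exists>N. negligible N \<and> (\<forall>z\<in>X - N. f z \<le> 0)" if XD: "X \<in> D" for X
  proof -
    obtain c d where X: "X = cbox c d" and XU: "cbox c d \<subseteq> U"
      using D(2,3) XD by blast
    \<comment> \<open>Extension by zero, since the differentiation theorem asks for integrability on
      every box.\<close>
    define f1 where "f1 z = (if z \<in> cbox c d then f z else 0)" for z
    have "integrable (lebesgue_on (cbox c d)) f"
      using assms XU by (simp add: L1_loc_def L1_def)
    then have "f integrable_on cbox c d"
      by (simp add: integrable_on_lebesgue_on)
    then have "f1 integrable_on UNIV"
      unfolding f1_def by (simp add: integrable_restrict_UNIV)
    then have "f1 integrable_on cbox a b" for a b
      using integrable_on_subcbox by blast
    from integrable_ccontinuous_explicit[OF this]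
    obtain N where N: "negligible N"
      "\<And>x e. \<lbrakk>x \<notin> N; 0 < e\<rbrakk> \<Longrightarrow> \<exists>d>0. \<forall>h. 0 < h \<and> h < d \<longrightarrow>
          norm (integral (cbox x (x + h *\<^sub>R One)) f1 /\<^sub>R h ^ DIM('a) - f1 x) < e"
      by blast
    have "f x \<le> 0" if x: "x \<in> box c d" "x \<notin> N" for x
    proof (rule ccontr)
      assume "\<not> f x \<le> 0"
      then have pos: "0 < f1 x"
        using x box_subset_cbox[of c d] by (auto simp: f1_def)
      obtain \<delta> where \<delta>: "\<delta> > 0" "\<And>h. 0 < h \<Longrightarrow> h < \<delta> \<Longrightarrow>
          norm (integral (cbox x (x + h *\<^sub>R One)) f1 /\<^sub>R h ^ DIM('a) - f1 x) < f1 x"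
        using N(2)[OF x(2) pos] by blast
      obtain e where e: "e > 0" "ball x e \<subseteq> box c d"
        using x(1) open_box open_contains_ball by blast
      \<comment> \<open>Small enough for the differentiation estimate and for the cube to stay in
        the ball: points of the cube have l1 distance at most \<open>h * DIM('a)\<close> from its
        corner.\<close>
      define h where "h = min (\<delta> / 2) (e / (2 * real DIM('a)))"
      have h: "0 < h" "h < \<delta>" "h * real DIM('a) < e"
        using \<delta>(1) e(1) by (auto simp: h_def min_def field_simps)
      have sub: "cbox x (x + h *\<^sub>R One) \<subseteq> box c d"
      proof
        fix y assume y: "y \<in> cbox x (x + h *\<^sub>R One)"
        have "dist x y \<le> (\<Sum>i\<in>Basis. \<bar>(y - x) \<bullet> i\<bar>)"
          by (metis dist_commute dist_norm norm_le_l1)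
        also have "\<dots> \<le> (\<Sum>i\<in>(Basis::'a set). h)"
          using y by (intro sum_mono) (auto simp: mem_box inner_diff_left inner_add_left)
        also have "\<dots> < e"
          using h by (simp add: mult.commute)
        finally show "y \<in> box c d"
          using e by (auto simp: mem_ball)
      qed
      have "integral (cbox x (x + h *\<^sub>R One)) f1 = integral (cbox x (x + h *\<^sub>R One)) f"
        using sub box_subset_cbox[of c d] by (intro integral_cong) (auto simp: f1_def)
      also have "\<dots> \<le> 0"
        using sub box_subset_cbox[of c d] XU
        by (intro integral_cbox_nonpos_if_test_nonpos[OF assms(1,2) _ test]) auto
      finally have "integral (cbox x (x + h *\<^sub>R One)) f1 /\<^sub>R h ^ DIM('a) \<le> 0"
        using h(1) by (simp add: mult_nonneg_nonpos)
      then show False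
        using \<delta>(2)[OF h(1,2)] by simp
    qed
    \<comment> \<open>The faces of the box, which the differentiation argument leaves out, join the
      exceptional set.\<close>
    then show ?thesis
      using N(1) negligible_frontier_interval[of c d] unfolding X
      by (intro exI[of _ "N \<union> (cbox c d - box c d)"]) auto
  qed
  then obtain N where N: "\<And>X. X \<in> D \<Longrightarrow> negligible (N X)"
      "\<And>X z. X \<in> D \<Longrightarrow> z \<in> X - N X \<Longrightarrow> f z \<le> 0"
    by metis
  have "(\<Union>X\<in>D. N X) \<in> null_sets lebesgue"
    using N(1) D(1) by (simp add: negligible_iff_null_sets null_sets_UN')
  then have "AE z in lebesgue. z \<in> U \<longrightarrow> f z \<le> 0"
    by (rule AE_I') (use N(2) D(4) in blast)
  then show ?thesis
    using assms(1) by (simp add: AE_restrict_space_iff)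
qed

section \<open>Weak gradients of Lipschitz functions\<close>

lemma integral_lebesgue_on_eq_lborel:
  fixes f :: "'a::euclidean_space \<Rightarrow> real"
  assumes "open U" "f \<in> borel_measurable borel" "\<And>z. z \<notin> U \<Longrightarrow> f z = 0"
  shows "(\<integral>z. f z \<partial>lebesgue_on U) = (\<integral>z. f z \<partial>lborel)"
proof -
  have "(\<integral>z. f z \<partial>lebesgue_on U) = (\<integral>z. indicator U z *\<^sub>R f z \<partial>lebesgue)"
    using assms(1) by (simp add: integral_restrict_space)
  also have "(\<lambda>z. indicator U z *\<^sub>R f z) = f"
    using assms(3) by (force simp: indicator_def fun_eq_iff)
  finally show ?thesis
    using assms(2) by (simp add: integral_completion)
qed

lemma integrable_indicator_compact:
  fixes K :: "'a::euclidean_space set"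
  assumes "compact K"
  shows "integrable lborel (indicator K :: 'a \<Rightarrow> real)"
  using emeasure_bounded_finite[OF compact_imp_bounded[OF assms]] assms
  by (intro integrable_real_indicator) (auto simp: borel_compact)

lemma integrable_bounded_times_test:
  fixes W :: "'a::euclidean_space \<Rightarrow> real"
  assumes "\<phi> \<in> test_functions U" "W \<in> borel_measurable borel" "\<And>z. \<bar>W z\<bar> \<le> C"
  shows "integrable lborel (\<lambda>z. W z * \<phi> z)"
proof -
  obtain K where K: "compact K" "K \<subseteq> U" "\<And>z. z \<notin> K \<Longrightarrow> \<phi> z = 0"
    using test_function_support[OF assms(1)] by blast
  obtain B where B: "B \<ge> 0" "\<And>z. \<bar>\<phi> z\<bar> \<le> B"
    using test_function_bounded[OF assms(1)] by blast
  have [measurable]: "\<phi> \<in> borel_measurable borel" "W \<in> borel_measurable borel"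
    using test_function_measurable(1)[OF assms(1)] assms(2) by auto
  show ?thesis
  proof (rule Bochner_Integration.integrable_bound[where f = "\<lambda>z. (C * B) * indicator K z"])
    show "integrable lborel (\<lambda>z. (C * B) * indicator K z)"
      using K(1) by (intro integrable_mult_right integrable_indicator_compact)
    have "C \<ge> 0"
      using assms(3)[of undefined] by linarith
    then show "AE z in lborel. norm (W z * \<phi> z) \<le> norm (C * B * indicator K z)"
      using B assms(3) K(3) by (intro AE_I2) (auto simp: indicator_def abs_mult intro!: mult_mono)
  qed simp
qed

lemma integral_lborel_shift:
  fixes W \<phi> :: "'a::euclidean_space \<Rightarrow> real"
  assumes [measurable]: "W \<in> borel_measurable borel" "\<phi> \<in> borel_measurable borel"
  shows "(\<integral>z. W (z + a) * \<phi> z \<partial>lborel) = (\<integral>z. W z * \<phi> (z - a) \<partial>lborel)"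
proof -
  have "(\<integral>z. W z * \<phi> (z - a) \<partial>lborel) = (\<integral>z. W z * \<phi> (z - a) \<partial>distr lborel borel ((+) a))"
    by (simp add: lborel_distr_plus)
  also have "\<dots> = (\<integral>z. W (a + z) * \<phi> (a + z - a) \<partial>lborel)"
    by (subst integral_distr) auto
  finally show ?thesis
    by (simp add: add.commute)
qed

lemma test_function_translate:
  assumes "\<phi> \<in> test_functions U"
  shows "((\<lambda>s. \<phi> (z - s *\<^sub>R b)) has_real_derivative - frechet_derivative \<phi> (at (z - s *\<^sub>R b)) b) (at s)"
proof -
  have "((\<lambda>s. z - s *\<^sub>R b) has_derivative (\<lambda>s. - (s *\<^sub>R b))) (at s)"
    by (auto intro!: derivative_eq_intros)
  note D = has_derivative_compose[OF this test_function_has_derivative[OF assms]]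
  have "linear (frechet_derivative \<phi> (at (z - s *\<^sub>R b)))"
    using test_function_has_derivative[OF assms] has_derivative_linear by blast
  then show ?thesis
    unfolding has_field_derivative_def
    by (intro has_derivative_eq_rhs[OF D]) (simp add: fun_eq_iff linear_neg linear_scale)
qed

abbreviation diffq :: "('a::euclidean_space \<Rightarrow> real) \<Rightarrow> 'a \<Rightarrow> nat \<Rightarrow> 'a \<Rightarrow> real" where
  "diffq W b k z \<equiv> (W (z + inverse (real (Suc k)) *\<^sub>R b) - W z) / inverse (real (Suc k))"

text \<open>Discrete integration by parts: a translation of the integral moves the difference
  quotient from \<open>W\<close> onto \<phi>, where it converges to minus the derivative.\<close>

lemma integral_diffq_test_tendsto:
  fixes W :: "'a::euclidean_space \<Rightarrow> real"
  assumes "open U" "\<phi> \<in> test_functions U" "W \<in> borel_measurable borel" "\<And>z. \<bar>W z\<bar> \<le> C"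
    and "b \<in> Basis"
  shows "(\<lambda>k. \<integral>z. diffq W b k z * \<phi> z \<partial>lebesgue_on U)
     \<longlonglongrightarrow> - (\<integral>z. W z * frechet_derivative \<phi> (at z) b \<partial>lebesgue_on U)"
proof -
  let ?h = "\<lambda>k. inverse (real (Suc k))"
  let ?D = "\<lambda>z. frechet_derivative \<phi> (at z) b"
  note D = test_function_deriv[OF assms(2,5)]
  have [measurable]: "\<phi> \<in> borel_measurable borel" "W \<in> borel_measurable borel"
      "?D \<in> borel_measurable borel"
    using test_function_measurable(1)[OF assms(2)] test_function_measurable(1)[OF D] assms(3) by auto
  obtain K where K: "compact K" "K \<subseteq> U" "\<And>z. z \<notin> K \<Longrightarrow> \<phi> z = 0"
    using test_function_support[OF assms(2)] by blast
  obtain KD where KD: "compact KD" "KD \<subseteq> U" "\<And>z. z \<notin> KD \<Longrightarrow> ?D z = 0"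
    using test_function_support[OF D] by blast
  obtain B where B: "B \<ge> 0" "\<And>z. \<bar>?D z\<bar> \<le> B"
    using test_function_bounded[OF D] by blast
  have C: "C \<ge> 0"
    using assms(4)[of undefined] by linarith
  have "(\<integral>z. diffq W b k z * \<phi> z \<partial>lebesgue_on U)
      = (\<integral>z. W z * ((\<phi> (z - ?h k *\<^sub>R b) - \<phi> z) / ?h k) \<partial>lborel)" for k
  proof -
    have "(\<integral>z. diffq W b k z * \<phi> z \<partial>lebesgue_on U) = (\<integral>z. diffq W b k z * \<phi> z \<partial>lborel)"
      using K by (intro integral_lebesgue_on_eq_lborel assms(1)) auto
    also have "\<dots> = (\<integral>z. (W (z + ?h k *\<^sub>R b) * \<phi> z - W z * \<phi> z) / ?h k \<partial>lborel)"
      by (simp add: field_simps)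
    also have "\<dots> = ((\<integral>z. W (z + ?h k *\<^sub>R b) * \<phi> z \<partial>lborel) - (\<integral>z. W z * \<phi> z \<partial>lborel)) / ?h k"
      by (subst integral_divide_zero, subst Bochner_Integration.integral_diff)
        (intro integrable_bounded_times_test[OF assms(2), where C = C] assms(4) |
          simp add: assms(4) del: inverse_Suc)+
    also have "(\<integral>z. W (z + ?h k *\<^sub>R b) * \<phi> z \<partial>lborel) = (\<integral>z. W z * \<phi> (z - ?h k *\<^sub>R b) \<partial>lborel)"
      by (rule integral_lborel_shift) auto
    also have "(\<integral>z. W z * \<phi> (z - ?h k *\<^sub>R b) \<partial>lborel) - (\<integral>z. W z * \<phi> z \<partial>lborel) =
        (\<integral>z. W z * \<phi> (z - ?h k *\<^sub>R b) - W z * \<phi> z \<partial>lborel)"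
    proof (rule Bochner_Integration.integral_diff[symmetric])
      have "integrable lborel (\<lambda>z. W (?h k *\<^sub>R b + z) * \<phi> z)"
        by (intro integrable_bounded_times_test[OF assms(2), where C = C] assms(4)) simp
      then have "integrable (distr lborel borel ((+) (?h k *\<^sub>R b))) (\<lambda>z. W z * \<phi> (z - ?h k *\<^sub>R b))"
        by (subst integrable_distr_eq) auto
      then show "integrable lborel (\<lambda>z. W z * \<phi> (z - ?h k *\<^sub>R b))"
        by (simp add: lborel_distr_plus)
    qed (intro integrable_bounded_times_test[OF assms(2), where C = C] assms(3,4))
    also have "\<dots> / ?h k = (\<integral>z. W z * ((\<phi> (z - ?h k *\<^sub>R b) - \<phi> z) / ?h k) \<partial>lborel)"
      by (subst integral_divide_zero[symmetric]) (simp add: field_simps)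
    finally show ?thesis .
  qed
  moreover have "(\<lambda>k. \<integral>z. W z * ((\<phi> (z - ?h k *\<^sub>R b) - \<phi> z) / ?h k) \<partial>lborel)
      \<longlonglongrightarrow> (\<integral>z. W z * - ?D z \<partial>lborel)"
  proof -
    \<comment> \<open>The translations have length at most 1, so all difference quotients of \<phi>
      vanish outside this compact neighbourhood of its support.\<close>
    define K1 where "K1 = {x + y |x y. x \<in> K \<and> y \<in> cball 0 1}"
    have K1: "compact K1"
      unfolding K1_def by (intro compact_sums K compact_cball)
    have b1: "norm b = 1"
      using assms(5) by simp
    \<comment> \<open>The mean value theorem bounds the quotients uniformly in \<open>k\<close>, as
      dominated convergence requires.\<close>
    have mvt: "\<bar>(\<phi> (z - ?h k *\<^sub>R b) - \<phi> z) / ?h k\<bar> \<le> B" for z k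
    proof -
      have h: "0 < ?h k" by simp
      from MVT2[OF h test_function_translate[OF assms(2)], of z b]
      obtain s where "\<phi> (z - ?h k *\<^sub>R b) - \<phi> (z - 0 *\<^sub>R b) = (?h k - 0) * - ?D (z - s *\<^sub>R b)"
        by blast
      then have "\<bar>(\<phi> (z - ?h k *\<^sub>R b) - \<phi> z) / ?h k\<bar> = \<bar>?D (z - s *\<^sub>R b)\<bar>"
        by simp
      then show ?thesis
        using B(2) by simp
    qed
    show ?thesis
    proof (rule integral_dominated_convergence[where w = "\<lambda>z. (C * B) * indicator K1 z"])
      show "integrable lborel (\<lambda>z. (C * B) * indicator K1 z)"
        using K1 by (intro integrable_mult_right integrable_indicator_compact)
      show "AE z in lborel. (\<lambda>k. W z * ((\<phi> (z - ?h k *\<^sub>R b) - \<phi> z) / ?h k)) \<longlonglongrightarrow> W z * - ?D z"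
      proof (intro AE_I2 tendsto_mult tendsto_const)
        fix z
        have "((\<lambda>s. (\<phi> (z - s *\<^sub>R b) - \<phi> z) / s) \<longlongrightarrow> - ?D z) (at 0)"
          using test_function_translate[OF assms(2), of z b 0]
          by (simp add: has_field_derivative_iff)
        moreover have "filterlim ?h (at 0) sequentially"
          using LIMSEQ_inverse_real_of_nat by (auto simp: filterlim_at)
        ultimately show "(\<lambda>k. (\<phi> (z - ?h k *\<^sub>R b) - \<phi> z) / ?h k) \<longlonglongrightarrow> - ?D z"
          by (rule filterlim_compose)
      qed
      show "AE z in lborel. norm (W z * ((\<phi> (z - ?h k *\<^sub>R b) - \<phi> z) / ?h k))
          \<le> (C * B) * indicator K1 z" for k
      proof (rule AE_I2)
        fix z
        show "norm (W z * ((\<phi> (z - ?h k *\<^sub>R b) - \<phi> z) / ?h k)) \<le> (C * B) * indicator K1 z"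
        proof (cases "z \<in> K1")
          case True
          have "norm (W z * ((\<phi> (z - ?h k *\<^sub>R b) - \<phi> z) / ?h k)) \<le> C * B"
            unfolding real_norm_def abs_mult by (intro mult_mono mvt assms(4) C) simp
          then show ?thesis
            using True by simp
        next
          case False
          have "z \<notin> K"
          proof
            assume "z \<in> K"
            then have "z + 0 \<in> K1"
              unfolding K1_def by force
            with False show False by simp
          qed
          moreover have "z - ?h k *\<^sub>R b \<notin> K"
          proof
            assume "z - ?h k *\<^sub>R b \<in> K"
            moreover have "?h k *\<^sub>R b \<in> cball 0 1"
              using b1 by (simp add: inverse_le_1_iff)
            ultimately have "(z - ?h k *\<^sub>R b) + ?h k *\<^sub>R b \<in> K1"
              unfolding K1_def by blast
            with False show False by simp
          qed
          ultimately show ?thesis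
            using K(3) False by simp
        qed
      qed
    qed auto
  qed
  moreover have "(\<integral>z. W z * - ?D z \<partial>lborel) = - (\<integral>z. W z * ?D z \<partial>lebesgue_on U)"
  proof -
    have "(\<integral>z. W z * ?D z \<partial>lebesgue_on U) = (\<integral>z. W z * ?D z \<partial>lborel)"
      using KD by (intro integral_lebesgue_on_eq_lborel assms(1)) auto
    then show ?thesis
      by simp
  qed
  ultimately show ?thesis
    by simp
qed

lemma abs_integral_le_AE:
  fixes f h :: "'a \<Rightarrow> real"
  assumes "integrable M h" "AE x in M. \<bar>f x\<bar> \<le> h x"
  shows "\<bar>integral\<^sup>L M f\<bar> \<le> integral\<^sup>L M h"
proof (cases "integrable M f")
  case True
  have "\<bar>integral\<^sup>L M f\<bar> \<le> (\<integral>x. \<bar>f x\<bar> \<partial>M)"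
    by (rule integral_abs_bound)
  also have "\<dots> \<le> integral\<^sup>L M h"
    using True assms by (intro integral_mono_AE) auto
  finally show ?thesis .
next
  case False
  \<comment> \<open>A non-integrable \<open>f\<close> has integral 0 by convention, so nonnegativity
    of \<open>h\<close> is all that remains.\<close>
  have "AE x in M. 0 \<le> h x"
    using assms(2) by eventually_elim auto
  then show ?thesis
    using False by (simp add: not_integrable_integral_eq integral_nonneg_AE)
qed

lemma L1_loc_bounded:
  fixes f :: "'a::euclidean_space \<Rightarrow> 'b::euclidean_space"
  assumes "open U" "f \<in> borel_measurable (lebesgue_on U)" "\<And>z. z \<in> U \<Longrightarrow> norm (f z) \<le> C"
  shows "f \<in> L1_loc U"
  unfolding L1_loc_def L1_def
proof clarsimp
  fix K assume K: "compact K" "K \<subseteq> U"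
  then have fK: "f \<in> borel_measurable (lebesgue_on K)"
    using measurable_restrict_space1[OF assms(2), of K] assms(1)
    by (simp add: restrict_restrict_space inf.absorb2 compact_imp_closed)
  interpret finite_measure "lebesgue_on K"
    using K(1) by (simp add: finite_measure_lebesgue_on lmeasurable_compact)
  show "integrable (lebesgue_on K) f"
    using K assms(3) by (intro integrable_const_bound[where B = C] AE_I2 fK) auto
qed

lemma continuous_on_measurable_lebesgue_on:
  fixes f :: "'a::euclidean_space \<Rightarrow> 'b::euclidean_space"
  shows "open U \<Longrightarrow> continuous_on U f \<Longrightarrow> f \<in> borel_measurable (lebesgue_on U)"
  by (simp add: continuous_imp_measurable_on_sets_lebesgue)

text \<open>A differentiable approximation of the positive part: the supremum of \<open>\<mu> * t - d * \<mu>\<^sup>2 / 2\<close> over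
  \<open>0 \<le> \<mu> \<le> 1\<close>, attained at its derivative \<open>pos_slope d t\<close>.\<close>

definition pos_slope :: "real \<Rightarrow> real \<Rightarrow> real" where
  "pos_slope d t = max 0 (min 1 (t / d))"

definition pos_smooth :: "real \<Rightarrow> real \<Rightarrow> real" where
  "pos_smooth d t = pos_slope d t * t - d * (pos_slope d t)\<^sup>2 / 2"

lemma pos_slope_bounds: "0 \<le> pos_slope d t" "pos_slope d t \<le> 1"
  by (auto simp: pos_slope_def)

text \<open>\<open>pos_slope d t\<close> is the projection of \<open>t / d\<close> to the unit
  interval. The sign of the product in the proof is first-order optimality of this projection; the
  values then differ by minus that product plus a square.\<close>

lemma pos_smooth_ge:
  assumes "d > 0" "0 \<le> \<mu>" "\<mu> \<le> 1"
  shows "\<mu> * t - d * \<mu>\<^sup>2 / 2 \<le> pos_smooth d t"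
proof -
  let ?m = "pos_slope d t"
  have "(\<mu> - ?m) * (t - d * ?m) \<le> 0"
  proof -
    consider "t < 0" | "0 \<le> t" "t \<le> d" | "t > d" by linarith
    then show ?thesis
    proof cases
      case 1
      then have "t / d < 0"
        using assms(1) by (simp add: divide_neg_pos)
      then have "?m = 0"
        by (simp add: pos_slope_def)
      then show ?thesis
        using 1 assms by (simp add: mult_nonneg_nonpos)
    next
      case 2
      then have "?m = t / d"
        using assms(1) by (simp add: pos_slope_def max_def min_def)
      then show ?thesis
        using assms(1) by simp
    next
      case 3
      then have "?m = 1"
        using assms(1) by (simp add: pos_slope_def max_def min_def)
      then show ?thesis
        using 3 assms by (simp add: mult_nonpos_nonneg)
    qed
  qed
  moreover have "pos_smooth d t - (\<mu> * t - d * \<mu>\<^sup>2 / 2)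
      = - ((\<mu> - ?m) * (t - d * ?m)) + d / 2 * (\<mu> - ?m)\<^sup>2"
    unfolding pos_smooth_def by (simp add: power2_eq_square field_simps)
  moreover have "0 \<le> d / 2 * (\<mu> - ?m)\<^sup>2"
    using assms(1) by simp
  ultimately show ?thesis
    by linarith
qed

lemma pos_smooth_bounds:
  assumes "d > 0"
  shows "0 \<le> pos_smooth d t" "pos_smooth d t \<le> max t 0" "max t 0 - d / 2 \<le> pos_smooth d t"
proof -
  show "0 \<le> pos_smooth d t"
    using pos_smooth_ge[OF assms, of 0 t] by simp
  show "max t 0 - d / 2 \<le> pos_smooth d t"
    using pos_smooth_ge[OF assms, of 0 t] pos_smooth_ge[OF assms, of 1 t] assms
    by (simp add: max_def)
  have "pos_smooth d t \<le> pos_slope d t * t"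
    unfolding pos_smooth_def using assms by simp
  also have "\<dots> \<le> pos_slope d t * max t 0"
    by (intro mult_left_mono pos_slope_bounds) simp
  also have "\<dots> \<le> 1 * max t 0"
    by (intro mult_right_mono pos_slope_bounds) simp
  finally show "pos_smooth d t \<le> max t 0"
    by simp
qed

lemma pos_slope_lipschitz: "d > 0 \<Longrightarrow> \<bar>pos_slope d s - pos_slope d t\<bar> \<le> \<bar>s - t\<bar> / d"
proof -
  assume d: "d > 0"
  have "\<bar>pos_slope d s - pos_slope d t\<bar> \<le> \<bar>s / d - t / d\<bar>"
    unfolding pos_slope_def by (simp add: max_def min_def abs_if)
  then show ?thesis
    using d by (simp add: diff_divide_distrib[symmetric])
qed

text \<open>As a supremum of affine functions, \<open>pos_smooth d\<close> lies above its tangents.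
  Exchanging \<open>s\<close> and \<open>t\<close> bounds the remainder by the change of slope times
  the step, and the slope is Lipschitz with constant \<open>1 / d\<close>.\<close>

lemma pos_smooth_taylor:
  assumes "d > 0"
  shows "\<bar>pos_smooth d s - pos_smooth d t - pos_slope d t * (s - t)\<bar> \<le> (s - t)\<^sup>2 / d"
proof -
  have *: "0 \<le> pos_smooth d s - pos_smooth d t - pos_slope d t * (s - t)" for s t
    using pos_smooth_ge[OF assms pos_slope_bounds[of d t], of s]
    unfolding pos_smooth_def[of d t] by (simp add: algebra_simps)
  have "pos_smooth d s - pos_smooth d t - pos_slope d t * (s - t)
      \<le> (pos_slope d s - pos_slope d t) * (s - t)"
    using *[of t s] by (simp add: algebra_simps)
  also have "\<dots> \<le> \<bar>pos_slope d s - pos_slope d t\<bar> * \<bar>s - t\<bar>"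
    by (metis abs_ge_self abs_mult)
  also have "\<dots> \<le> \<bar>s - t\<bar> / d * \<bar>s - t\<bar>"
    by (intro mult_right_mono pos_slope_lipschitz assms) simp
  also have "\<dots> = (s - t)\<^sup>2 / d"
    by (simp add: power2_eq_square)
  finally show ?thesis
    using *[of s t] by linarith
qed

section \<open>Chain rule for the positive part of a Lipschitz function\<close>

locale lipschitz_weak_gradient =
  fixes U :: "'a::euclidean_space set" and w :: "'a \<Rightarrow> real" and g :: "'a \<Rightarrow> 'a" and L :: real
  assumes open_U: "open U" and bounded_U: "bounded U"
    and lipschitz: "L-lipschitz_on U w" and gradient: "has_weak_gradient U w g"
begin

text \<open>Extension by zero makes all translates of \<open>w\<close> meaningful. It may jump
  across the boundary of \<open>U\<close>, but on a compact subset of \<open>U\<close> sufficiently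
  short translations do not see the jump.\<close>

definition W :: "'a \<Rightarrow> real" where "W z = indicator U z * w z"

lemma L_nonneg: "0 \<le> L"
  using lipschitz lipschitz_on_nonneg by blast

lemma w_continuous: "continuous_on U w"
  using lipschitz lipschitz_on_continuous_on by blast

lemma W_measurable [measurable]: "W \<in> borel_measurable borel"
  using borel_measurable_continuous_on_indicator[OF _ w_continuous] open_U
  unfolding W_def[abs_def] by simp

lemma W_bounded: obtains C where "C \<ge> 0" "\<And>z. \<bar>W z\<bar> \<le> C"
proof -
  have "bounded (w ` U)"
    using lipschitz_on_uniformly_continuous[OF lipschitz] bounded_U
    by (rule bounded_uniformly_continuous_image)
  then obtain C where "\<And>z. z \<in> U \<Longrightarrow> \<bar>w z\<bar> \<le> C"
    by (auto simp: bounded_iff)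
  then have "\<bar>W z\<bar> \<le> max C 0" for z
    by (cases "z \<in> U") (force simp: W_def)+
  then show ?thesis
    using that[of "max C 0"] by auto
qed

lemma W_eq: "z \<in> U \<Longrightarrow> W z = w z"
  by (simp add: W_def)

lemma g_L1_loc: "g \<in> L1_loc U"
  using gradient by (simp add: has_weak_gradient_def)

lemma gb_L1_loc: "(\<lambda>z. g z \<bullet> b) \<in> L1_loc U"
  using g_L1_loc by (rule L1_loc_inner)

lemma diffq_test_tendsto:
  assumes "\<phi> \<in> test_functions U" "b \<in> Basis"
  shows "(\<lambda>k. \<integral>z. diffq W b k z * \<phi> z \<partial>lebesgue_on U) \<longlonglongrightarrow> (\<integral>z. (g z \<bullet> b) * \<phi> z \<partial>lebesgue_on U)"
proof -
  obtain C where C: "C \<ge> 0" "\<And>z. \<bar>W z\<bar> \<le> C"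
    using W_bounded by blast
  have "(\<integral>z. W z * frechet_derivative \<phi> (at z) b \<partial>lebesgue_on U)
      = (\<integral>z. w z * frechet_derivative \<phi> (at z) b \<partial>lebesgue_on U)"
    by (intro Bochner_Integration.integral_cong) (auto simp: W_eq)
  also have "\<dots> = - (\<integral>z. (g z \<bullet> b) * \<phi> z \<partial>lebesgue_on U)"
    using gradient assms by (simp add: has_weak_gradient_def)
  finally show ?thesis
    using integral_diffq_test_tendsto[OF open_U assms(1) W_measurable C(2) assms(2)] by simp
qed

lemma eventually_diffq_le:
  assumes "compact K" "K \<subseteq> U" "b \<in> Basis"
  shows "\<forall>\<^sub>F k in sequentially. \<forall>z\<in>K. \<bar>W (z + inverse (real (Suc k)) *\<^sub>R b) - W z\<bar> \<le> L * inverse (real (Suc k))"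
proof -
  obtain e where e: "e > 0" "(\<Union>x\<in>K. ball x e) \<subseteq> U"
    using compact_subset_open_imp_ball_epsilon_subset[OF assms(1) open_U assms(2)] by blast
  have "\<forall>\<^sub>F k in sequentially. inverse (real (Suc k)) < e"
    using order_tendstoD(2)[OF LIMSEQ_inverse_real_of_nat e(1)] .
  then show ?thesis
  proof eventually_elim
    case (elim k)
    show ?case
    proof
      fix z assume z: "z \<in> K"
      let ?y = "z + inverse (real (Suc k)) *\<^sub>R b"
      have d: "dist ?y z = inverse (real (Suc k))"
        using assms(3) by (simp add: dist_norm)
      then have "?y \<in> ball z e"
        using elim by (simp add: dist_commute mem_ball)
      then have "?y \<in> U" "z \<in> U"
        using e(2) z assms(2) by blast+
      then show "\<bar>W ?y - W z\<bar> \<le> L * inverse (real (Suc k))"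
        using lipschitz_onD[OF lipschitz, of ?y z] d by (simp add: W_eq dist_real_def)
    qed
  qed
qed

lemma eventually_diffq_le_test:
  assumes "\<phi> \<in> test_functions U" "b \<in> Basis"
  shows "\<forall>\<^sub>F k in sequentially. \<forall>z. \<bar>diffq W b k z * \<phi> z\<bar> \<le> L * \<bar>\<phi> z\<bar>"
proof -
  obtain K where K: "compact K" "K \<subseteq> U" "\<And>z. z \<notin> K \<Longrightarrow> \<phi> z = 0"
    using test_function_support[OF assms(1)] by blast
  show ?thesis
    using eventually_diffq_le[OF K(1,2) assms(2)]
  proof eventually_elim
    case (elim k)
    show ?case
    proof
      fix z
      show "\<bar>diffq W b k z * \<phi> z\<bar> \<le> L * \<bar>\<phi> z\<bar>"
      proof (cases "z \<in> K")
        case True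
        have "0 < inverse (real (Suc k))"
          by simp
        then have "\<bar>diffq W b k z\<bar> \<le> L"
          using elim True by (simp only: abs_divide) (simp only: pos_divide_le_eq abs_of_pos)
        then have "\<bar>diffq W b k z\<bar> * \<bar>\<phi> z\<bar> \<le> L * \<bar>\<phi> z\<bar>"
          by (rule mult_right_mono) simp
        then show ?thesis
          by (simp only: abs_mult)
      qed (simp add: K(3))
    qed
  qed
qed

lemma const_L1_loc: "(\<lambda>z. c::real) \<in> L1_loc U"
  by (rule L1_loc_bounded[OF open_U, where C = "\<bar>c\<bar>"]) auto

lemma integral_gb_test_le:
  assumes "\<phi> \<in> test_functions U" "b \<in> Basis"
  shows "\<bar>\<integral>z. (g z \<bullet> b) * \<phi> z \<partial>lebesgue_on U\<bar> \<le> L * (\<integral>z. \<bar>\<phi> z\<bar> \<partial>lebesgue_on U)"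
proof (rule LIMSEQ_le_const2[OF tendsto_rabs[OF diffq_test_tendsto[OF assms]]])
  have \<phi>: "integrable (lebesgue_on U) \<phi>"
    using integrable_times_test[OF open_U const_L1_loc assms(1), of 1] by simp
  have "\<forall>\<^sub>F k in sequentially. \<bar>\<integral>z. diffq W b k z * \<phi> z \<partial>lebesgue_on U\<bar>
      \<le> L * (\<integral>z. \<bar>\<phi> z\<bar> \<partial>lebesgue_on U)"
    using eventually_diffq_le_test[OF assms]
  proof eventually_elim
    case (elim k)
    have "\<bar>\<integral>z. diffq W b k z * \<phi> z \<partial>lebesgue_on U\<bar> \<le> (\<integral>z. L * \<bar>\<phi> z\<bar> \<partial>lebesgue_on U)"
      using elim \<phi> by (intro abs_integral_le_AE) auto
    then show ?case
      by simp
  qed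
  then show "\<exists>N. \<forall>k\<ge>N. \<bar>\<integral>z. diffq W b k z * \<phi> z \<partial>lebesgue_on U\<bar>
      \<le> L * (\<integral>z. \<bar>\<phi> z\<bar> \<partial>lebesgue_on U)"
    by (simp add: eventually_sequentially)
qed

text \<open>The Lipschitz bound on difference quotients survives the limit when tested against
  \<phi>, and the one-sided fundamental lemma makes it pointwise; the signs 1 and -1 together give
  the absolute value.\<close>

lemma AE_gradient_le:
  assumes "b \<in> Basis"
  shows "AE z in lebesgue_on U. \<bar>g z \<bullet> b\<bar> \<le> L"
proof -
  have A: "AE z in lebesgue_on U. s * (g z \<bullet> b) - L \<le> 0" if s: "\<bar>s\<bar> = 1" for s
  proof (rule AE_nonpos_if_test_nonpos[OF open_U])
    show "(\<lambda>z. s * (g z \<bullet> b) - L) \<in> L1_loc U"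
      using gb_L1_loc[of b] const_L1_loc[of L] by (auto simp: L1_loc_def L1_def)
    fix \<phi> assume \<phi>: "\<phi> \<in> test_functions U" "\<And>z. 0 \<le> \<phi> z"
    have "(\<integral>z. (s * (g z \<bullet> b) - L) * \<phi> z \<partial>lebesgue_on U)
        = (\<integral>z. s * ((g z \<bullet> b) * \<phi> z) - L * \<phi> z \<partial>lebesgue_on U)"
      by (simp add: algebra_simps)
    also have "\<dots> = s * (\<integral>z. (g z \<bullet> b) * \<phi> z \<partial>lebesgue_on U) - L * (\<integral>z. \<phi> z \<partial>lebesgue_on U)"
      using integrable_times_test[OF open_U const_L1_loc[of 1] \<phi>(1)]
        integrable_times_test[OF open_U gb_L1_loc[of b] \<phi>(1)]
      by simp
    also have "\<dots> \<le> 0"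
    proof -
      have "s * (\<integral>z. (g z \<bullet> b) * \<phi> z \<partial>lebesgue_on U) \<le> \<bar>\<integral>z. (g z \<bullet> b) * \<phi> z \<partial>lebesgue_on U\<bar>"
        using s by (metis abs_ge_self abs_mult mult_1)
      then show ?thesis
        using integral_gb_test_le[OF \<phi>(1) assms] \<phi>(2) by simp
    qed
    finally show "(\<integral>z. (s * (g z \<bullet> b) - L) * \<phi> z \<partial>lebesgue_on U) \<le> 0" .
  qed
  have "AE z in lebesgue_on U. (g z \<bullet> b) - L \<le> 0"
    using A[of 1] by simp
  moreover have "AE z in lebesgue_on U. - (g z \<bullet> b) - L \<le> 0"
    using A[of "-1"] by simp
  ultimately show ?thesis
    by eventually_elim auto
qed

end

lemma pos_slope_times_le: "\<bar>pos_slope d t\<bar> * \<bar>x\<bar> \<le> \<bar>x\<bar>"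
  using pos_slope_bounds[of d t] by (simp add: mult_left_le_one_le)

context lipschitz_weak_gradient
begin

lemma diffq_L1_loc:
  assumes F: "F \<in> borel_measurable borel" and C: "\<And>z. \<bar>F z\<bar> \<le> C"
  shows "diffq F b k \<in> L1_loc U"
proof (rule L1_loc_bounded[OF open_U])
  have "diffq F b k \<in> borel_measurable borel"
    using F by measurable
  then show "diffq F b k \<in> borel_measurable (lebesgue_on U)"
    by (simp add: measurable_completion measurable_restrict_space1)
  fix z
  have "\<bar>F (z + inverse (real (Suc k)) *\<^sub>R b) - F z\<bar> \<le> 2 * C"
    using C[of z] C[of "z + inverse (real (Suc k)) *\<^sub>R b"] by linarith
  then show "norm (diffq F b k z) \<le> 2 * C / inverse (real (Suc k))"
    unfolding real_norm_def abs_divide by (intro frac_le) auto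
qed

text \<open>The product of \<zeta> and \<phi> need not be smooth, so the convergence against test
  functions does not apply to it. By Stone-Weierstrass, \<zeta> is close to a polynomial on the
  support of \<phi>; as both the difference quotients and the gradient are bounded by
  \<open>L\<close> there, the replacement costs little, uniformly in \<open>k\<close>.\<close>

lemma integral_diffq_continuous_tendsto:
  assumes "\<phi> \<in> test_functions U" "b \<in> Basis" "continuous_on U \<zeta>"
  shows "(\<lambda>k. \<integral>z. diffq W b k z * (\<zeta> z * \<phi> z) \<partial>lebesgue_on U)
    \<longlonglongrightarrow> (\<integral>z. (g z \<bullet> b) * (\<zeta> z * \<phi> z) \<partial>lebesgue_on U)"
proof (rule LIMSEQ_I)
  fix e :: real assume e: "e > 0"
  obtain K where K: "compact K" "K \<subseteq> U" "\<And>z. z \<notin> K \<Longrightarrow> \<phi> z = 0"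
    using test_function_support[OF assms(1)] by blast
  obtain C where C: "C \<ge> 0" "\<And>z. \<bar>W z\<bar> \<le> C"
    using W_bounded by blast
  have \<phi>: "integrable (lebesgue_on U) \<phi>"
    using integrable_times_test[OF open_U const_L1_loc assms(1), of 1] by simp
  define A where "A = (\<integral>z. \<bar>\<phi> z\<bar> \<partial>lebesgue_on U)"
  have "A \<ge> 0"
    unfolding A_def by simp
  \<comment> \<open>The summand 1 keeps the denominator positive when \<open>L * A\<close> vanishes;
    each of the two replacement errors becomes at most \<open>e / 4\<close>.\<close>
  define c where "c = e / (4 * (L * A + 1))"
  have LA: "0 \<le> L * A"
    using L_nonneg \<open>A \<ge> 0\<close> by simp
  have "c > 0"
    using e LA unfolding c_def by (intro divide_pos_pos mult_pos_pos) auto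
  have "L * A * c \<le> (L * A + 1) * c"
    using \<open>c > 0\<close> by (intro mult_right_mono) auto
  also have "\<dots> = e / 4"
    using LA unfolding c_def by (simp add: field_simps)
  finally have c4: "L * c * A \<le> e / 4"
    by (simp add: mult_ac)
  obtain p where p: "real_polynomial_function p" "\<And>x. x \<in> K \<Longrightarrow> \<bar>\<zeta> x - p x\<bar> < c"
    using Stone_Weierstrass_real_polynomial_function[OF K(1) continuous_on_subset[OF assms(3) K(2)] \<open>c > 0\<close>]
    by blast
  define q where "q z = (\<zeta> z - p z) * \<phi> z" for z
  have p\<phi>: "(\<lambda>z. p z * \<phi> z) \<in> test_functions U"
    using assms(1) Ck_real_polynomial_function[OF p(1)] by (rule test_function_mult)
  have q_le: "\<bar>q z\<bar> \<le> c * \<bar>\<phi> z\<bar>" for z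
    using p(2)[of z] K(3)[of z] by (cases "z \<in> K") (auto simp: q_def abs_mult intro: mult_right_mono)
  obtain B where B: "B \<ge> 0" "\<And>z. \<bar>\<phi> z\<bar> \<le> B"
    using test_function_bounded[OF assms(1)] by blast
  have q_bd: "\<bar>q z\<bar> \<le> c * B" for z
    using q_le[of z] mult_left_mono[OF B(2), of c z] \<open>c > 0\<close> by linarith
  have q_meas: "q \<in> borel_measurable (lebesgue_on U)"
  proof -
    have "continuous_on U p"
      using Ck_continuous_on[OF Ck_real_polynomial_function[OF p(1)]] continuous_on_subset by blast
    then have "continuous_on U q"
      unfolding q_def using assms(3) test_function_continuous_on[OF assms(1)]
      by (intro continuous_on_mult continuous_on_diff)
    then show ?thesis
      by (rule continuous_on_measurable_lebesgue_on[OF open_U])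
  qed
  have int: "integrable (lebesgue_on U) (\<lambda>z. f z * q z)" if "f \<in> L1_loc U" for f
    by (rule integrable_L1_loc_times_bounded[OF open_U that K(1,2) q_meas q_bd]) (simp add: q_def K(3))
  note diffq_L1 = diffq_L1_loc[OF W_measurable C(2), where b = b]
  have split: "(\<integral>z. f z * (\<zeta> z * \<phi> z) \<partial>lebesgue_on U)
      = (\<integral>z. f z * (p z * \<phi> z) \<partial>lebesgue_on U) + (\<integral>z. f z * q z \<partial>lebesgue_on U)"
    if "f \<in> L1_loc U" for f
    using integrable_times_test[OF open_U that p\<phi>] int[OF that]
    by (subst Bochner_Integration.integral_add[symmetric]) (auto simp: q_def algebra_simps)
  have small: "\<bar>\<integral>z. f z * q z \<partial>lebesgue_on U\<bar> \<le> e / 4"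
    if "AE z in lebesgue_on U. \<bar>f z * \<phi> z\<bar> \<le> L * \<bar>\<phi> z\<bar>" for f
  proof -
    have "\<bar>\<integral>z. f z * q z \<partial>lebesgue_on U\<bar> \<le> (\<integral>z. L * c * \<bar>\<phi> z\<bar> \<partial>lebesgue_on U)"
    proof (rule abs_integral_le_AE)
      show "AE z in lebesgue_on U. \<bar>f z * q z\<bar> \<le> L * c * \<bar>\<phi> z\<bar>"
        using that
      proof eventually_elim
        case (elim z)
        have "\<bar>f z * q z\<bar> \<le> \<bar>f z\<bar> * (c * \<bar>\<phi> z\<bar>)"
          unfolding abs_mult by (intro mult_left_mono q_le) simp
        also have "\<dots> = c * \<bar>f z * \<phi> z\<bar>"
          by (simp add: abs_mult)
        also have "\<dots> \<le> c * (L * \<bar>\<phi> z\<bar>)"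
          using elim \<open>c > 0\<close> by (intro mult_left_mono) auto
        finally show ?case
          by (simp add: mult_ac)
      qed
    qed (use \<phi> in simp)
    also have "\<dots> = L * c * A"
      by (simp add: A_def)
    finally show ?thesis
      using c4 by linarith
  qed
  have g_small: "\<bar>\<integral>z. (g z \<bullet> b) * q z \<partial>lebesgue_on U\<bar> \<le> e / 4"
    by (rule small) (use AE_gradient_le[OF assms(2)] in \<open>eventually_elim, auto simp: abs_mult mult_right_mono\<close>)
  have "\<forall>\<^sub>F k in sequentially. dist (\<integral>z. diffq W b k z * (p z * \<phi> z) \<partial>lebesgue_on U)
      (\<integral>z. (g z \<bullet> b) * (p z * \<phi> z) \<partial>lebesgue_on U) < e / 4"
    using e by (intro tendstoD[OF diffq_test_tendsto[OF p\<phi> assms(2)]]) simp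
  moreover note eventually_diffq_le_test[OF assms(1,2)]
  ultimately have "\<forall>\<^sub>F k in sequentially. norm ((\<integral>z. diffq W b k z * (\<zeta> z * \<phi> z) \<partial>lebesgue_on U)
      - (\<integral>z. (g z \<bullet> b) * (\<zeta> z * \<phi> z) \<partial>lebesgue_on U)) < e"
  proof eventually_elim
    case (elim k)
    have "\<bar>\<integral>z. diffq W b k z * q z \<partial>lebesgue_on U\<bar> \<le> e / 4"
      by (rule small) (use elim(2) in simp)
    then show ?case
      using elim(1) g_small e
      unfolding split[OF diffq_L1] split[OF gb_L1_loc] dist_real_def real_norm_def by linarith
  qed
  then show "\<exists>no. \<forall>n\<ge>no. norm ((\<integral>z. diffq W b n z * (\<zeta> z * \<phi> z) \<partial>lebesgue_on U)
      - (\<integral>z. (g z \<bullet> b) * (\<zeta> z * \<phi> z) \<partial>lebesgue_on U)) < e"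
    by (simp add: eventually_sequentially)
qed

text \<open>By the quadratic Taylor remainder, the difference quotient of the smoothed function
  differs from slope times difference quotient of \<open>W\<close> by at most
  \<open>L\<^sup>2 / d\<close> times the step. Both sides have known limits, which therefore
  agree.\<close>

lemma pos_smooth_integral:
  assumes "\<phi> \<in> test_functions U" "b \<in> Basis" "d > 0"
  shows "(\<integral>z. pos_smooth d (w z) * frechet_derivative \<phi> (at z) b \<partial>lebesgue_on U)
    = - (\<integral>z. (g z \<bullet> b) * (pos_slope d (w z) * \<phi> z) \<partial>lebesgue_on U)"
proof -
  obtain K where K: "compact K" "K \<subseteq> U" "\<And>z. z \<notin> K \<Longrightarrow> \<phi> z = 0"
    using test_function_support[OF assms(1)] by blast
  obtain C where C: "C \<ge> 0" "\<And>z. \<bar>W z\<bar> \<le> C"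
    using W_bounded by blast
  define V where "V z = pos_smooth d (W z)" for z
  have "pos_smooth d \<in> borel_measurable borel"
    unfolding pos_smooth_def[abs_def] pos_slope_def[abs_def] by measurable
  then have [measurable]: "V \<in> borel_measurable borel"
    unfolding V_def[abs_def] by measurable
  have V_bd: "\<bar>V z\<bar> \<le> C" for z
  proof -
    have "max (W z) 0 \<le> C"
      using C(1) C(2)[of z] by simp
    then show ?thesis
      using pos_smooth_bounds(1,2)[OF assms(3), of "W z"] unfolding V_def by linarith
  qed
  have \<phi>: "integrable (lebesgue_on U) \<phi>"
    using integrable_times_test[OF open_U const_L1_loc assms(1), of 1] by simp
  have lim1: "(\<lambda>k. \<integral>z. diffq V b k z * \<phi> z \<partial>lebesgue_on U)
     \<longlonglongrightarrow> - (\<integral>z. V z * frechet_derivative \<phi> (at z) b \<partial>lebesgue_on U)"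
    by (rule integral_diffq_test_tendsto[OF open_U assms(1) _ V_bd assms(2)]) simp
  have slope_cont: "continuous_on U (\<lambda>z. pos_slope d (w z))"
    unfolding pos_slope_def using w_continuous assms(3) by (intro continuous_intros) auto
  have lim2: "(\<lambda>k. \<integral>z. diffq W b k z * (pos_slope d (w z) * \<phi> z) \<partial>lebesgue_on U)
    \<longlonglongrightarrow> (\<integral>z. (g z \<bullet> b) * (pos_slope d (w z) * \<phi> z) \<partial>lebesgue_on U)"
    by (rule integral_diffq_continuous_tendsto[OF assms(1,2) slope_cont])
  define A where "A = (\<integral>z. \<bar>\<phi> z\<bar> \<partial>lebesgue_on U)"
  have "(\<lambda>k. (\<integral>z. diffq V b k z * \<phi> z \<partial>lebesgue_on U)
      - (\<integral>z. diffq W b k z * (pos_slope d (w z) * \<phi> z) \<partial>lebesgue_on U)) \<longlonglongrightarrow> 0"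
  proof (rule Lim_null_comparison)
    show "(\<lambda>k. L\<^sup>2 / d * A * inverse (real (Suc k))) \<longlonglongrightarrow> 0"
      by (intro tendsto_mult_right_zero LIMSEQ_inverse_real_of_nat)
    show "\<forall>\<^sub>F k in sequentially. norm ((\<integral>z. diffq V b k z * \<phi> z \<partial>lebesgue_on U)
      - (\<integral>z. diffq W b k z * (pos_slope d (w z) * \<phi> z) \<partial>lebesgue_on U))
        \<le> L\<^sup>2 / d * A * inverse (real (Suc k))"
      using eventually_diffq_le[OF K(1,2) assms(2)]
    proof eventually_elim
      case (elim k)
      let ?h = "inverse (real (Suc k))"
      have h: "?h > 0" by simp
      have i1: "integrable (lebesgue_on U) (\<lambda>z. diffq V b k z * \<phi> z)"
        using V_bd by (intro integrable_times_test[OF open_U _ assms(1)] diffq_L1_loc) auto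
      have i2: "integrable (lebesgue_on U) (\<lambda>z. diffq W b k z * (pos_slope d (w z) * \<phi> z))"
      proof (rule Bochner_Integration.integrable_bound[where f = "\<lambda>z. diffq W b k z * \<phi> z"])
        show "integrable (lebesgue_on U) (\<lambda>z. diffq W b k z * \<phi> z)"
          using C by (intro integrable_times_test[OF open_U _ assms(1)] diffq_L1_loc) auto
        show "(\<lambda>z. diffq W b k z * (pos_slope d (w z) * \<phi> z)) \<in> borel_measurable (lebesgue_on U)"
          by (intro borel_measurable_times L1_loc_measurable[OF open_U diffq_L1_loc[OF W_measurable C(2)]]
              test_function_measurable(2)[OF assms(1)] continuous_on_measurable_lebesgue_on[OF open_U slope_cont])
        show "AE z in lebesgue_on U. norm (diffq W b k z * (pos_slope d (w z) * \<phi> z))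
            \<le> norm (diffq W b k z * \<phi> z)"
          using pos_slope_times_le
          by (intro AE_I2) (simp only: real_norm_def abs_mult, intro mult_left_mono, auto)
      qed
      have "\<bar>\<integral>z. diffq V b k z * \<phi> z - diffq W b k z * (pos_slope d (w z) * \<phi> z) \<partial>lebesgue_on U\<bar>
          \<le> (\<integral>z. L\<^sup>2 / d * ?h * \<bar>\<phi> z\<bar> \<partial>lebesgue_on U)"
      proof (rule abs_integral_le_AE)
        show "AE z in lebesgue_on U. \<bar>diffq V b k z * \<phi> z - diffq W b k z * (pos_slope d (w z) * \<phi> z)\<bar>
            \<le> L\<^sup>2 / d * ?h * \<bar>\<phi> z\<bar>"
        proof (rule AE_I2)
          fix z
          show "\<bar>diffq V b k z * \<phi> z - diffq W b k z * (pos_slope d (w z) * \<phi> z)\<bar>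
            \<le> L\<^sup>2 / d * ?h * \<bar>\<phi> z\<bar>"
          proof (cases "z \<in> K")
            case True
            then have "z \<in> U"
              using K by blast
            let ?y = "z + ?h *\<^sub>R b"
            let ?T = "V ?y - V z - pos_slope d (w z) * (W ?y - W z)"
            have "\<bar>?T\<bar> \<le> (W ?y - W z)\<^sup>2 / d"
              using pos_smooth_taylor[OF assms(3), of "W ?y" "W z"] \<open>z \<in> U\<close>
              unfolding V_def by (simp only: W_eq)
            also have "\<dots> \<le> (L * ?h)\<^sup>2 / d"
              using elim True assms(3) by (intro divide_right_mono power2_le_iff_abs_le[THEN iffD2])
                (auto intro: L_nonneg simp del: of_nat_Suc)
            finally have "\<bar>?T\<bar> / ?h \<le> (L * ?h)\<^sup>2 / d / ?h"
              using h by (intro divide_right_mono) auto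
            also have "\<dots> = L\<^sup>2 / d * ?h"
              using h by (simp only: power2_eq_square) (simp add: field_simps del: of_nat_Suc)
            finally have "\<bar>?T\<bar> / ?h * \<bar>\<phi> z\<bar> \<le> L\<^sup>2 / d * ?h * \<bar>\<phi> z\<bar>"
              by (rule mult_right_mono) simp
            moreover have "diffq V b k z * \<phi> z - diffq W b k z * (pos_slope d (w z) * \<phi> z)
                = ?T / ?h * \<phi> z"
              by (simp only: diff_divide_distrib left_diff_distrib right_diff_distrib)
                (simp only: times_divide_eq_right times_divide_eq_left mult_ac)
            ultimately show ?thesis
              using h by (simp only: abs_mult abs_divide abs_of_pos)
          qed (simp add: K(3))
        qed
      qed (use \<phi> in simp)
      then show ?case
        unfolding Bochner_Integration.integral_diff[OF i1 i2] real_norm_def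
        by (simp add: A_def mult_ac del: of_nat_Suc)
    qed
  qed
  from tendsto_diff[OF lim1 this]
  have "(\<lambda>k. \<integral>z. diffq W b k z * (pos_slope d (w z) * \<phi> z) \<partial>lebesgue_on U)
      \<longlonglongrightarrow> - (\<integral>z. V z * frechet_derivative \<phi> (at z) b \<partial>lebesgue_on U)"
    by simp
  from LIMSEQ_unique[OF lim2 this]
  have "(\<integral>z. V z * frechet_derivative \<phi> (at z) b \<partial>lebesgue_on U)
    = - (\<integral>z. (g z \<bullet> b) * (pos_slope d (w z) * \<phi> z) \<partial>lebesgue_on U)"
    by simp
  moreover have "(\<integral>z. V z * frechet_derivative \<phi> (at z) b \<partial>lebesgue_on U)
    = (\<integral>z. pos_smooth d (w z) * frechet_derivative \<phi> (at z) b \<partial>lebesgue_on U)"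
    by (intro Bochner_Integration.integral_cong) (auto simp: V_def W_eq)
  ultimately show ?thesis
    by simp
qed

text \<open>Let \<open>d\<close> tend to 0 under both integrals. Where \<open>w\<close> vanishes the
  slope is 0 for every \<open>d\<close>, and this decides in favour of the strict inequality in the
  gradient.\<close>

lemma has_weak_gradient_pos_part:
  "has_weak_gradient U (\<lambda>z. max (w z) 0) (\<lambda>z. if w z > 0 then g z else 0)"
  unfolding has_weak_gradient_def
proof (intro conjI ballI)
  obtain C where C: "C \<ge> 0" "\<And>z. \<bar>W z\<bar> \<le> C"
    using W_bounded by blast
  have w_meas: "w \<in> borel_measurable (lebesgue_on U)"
    by (rule continuous_on_measurable_lebesgue_on[OF open_U w_continuous])
  show wL: "(\<lambda>z. max (w z) 0) \<in> L1_loc U"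
  proof (rule L1_loc_bounded[OF open_U])
    show "(\<lambda>z. max (w z) 0) \<in> borel_measurable (lebesgue_on U)"
      using w_meas by measurable
    show "norm (max (w z) 0) \<le> C" if "z \<in> U" for z
      using C(1) C(2)[of z] W_eq[OF that] by simp
  qed
  show "(\<lambda>z. if w z > 0 then g z else 0) \<in> L1_loc U"
    unfolding L1_loc_def L1_def
  proof clarsimp
    fix K assume K: "compact K" "K \<subseteq> U"
    then have [measurable]: "w \<in> borel_measurable (lebesgue_on K)"
      using w_continuous continuous_on_subset
      by (intro continuous_imp_measurable_on_sets_lebesgue) (auto simp: compact_imp_closed)
    have gK: "integrable (lebesgue_on K) g"
      using g_L1_loc K by (simp add: L1_loc_def L1_def)
    then have [measurable]: "g \<in> borel_measurable (lebesgue_on K)"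
      by simp
    show "integrable (lebesgue_on K) (\<lambda>z. if w z > 0 then g z else 0)"
      by (rule Bochner_Integration.integrable_bound[OF gK]) auto
  qed
  fix \<phi> b assume \<phi>: "\<phi> \<in> test_functions U" and b: "b \<in> (Basis :: 'a set)"
  let ?d = "\<lambda>k. inverse (real (Suc k))"
  let ?D = "\<lambda>z. frechet_derivative \<phi> (at z) b"
  have d0: "?d k > 0" for k
    by simp
  have gm: "(\<lambda>z. g z \<bullet> b) \<in> borel_measurable (lebesgue_on U)"
    by (rule L1_loc_measurable[OF open_U gb_L1_loc])
  note m = test_function_measurable(2)[OF \<phi>] test_function_measurable(2)[OF test_function_deriv[OF \<phi> b]]
  have sm: "pos_smooth d \<in> borel_measurable borel" "pos_slope d \<in> borel_measurable borel" for d
    unfolding pos_smooth_def[abs_def] pos_slope_def[abs_def] by measurable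
  have "(\<lambda>k. \<integral>z. pos_smooth (?d k) (w z) * ?D z \<partial>lebesgue_on U)
      \<longlonglongrightarrow> (\<integral>z. max (w z) 0 * ?D z \<partial>lebesgue_on U)"
  proof (rule integral_dominated_convergence[where w = "\<lambda>z. \<bar>max (w z) 0 * ?D z\<bar>"])
    show "integrable (lebesgue_on U) (\<lambda>z. \<bar>max (w z) 0 * ?D z\<bar>)"
      by (intro integrable_abs integrable_times_test[OF open_U wL] test_function_deriv \<phi> b)
    show "AE z in lebesgue_on U. (\<lambda>k. pos_smooth (?d k) (w z) * ?D z) \<longlonglongrightarrow> max (w z) 0 * ?D z"
    proof (intro AE_I2 tendsto_mult tendsto_const)
      fix z
      show "(\<lambda>k. pos_smooth (?d k) (w z)) \<longlonglongrightarrow> max (w z) 0"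
      proof (rule tendsto_sandwich)
        show "(\<lambda>k. max (w z) 0 - ?d k / 2) \<longlonglongrightarrow> max (w z) 0"
          using tendsto_diff[OF tendsto_const tendsto_divide[OF LIMSEQ_inverse_real_of_nat tendsto_const[of 2]]]
          by fastforce
        show "\<forall>\<^sub>F k in sequentially. max (w z) 0 - ?d k / 2 \<le> pos_smooth (?d k) (w z)"
          by (intro always_eventually allI pos_smooth_bounds d0)
        show "\<forall>\<^sub>F k in sequentially. pos_smooth (?d k) (w z) \<le> max (w z) 0"
          by (intro always_eventually allI pos_smooth_bounds d0)
      qed simp
    qed
    show "AE z in lebesgue_on U. norm (pos_smooth (?d k) (w z) * ?D z) \<le> \<bar>max (w z) 0 * ?D z\<bar>" for k
    proof (rule AE_I2)
      fix z
      show "norm (pos_smooth (?d k) (w z) * ?D z) \<le> \<bar>max (w z) 0 * ?D z\<bar>"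
        unfolding real_norm_def abs_mult
        using pos_smooth_bounds(1,2)[OF d0[of k], of "w z"] by (intro mult_right_mono) auto
    qed
    show "(\<lambda>z. max (w z) 0 * ?D z) \<in> borel_measurable (lebesgue_on U)"
      using m(2) w_meas by measurable
    show "(\<lambda>z. pos_smooth (?d k) (w z) * ?D z) \<in> borel_measurable (lebesgue_on U)" for k
      by (intro borel_measurable_times measurable_compose[OF w_meas sm(1)] m(2))
  qed
  moreover have "(\<lambda>k. \<integral>z. (g z \<bullet> b) * (pos_slope (?d k) (w z) * \<phi> z) \<partial>lebesgue_on U)
      \<longlonglongrightarrow> (\<integral>z. ((if w z > 0 then g z else 0) \<bullet> b) * \<phi> z \<partial>lebesgue_on U)"
  proof (rule integral_dominated_convergence[where w = "\<lambda>z. \<bar>(g z \<bullet> b) * \<phi> z\<bar>"])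
    show "integrable (lebesgue_on U) (\<lambda>z. \<bar>(g z \<bullet> b) * \<phi> z\<bar>)"
      by (intro integrable_abs integrable_times_test[OF open_U gb_L1_loc] \<phi>)
    show "AE z in lebesgue_on U. (\<lambda>k. (g z \<bullet> b) * (pos_slope (?d k) (w z) * \<phi> z))
        \<longlonglongrightarrow> ((if w z > 0 then g z else 0) \<bullet> b) * \<phi> z"
    proof (rule AE_I2)
      fix z
      have "(\<lambda>k. pos_slope (?d k) (w z)) \<longlonglongrightarrow> (if w z > 0 then 1 else 0)"
      proof (cases "w z > 0")
        case True
        have "\<forall>\<^sub>F k in sequentially. ?d k < w z"
          using order_tendstoD(2)[OF LIMSEQ_inverse_real_of_nat True] .
        then have "\<forall>\<^sub>F k in sequentially. pos_slope (?d k) (w z) = 1"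
        proof eventually_elim
          case (elim k)
          then have "1 \<le> w z / ?d k"
            using d0[of k] by (simp only: pos_le_divide_eq mult_1)
          then show ?case
            by (simp add: pos_slope_def max_def min_def)
        qed
        then show ?thesis
          using True by (simp add: tendsto_eventually)
      next
        case False
        have "pos_slope (?d k) (w z) = 0" for k
        proof -
          have "w z / ?d k \<le> 0"
            using False d0[of k] by (intro divide_nonpos_pos) auto
          then have "min 1 (w z / ?d k) \<le> 0"
            by (rule min.coboundedI2)
          then show ?thesis
            unfolding pos_slope_def by (rule max_absorb1)
        qed
        then show ?thesis
          using False by simp
      qed
      then have "(\<lambda>k. (g z \<bullet> b) * (pos_slope (?d k) (w z) * \<phi> z))
          \<longlonglongrightarrow> (g z \<bullet> b) * ((if w z > 0 then 1 else 0) * \<phi> z)"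
        by (intro tendsto_mult tendsto_const)
      then show "(\<lambda>k. (g z \<bullet> b) * (pos_slope (?d k) (w z) * \<phi> z))
        \<longlonglongrightarrow> ((if w z > 0 then g z else 0) \<bullet> b) * \<phi> z"
        by (cases "w z > 0") auto
    qed
    show "AE z in lebesgue_on U. norm ((g z \<bullet> b) * (pos_slope (?d k) (w z) * \<phi> z))
        \<le> \<bar>(g z \<bullet> b) * \<phi> z\<bar>" for k
      using pos_slope_times_le
      by (intro AE_I2) (simp only: real_norm_def abs_mult, intro mult_left_mono, auto)
    show "(\<lambda>z. ((if w z > 0 then g z else 0) \<bullet> b) * \<phi> z) \<in> borel_measurable (lebesgue_on U)"
      using m(1) w_meas L1_loc_measurable[OF open_U g_L1_loc] by measurable
    show "(\<lambda>z. (g z \<bullet> b) * (pos_slope (?d k) (w z) * \<phi> z)) \<in> borel_measurable (lebesgue_on U)" for k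
      by (intro borel_measurable_times measurable_compose[OF w_meas sm(2)] m(1) gm)
  qed
  from tendsto_minus[OF this]
  have "(\<lambda>k. \<integral>z. pos_smooth (?d k) (w z) * ?D z \<partial>lebesgue_on U)
      \<longlonglongrightarrow> - (\<integral>z. ((if w z > 0 then g z else 0) \<bullet> b) * \<phi> z \<partial>lebesgue_on U)"
    by (simp only: pos_smooth_integral[OF \<phi> b d0])
  ultimately show "(\<integral>z. max (w z) 0 * ?D z \<partial>lebesgue_on U)
      = - (\<integral>z. ((if w z > 0 then g z else 0) \<bullet> b) * \<phi> z \<partial>lebesgue_on U)"
    by (rule LIMSEQ_unique)
qed

end

section \<open>Uniqueness of weak gradients, and gradients of the competitors\<close>

lemma AE_zero_if_test_zero:
  fixes f :: "'a::euclidean_space \<Rightarrow> real"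
  assumes "open U" "f \<in> L1_loc U"
    and "\<And>\<phi>. \<phi> \<in> test_functions U \<Longrightarrow> (\<integral>z. f z * \<phi> z \<partial>lebesgue_on U) = 0"
  shows "AE z in lebesgue_on U. f z = 0"
proof -
  have "AE z in lebesgue_on U. f z \<le> 0"
    using assms by (intro AE_nonpos_if_test_nonpos) auto
  moreover have "(\<lambda>z. - f z) \<in> L1_loc U"
    using assms(2) by (simp add: L1_loc_def L1_def)
  then have "AE z in lebesgue_on U. - f z \<le> 0"
    using assms by (intro AE_nonpos_if_test_nonpos) auto
  ultimately show ?thesis
    by eventually_elim auto
qed

text \<open>This is what permits replacing the representative picked by \<open>weak_gradient\<close>
  with an explicit formula inside an energy.\<close>

lemma weak_gradient_unique:
  fixes g h :: "'a::euclidean_space \<Rightarrow> 'a"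
  assumes "open U" "has_weak_gradient U v g" "has_weak_gradient U v h"
  shows "AE z in lebesgue_on U. g z = h z"
proof -
  have "AE z in lebesgue_on U. g z \<bullet> b - h z \<bullet> b = 0" if b: "b \<in> Basis" for b
  proof (rule AE_zero_if_test_zero[OF assms(1)])
    have g: "(\<lambda>z. g z \<bullet> b) \<in> L1_loc U" and h: "(\<lambda>z. h z \<bullet> b) \<in> L1_loc U"
      using assms(2,3) by (auto simp: has_weak_gradient_def intro: L1_loc_inner)
    then show "(\<lambda>z. g z \<bullet> b - h z \<bullet> b) \<in> L1_loc U"
      by (auto simp: L1_loc_def L1_def)
    fix \<phi> assume \<phi>: "\<phi> \<in> test_functions U"
    have "(\<integral>z. (g z \<bullet> b - h z \<bullet> b) * \<phi> z \<partial>lebesgue_on U)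
        = (\<integral>z. (g z \<bullet> b) * \<phi> z \<partial>lebesgue_on U) - (\<integral>z. (h z \<bullet> b) * \<phi> z \<partial>lebesgue_on U)"
      using integrable_times_test[OF assms(1) g \<phi>] integrable_times_test[OF assms(1) h \<phi>]
      by (simp add: left_diff_distrib)
    also have "\<dots> = 0"
    proof -
      have "(\<integral>z. v z * frechet_derivative \<phi> (at z) b \<partial>lebesgue_on U)
          = - (\<integral>z. (g z \<bullet> b) * \<phi> z \<partial>lebesgue_on U)"
        using assms(2) \<phi> b by (simp add: has_weak_gradient_def)
      moreover have "(\<integral>z. v z * frechet_derivative \<phi> (at z) b \<partial>lebesgue_on U)
          = - (\<integral>z. (h z \<bullet> b) * \<phi> z \<partial>lebesgue_on U)"
        using assms(3) \<phi> b by (simp add: has_weak_gradient_def)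
      ultimately show ?thesis
        by simp
    qed
    finally show "(\<integral>z. (g z \<bullet> b - h z \<bullet> b) * \<phi> z \<partial>lebesgue_on U) = 0" .
  qed
  then have "AE z in lebesgue_on U. \<forall>b\<in>Basis. g z \<bullet> b - h z \<bullet> b = 0"
    by (intro AE_finite_allI) auto
  then show ?thesis
    by eventually_elim (auto intro: euclidean_eqI)
qed

lemma has_weak_gradient_weak_gradient:
  "has_weak_gradient U v g \<Longrightarrow> has_weak_gradient U v (weak_gradient U v)"
  unfolding weak_gradient_def by (rule someI[of "has_weak_gradient U v"])

lemma weak_gradient_AE_eq:
  "open U \<Longrightarrow> has_weak_gradient U v g \<Longrightarrow> AE z in lebesgue_on U. weak_gradient U v z = g z"
  by (rule weak_gradient_unique[OF _ has_weak_gradient_weak_gradient])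

lemma has_weak_gradient_diff:
  assumes "open U" "has_weak_gradient U v g" "has_weak_gradient U w h"
  shows "has_weak_gradient U (\<lambda>z. v z - w z) (\<lambda>z. g z - h z)"
  unfolding has_weak_gradient_def
proof (intro conjI ballI)
  have v: "v \<in> L1_loc U" "w \<in> L1_loc U" and g: "g \<in> L1_loc U" "h \<in> L1_loc U"
    using assms(2,3) by (auto simp: has_weak_gradient_def)
  then show "(\<lambda>z. v z - w z) \<in> L1_loc U" "(\<lambda>z. g z - h z) \<in> L1_loc U"
    by (auto simp: L1_loc_def L1_def)
  fix \<phi> b assume \<phi>: "\<phi> \<in> test_functions U" and b: "b \<in> (Basis :: 'a set)"
  note D = test_function_deriv[OF \<phi> b]
  show "(\<integral>z. (v z - w z) * frechet_derivative \<phi> (at z) b \<partial>lebesgue_on U)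
      = - (\<integral>z. ((g z - h z) \<bullet> b) * \<phi> z \<partial>lebesgue_on U)"
    using assms(2,3) \<phi> b integrable_times_test[OF assms(1) v(1) D]
      integrable_times_test[OF assms(1) v(2) D]
      integrable_times_test[OF assms(1) L1_loc_inner[OF g(1)] \<phi>]
      integrable_times_test[OF assms(1) L1_loc_inner[OF g(2)] \<phi>]
    by (simp add: has_weak_gradient_def left_diff_distrib inner_diff_left)
qed

lemma continuous_on_L1_loc:
  fixes f :: "'a::euclidean_space \<Rightarrow> 'b::euclidean_space"
  assumes "continuous_on U f"
  shows "f \<in> L1_loc U"
  unfolding L1_loc_def L1_def
proof clarsimp
  fix K assume K: "compact K" "K \<subseteq> U"
  have f: "continuous_on K f"
    using assms K(2) continuous_on_subset by blast
  interpret finite_measure "lebesgue_on K"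
    using K(1) by (simp add: finite_measure_lebesgue_on lmeasurable_compact)
  obtain B where "\<And>z. z \<in> K \<Longrightarrow> norm (f z) \<le> B"
    using compact_imp_bounded[OF compact_continuous_image[OF f K(1)]] by (auto simp: bounded_iff)
  moreover have "f \<in> borel_measurable (lebesgue_on K)"
    using f K(1) by (intro continuous_imp_measurable_on_sets_lebesgue) (auto simp: compact_imp_closed)
  ultimately show "integrable (lebesgue_on K) f"
    by (intro integrable_const_bound[where B = B] AE_I2) auto
qed

text \<open>The case of a constant function, whose difference quotients vanish.\<close>

lemma integral_deriv_test_function:
  assumes "open U" "\<psi> \<in> test_functions U" "b \<in> Basis"
  shows "(\<integral>z. frechet_derivative \<psi> (at z) b \<partial>lebesgue_on U) = 0"
  using integral_diffq_test_tendsto[OF assms(1,2) _ _ assms(3), of "\<lambda>_. 1" 1]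
  by (simp add: LIMSEQ_const_iff)

text \<open>The product of \<open>p\<close> and \<phi> is again a test function, so the integral of
  its derivative is 0; the product rule does the rest.\<close>

lemma has_weak_gradient_smooth:
  fixes p :: "'a::euclidean_space \<Rightarrow> real"
  assumes "open U" "\<And>k. Ck k p" and D: "\<And>z. (p has_derivative (\<lambda>h. G z \<bullet> h)) (at z)"
    and "continuous_on UNIV G"
  shows "has_weak_gradient U p G"
  unfolding has_weak_gradient_def
proof (intro conjI ballI)
  show p: "p \<in> L1_loc U"
    using Ck_continuous_on[OF assms(2)] continuous_on_L1_loc continuous_on_subset by blast
  show G: "G \<in> L1_loc U"
    using assms(4) continuous_on_L1_loc continuous_on_subset by blast
  fix \<phi> b assume \<phi>: "\<phi> \<in> test_functions U" and b: "b \<in> (Basis :: 'a set)"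
  have "frechet_derivative (\<lambda>z. p z * \<phi> z) (at z) b
      = p z * frechet_derivative \<phi> (at z) b + (G z \<bullet> b) * \<phi> z" for z
    using frechet_derivative_at[OF has_derivative_mult[OF D test_function_has_derivative[OF \<phi>]], of z]
    by metis
  then have "0 = (\<integral>z. p z * frechet_derivative \<phi> (at z) b + (G z \<bullet> b) * \<phi> z \<partial>lebesgue_on U)"
    using integral_deriv_test_function[OF assms(1) test_function_mult[OF \<phi> assms(2)] b] by simp
  also have "\<dots> = (\<integral>z. p z * frechet_derivative \<phi> (at z) b \<partial>lebesgue_on U)
      + (\<integral>z. (G z \<bullet> b) * \<phi> z \<partial>lebesgue_on U)"
    by (intro Bochner_Integration.integral_add integrable_times_test[OF assms(1)] p \<phi> b
        test_function_deriv L1_loc_inner[OF G])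
  finally show "(\<integral>z. p z * frechet_derivative \<phi> (at z) b \<partial>lebesgue_on U)
      = - (\<integral>z. (G z \<bullet> b) * \<phi> z \<partial>lebesgue_on U)"
    by simp
qed

text \<open>The dimension appears because the coordinates are bounded separately. The loss is
  harmless: the constants may depend on it.\<close>

lemma (in lipschitz_weak_gradient) AE_norm_gradient_le:
  "AE z in lebesgue_on U. (norm (g z))\<^sup>2 \<le> real DIM('a) * L\<^sup>2"
proof -
  have "AE z in lebesgue_on U. \<forall>b\<in>Basis. \<bar>g z \<bullet> b\<bar> \<le> L"
    using AE_gradient_le by (intro AE_finite_allI) auto
  then show ?thesis
  proof eventually_elim
    case (elim z)
    have "(norm (g z))\<^sup>2 = (\<Sum>b\<in>Basis. (g z \<bullet> b)\<^sup>2)"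
      unfolding power2_norm_eq_inner by (subst euclidean_inner) (simp add: power2_eq_square)
    also have "\<dots> \<le> (\<Sum>b\<in>(Basis :: 'a set). L\<^sup>2)"
      using elim L_nonneg by (intro sum_mono power2_le_iff_abs_le[THEN iffD2]) auto
    finally show ?case
      by simp
  qed
qed

lemma (in lipschitz_weak_gradient) g_measurable: "g \<in> borel_measurable (lebesgue_on U)"
  by (rule L1_loc_measurable[OF open_U g_L1_loc])

lemma finite_measure_lebesgue_on_bounded:
  "open U \<Longrightarrow> bounded U \<Longrightarrow> finite_measure (lebesgue_on (U :: 'a::euclidean_space set))"
  by (simp add: finite_measure_lebesgue_on lmeasurable_open)

lemma (in lipschitz_weak_gradient) norm_gradient_integrable:
  "integrable (lebesgue_on U) (\<lambda>z. (norm (g z))\<^sup>2)"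
proof -
  interpret finite_measure "lebesgue_on U"
    by (rule finite_measure_lebesgue_on_bounded[OF open_U bounded_U])
  show ?thesis
    using AE_norm_gradient_le g_measurable
    by (intro integrable_const_bound[where B = "real DIM('a) * L\<^sup>2"]) auto
qed

text \<open>Equals \<open>m\<close> on \<open>sphere y t\<close> when \<open>c = m / (t\<^sup>2 - s\<^sup>2)\<close>.\<close>

definition barrier :: "'a::euclidean_space \<Rightarrow> real \<Rightarrow> real \<Rightarrow> 'a \<Rightarrow> real" where
  "barrier y s c z = max (c * ((norm (z - y))\<^sup>2 - s\<^sup>2)) 0"

lemma paraboloid_lipschitz:
  fixes y :: "'a::euclidean_space"
  assumes "c \<ge> 0" "t > 0"
  shows "(2 * c * t)-lipschitz_on (cball y t) (\<lambda>z. c * ((norm (z - y))\<^sup>2 - s\<^sup>2))"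
proof (rule lipschitz_onI)
  fix z z' assume z: "z \<in> cball y t" "z' \<in> cball y t"
  have "dist (c * ((norm (z - y))\<^sup>2 - s\<^sup>2)) (c * ((norm (z' - y))\<^sup>2 - s\<^sup>2))
      = \<bar>c * ((norm (z - y) + norm (z' - y)) * (norm (z - y) - norm (z' - y)))\<bar>"
    by (simp add: dist_real_def power2_eq_square algebra_simps)
  also have "\<dots> = c * ((norm (z - y) + norm (z' - y)) * \<bar>norm (z - y) - norm (z' - y)\<bar>)"
    using assms by (simp add: abs_mult)
  also have "\<dots> \<le> c * ((t + t) * norm ((z - y) - (z' - y)))"
    using z assms by (intro mult_left_mono mult_mono add_mono norm_triangle_ineq3)
      (auto simp: dist_norm norm_minus_commute)
  finally show "dist (c * ((norm (z - y))\<^sup>2 - s\<^sup>2)) (c * ((norm (z' - y))\<^sup>2 - s\<^sup>2))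
      \<le> 2 * c * t * dist z z'"
    by (simp add: dist_norm algebra_simps)
qed (use assms in simp)

lemma lipschitz_on_pos_part:
  "C-lipschitz_on X f \<Longrightarrow> C-lipschitz_on X (\<lambda>z. max (f z :: real) 0)"
  unfolding lipschitz_on_def dist_real_def by (smt (verit, best))

lemma barrier_lipschitz:
  fixes y :: "'a::euclidean_space"
  assumes "c \<ge> 0" "t > 0"
  shows "(2 * c * t)-lipschitz_on (cball y t) (barrier y s c)"
  unfolding barrier_def[abs_def] by (intro lipschitz_on_pos_part paraboloid_lipschitz assms)

lemma Ck_paraboloid: "Ck k (\<lambda>z :: 'a::euclidean_space. c * ((norm (z - y))\<^sup>2 - s\<^sup>2))"
proof -
  have "real_polynomial_function (\<lambda>z. c * ((\<Sum>i\<in>Basis. (z \<bullet> i + (- (y \<bullet> i))) * (z \<bullet> i + (- (y \<bullet> i)))) + (- s\<^sup>2)))"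
    by (intro real_polynomial_function.intros real_polynomial_function_sum finite_Basis
        bounded_linear_inner_left)
  moreover have "(\<lambda>z :: 'a. c * ((\<Sum>i\<in>Basis. (z \<bullet> i + (- (y \<bullet> i))) * (z \<bullet> i + (- (y \<bullet> i)))) + (- s\<^sup>2)))
      = (\<lambda>z. c * ((norm (z - y))\<^sup>2 - s\<^sup>2))"
    unfolding power2_norm_eq_inner by (subst euclidean_inner) (simp add: inner_diff_left)
  ultimately show ?thesis
    using Ck_real_polynomial_function by metis
qed

lemma has_weak_gradient_barrier:
  fixes y :: "'a::euclidean_space"
  assumes "c \<ge> 0" "t > 0"
  shows "has_weak_gradient (ball y t) (barrier y s c)
    (\<lambda>z. if c * ((norm (z - y))\<^sup>2 - s\<^sup>2) > 0 then (2 * c) *\<^sub>R (z - y) else 0)"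
proof -
  have "((\<lambda>z. c * ((norm (z - y))\<^sup>2 - s\<^sup>2)) has_derivative (\<lambda>h. ((2 * c) *\<^sub>R (z - y)) \<bullet> h)) (at z)" for z
    unfolding power2_norm_eq_inner
    by (auto intro!: derivative_eq_intros simp: inner_commute algebra_simps)
  then have "has_weak_gradient (ball y t) (\<lambda>z. c * ((norm (z - y))\<^sup>2 - s\<^sup>2)) (\<lambda>z. (2 * c) *\<^sub>R (z - y))"
    by (intro has_weak_gradient_smooth Ck_paraboloid) (auto intro!: continuous_intros)
  then interpret lipschitz_weak_gradient "ball y t" "\<lambda>z. c * ((norm (z - y))\<^sup>2 - s\<^sup>2)"
      "\<lambda>z. (2 * c) *\<^sub>R (z - y)" "2 * c * t"
    using lipschitz_on_subset[OF paraboloid_lipschitz[OF assms] ball_subset_cball]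
    by unfold_locales auto
  show ?thesis
    using has_weak_gradient_pos_part unfolding barrier_def[abs_def] .
qed

text \<open>\<open>min u q\<close> is \<open>u\<close> minus the positive part of
  \<open>u - q\<close>, and that difference is Lipschitz on the ball.\<close>

lemma has_weak_gradient_min_barrier:
  fixes y :: "'a::euclidean_space"
  assumes "c \<ge> 0" "t > 0" "L-lipschitz_on (ball y t) u" "has_weak_gradient (ball y t) u g"
  shows "has_weak_gradient (ball y t) (\<lambda>z. min (u z) (barrier y s c z))
    (\<lambda>z. if u z > barrier y s c z
         then if c * ((norm (z - y))\<^sup>2 - s\<^sup>2) > 0 then (2 * c) *\<^sub>R (z - y) else 0 else g z)"
proof -
  let ?q = "barrier y s c"
  let ?gq = "\<lambda>z. if c * ((norm (z - y))\<^sup>2 - s\<^sup>2) > 0 then (2 * c) *\<^sub>R (z - y) else 0"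
  have q: "(2 * c * t)-lipschitz_on (ball y t) ?q"
    using lipschitz_on_subset[OF barrier_lipschitz[OF assms(1,2)] ball_subset_cball] .
  interpret lipschitz_weak_gradient "ball y t" "\<lambda>z. u z - ?q z" "\<lambda>z. g z - ?gq z" "L + 2 * c * t"
    by unfold_locales (auto intro!: lipschitz_on_diff assms q
        has_weak_gradient_diff[OF _ assms(4) has_weak_gradient_barrier[OF assms(1,2)], simplified])
  have "has_weak_gradient (ball y t) (\<lambda>z. u z - max (u z - ?q z) 0)
      (\<lambda>z. g z - (if u z - ?q z > 0 then g z - ?gq z else 0))"
    by (intro has_weak_gradient_diff[OF _ assms(4) has_weak_gradient_pos_part]) simp
  moreover have "(\<lambda>z. u z - max (u z - ?q z) 0) = (\<lambda>z. min (u z) (?q z))"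
    by (auto simp: fun_eq_iff)
  moreover have "(\<lambda>z. g z - (if u z - ?q z > 0 then g z - ?gq z else 0))
      = (\<lambda>z. if u z > ?q z then ?gq z else g z)"
    by (auto simp: fun_eq_iff)
  ultimately show ?thesis
    by simp
qed

section \<open>Decay of the positivity set\<close>

text \<open>The constant sequence \<open>v\<close> is an admissible approximation. The trace
  \<open>T\<close> is a separate function because it must be Borel on the whole space, while
  \<open>v\<close> is controlled only on the closed ball.\<close>

lemma has_trace_continuous:
  fixes v :: "'a::euclidean_space \<Rightarrow> real"
  assumes "continuous_on (cball x r) v" "gradient_in_L2 (ball x r) v"
    and "T \<in> borel_measurable borel" "\<And>z. z \<in> sphere x r \<Longrightarrow> T z = v z"
  shows "has_trace x r v T"
  unfolding has_trace_def
proof (intro conjI exI[of _ "\<lambda>_. v"] allI)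
  have "(\<integral>\<^sup>+z\<in>sphere x r. ennreal ((v z - T z)\<^sup>2) \<partial>hausdorff_measure (DIM('a) - 1))
      = (\<integral>\<^sup>+(z :: 'a). 0 \<partial>hausdorff_measure (DIM('a) - 1))"
    using assms(4) by (intro nn_integral_cong) (auto simp: indicator_def)
  then show "(\<lambda>k. \<integral>\<^sup>+z\<in>sphere x r. ennreal ((v z - T z)\<^sup>2) \<partial>hausdorff_measure (DIM('a) - 1)) \<longlonglongrightarrow> 0"
    by simp
qed (use assms in auto)

lemma same_trace_continuous:
  fixes v w :: "'a::euclidean_space \<Rightarrow> real"
  assumes "continuous_on (cball x r) v" "gradient_in_L2 (ball x r) v"
    and "continuous_on (cball x r) w" "gradient_in_L2 (ball x r) w"
    and "\<And>z. z \<in> sphere x r \<Longrightarrow> v z = w z"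
  shows "same_trace x r v w"
proof -
  \<comment> \<open>Cutting off outside the sphere yields a Borel function on the whole
    space.\<close>
  let ?T = "\<lambda>z. indicator (sphere x r) z *\<^sub>R w z"
  have "?T \<in> borel_measurable borel"
    using continuous_on_subset[OF assms(3) sphere_cball]
    by (intro borel_measurable_continuous_on_indicator) auto
  then have "has_trace x r v ?T" "has_trace x r w ?T"
    using assms by (auto intro!: has_trace_continuous)
  then show ?thesis
    unfolding same_trace_def by blast
qed

lemma competitor_continuous:
  fixes v u :: "'a::euclidean_space \<Rightarrow> real"
  assumes "continuous_on (cball x r) v" "gradient_in_L2 (ball x r) v"
    and "continuous_on (cball x r) u" "gradient_in_L2 (ball x r) u"
    and "\<And>z. z \<in> sphere x r \<Longrightarrow> v z = u z"
  shows "competitor u x r v"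
proof -
  interpret finite_measure "lebesgue_on (ball x r)"
    by (rule finite_measure_lebesgue_on_bounded) auto
  obtain B where B: "\<forall>z\<in>cball x r. norm (v z) \<le> B"
    using compact_imp_bounded[OF compact_continuous_image[OF assms(1) compact_cball]]
    unfolding bounded_iff by auto
  have "v \<in> borel_measurable (lebesgue_on (ball x r))"
    using continuous_on_subset[OF assms(1) ball_subset_cball]
    by (intro continuous_on_measurable_lebesgue_on) auto
  then have "integrable (lebesgue_on (ball x r)) v"
    using B by (intro integrable_const_bound[where B = B] AE_I2) (auto simp: less_imp_le)
  then show ?thesis
    using same_trace_continuous[OF assms] assms(2) by (simp add: competitor_def L1_def)
qed

text \<open>\<open>a\<close> is the largest slope of the barrier on the ball, reached towards
  \<open>sphere y t\<close>. The term with \<open>k\<close> is the price of almost minimality: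
  \<open>k\<close> times the energy of the competitor, for which a pointwise bound on the density
  suffices.\<close>

lemma positivity_set_decay:
  fixes y :: "'a::euclidean_space"
  assumes s: "0 < s" "s < t" and m: "0 \<le> m"
    and lip: "L-lipschitz_on (ball y t) u" and cont: "continuous_on (cball y t) u"
    and sphere: "\<And>z. z \<in> sphere y t \<Longrightarrow> u z \<le> m"
    and gr: "has_weak_gradient (ball y t) u g0"
    and qp: "qp \<in> borel_measurable (lebesgue_on (ball y t))" "AE z in lebesgue_on (ball y t). \<bar>qp z\<bar> \<le> Mp"
    and qm: "qm \<in> borel_measurable (lebesgue_on (ball y t))" "AE z in lebesgue_on (ball y t). \<bar>qm z\<bar> \<le> Mm"
    and \<rho>: "0 \<le> \<rho>" "\<And>z. z \<in> ball y t \<Longrightarrow> \<rho> \<le> qp z"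
    and k: "0 \<le> k" "\<And>v. competitor u y t v \<Longrightarrow> J_fun qp qm y t u \<le> (1 + k) * J_fun qp qm y t v"
  defines "a \<equiv> 2 * m * t / (t\<^sup>2 - s\<^sup>2)"
  shows "\<rho>\<^sup>2 * measure lebesgue {z \<in> ball y s. u z > 0}
    \<le> a\<^sup>2 * measure lebesgue {z \<in> ball y t. u z > 0}
      + k * (real DIM('a) * L\<^sup>2 + Mp\<^sup>2 + Mm\<^sup>2 + a\<^sup>2) * measure lebesgue (ball y t)"
proof -
  let ?B = "ball y t" and ?M = "lebesgue_on (ball y t)"
  define c where "c = m / (t\<^sup>2 - s\<^sup>2)"
  have ts: "t > 0" "t\<^sup>2 - s\<^sup>2 > 0"
    using s by (auto simp: power_strict_mono)
  have c: "c \<ge> 0" and ac: "a = 2 * c * t"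
    using m ts by (auto simp: c_def a_def)
  let ?q = "barrier y s c"
  define v where "v z = min (u z) (?q z)" for z
  \<comment> \<open>The energy refers to the chosen representative, so the locale is instantiated
    with it and not with \<open>g0\<close>.\<close>
  define g where "g = weak_gradient ?B u"
  define gv where "gv = weak_gradient ?B v"
  interpret finite_measure ?M
    by (rule finite_measure_lebesgue_on_bounded) auto
  have g: "has_weak_gradient ?B u g"
    unfolding g_def by (rule has_weak_gradient_weak_gradient[OF gr])
  interpret lipschitz_weak_gradient ?B u g L
    using lip g by unfold_locales auto
  let ?gq = "\<lambda>z. if c * ((norm (z - y))\<^sup>2 - s\<^sup>2) > 0 then (2 * c) *\<^sub>R (z - y) else 0"
  have gv': "has_weak_gradient ?B v (\<lambda>z. if u z > ?q z then ?gq z else g z)"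
    unfolding v_def by (rule has_weak_gradient_min_barrier[OF c ts(1) lip g])
  then have gv: "has_weak_gradient ?B v gv"
    unfolding gv_def by (rule has_weak_gradient_weak_gradient)
  have q_nonneg: "0 \<le> ?q z" for z
    by (simp add: barrier_def)
  have gq_le: "(norm (?gq z))\<^sup>2 \<le> a\<^sup>2" if "z \<in> ?B" for z
  proof -
    have "norm (?gq z) \<le> a"
      using that c ts(1) by (auto simp: ac dist_norm norm_minus_commute intro!: mult_left_mono)
    then show ?thesis
      by (simp add: power_mono)
  qed
  have gv_le: "AE z in ?M. (norm (gv z))\<^sup>2 \<le> (if u z > ?q z then a\<^sup>2 else (norm (g z))\<^sup>2)"
    using weak_gradient_AE_eq[OF open_ball gv'] AE_space
  proof eventually_elim
    case (elim z)
    show ?case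
    proof (cases "u z > ?q z")
      case True
      then have "gv z = ?gq z"
        using elim(1) by (simp only: gv_def if_True)
      then show ?thesis
        using gq_le[of z] elim(2) True by (simp only: if_True space_lebesgue_on)
    next
      case False
      then have "gv z = g z"
        using elim(1) by (simp only: gv_def if_False)
      then show ?thesis
        using False by simp
    qed
  qed
  have gv_bd: "AE z in ?M. (norm (gv z))\<^sup>2 \<le> real DIM('a) * L\<^sup>2 + a\<^sup>2"
    using gv_le AE_norm_gradient_le
  proof eventually_elim
    case (elim z)
    have "0 \<le> real DIM('a) * L\<^sup>2" "0 \<le> a\<^sup>2"
      by simp_all
    with elim show ?case
      by (cases "u z > ?q z"; simp only: if_True if_False; linarith)
  qed
  have gv_meas: "gv \<in> borel_measurable ?M"
    using gv L1_loc_measurable[OF open_ball] by (auto simp: has_weak_gradient_def)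
  have gv_int: "integrable ?M (\<lambda>z. (norm (gv z))\<^sup>2)"
    using gv_bd gv_meas by (intro integrable_const_bound[where B = "real DIM('a) * L\<^sup>2 + a\<^sup>2"]) auto
  have v_cont: "continuous_on (cball y t) v"
    unfolding v_def using cont lipschitz_on_continuous_on[OF barrier_lipschitz[OF c ts(1)]]
    by (intro continuous_on_min)
  have "competitor u y t v"
  proof (rule competitor_continuous[OF v_cont _ cont])
    show "gradient_in_L2 ?B v"
      using gv gv_meas gv_int by (auto simp: gradient_in_L2_def L2_def)
    show "gradient_in_L2 ?B u"
      using g g_measurable norm_gradient_integrable by (auto simp: gradient_in_L2_def L2_def)
    fix z assume z: "z \<in> sphere y t"
    then have "?q z = m"
      using ts m by (simp add: barrier_def c_def dist_norm norm_minus_commute)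
    then show "v z = u z"
      using sphere[OF z] by (simp add: v_def)
  qed
  note J = k(2)[OF this]
  have u_meas [measurable]: "u \<in> borel_measurable ?M" and v_meas [measurable]: "v \<in> borel_measurable ?M"
    using continuous_on_subset[OF cont ball_subset_cball] continuous_on_subset[OF v_cont ball_subset_cball]
    by (auto intro: continuous_on_measurable_lebesgue_on)
  note [measurable] = qp(1) qm(1)
  have ind: "integrable ?M (\<lambda>z. (qp z)\<^sup>2 * indicator {z. f z > 0} z)"
      "integrable ?M (\<lambda>z. (qm z)\<^sup>2 * indicator {z. f z < 0} z)"
    if [measurable]: "f \<in> borel_measurable ?M" for f :: "'a \<Rightarrow> real"
  proof -
    have "AE z in ?M. norm ((qp z)\<^sup>2 * indicator {z. f z > 0} z) \<le> Mp\<^sup>2"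
      using qp(2) by eventually_elim (auto simp: indicator_def abs_le_square_iff[symmetric])
    then show "integrable ?M (\<lambda>z. (qp z)\<^sup>2 * indicator {z. f z > 0} z)"
      by (rule integrable_const_bound) (unfold indicator_def of_bool_def mem_Collect_eq, measurable)
    have "AE z in ?M. norm ((qm z)\<^sup>2 * indicator {z. f z < 0} z) \<le> Mm\<^sup>2"
      using qm(2) by eventually_elim (auto simp: indicator_def abs_le_square_iff[symmetric])
    then show "integrable ?M (\<lambda>z. (qm z)\<^sup>2 * indicator {z. f z < 0} z)"
      by (rule integrable_const_bound) (unfold indicator_def of_bool_def mem_Collect_eq, measurable)
  qed
  define Eu where "Eu z = (norm (g z))\<^sup>2 + (qp z)\<^sup>2 * indicator {z. u z > 0} z
      + (qm z)\<^sup>2 * indicator {z. u z < 0} z" for z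
  define Ev where "Ev z = (norm (gv z))\<^sup>2 + (qp z)\<^sup>2 * indicator {z. v z > 0} z
      + (qm z)\<^sup>2 * indicator {z. v z < 0} z" for z
  have Eu: "integrable ?M Eu" and Ju: "J_fun qp qm y t u = (\<integral>z. Eu z \<partial>?M)"
    unfolding Eu_def[abs_def] J_fun_def g_def
    using norm_gradient_integrable ind[OF u_meas] by (auto simp: g_def)
  have Ev: "integrable ?M Ev" and Jv: "J_fun qp qm y t v = (\<integral>z. Ev z \<partial>?M)"
    unfolding Ev_def[abs_def] J_fun_def gv_def
    using gv_int ind[OF v_meas] by (auto simp: gv_def)
  let ?Pt = "{z \<in> ball y t. u z > 0}" and ?Ps = "{z \<in> ball y s. u z > 0}"
  have sub: "ball y s \<subseteq> ?B"
    using s by (intro subset_ball) simp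
  have "?Pt \<in> sets ?M" "?Ps \<in> sets ?M"
  proof -
    show "?Pt \<in> sets ?M"
      using measurable_sets[OF u_meas, of "{0<..}"] by (simp add: vimage_def Int_def conj_commute)
    moreover have "ball y s \<in> sets ?M"
      using sub by (auto simp: sets_restrict_space_iff)
    moreover have "?Ps = ball y s \<inter> ?Pt"
      using sub by auto
    ultimately show "?Ps \<in> sets ?M"
      by (simp add: sets.Int)
  qed
  moreover have "measure ?M X = measure lebesgue X" if "X \<subseteq> ?B" for X
    using that by (intro measure_restrict_space) auto
  from this[of ?Pt] this[of ?Ps] this[of ?B]
  have "measure ?M ?Pt = measure lebesgue ?Pt" "measure ?M ?Ps = measure lebesgue ?Ps"
      "measure ?M ?B = measure lebesgue ?B"
    using sub by blast+
  ultimately have P: "?Pt \<in> sets ?M" "?Ps \<in> sets ?M" "measure ?M ?Pt = measure lebesgue ?Pt"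
      "measure ?M ?Ps = measure lebesgue ?Ps" "measure ?M ?B = measure lebesgue ?B"
    by simp_all
  have Pi: "integrable ?M (indicator ?Pt :: _ \<Rightarrow> real)" "integrable ?M (indicator ?Ps :: _ \<Rightarrow> real)"
    using P by (auto intro!: integrable_real_indicator simp: emeasure_eq_measure)
  have "(\<integral>z. Ev z \<partial>?M) \<le> (\<integral>z. Eu z + a\<^sup>2 * indicator ?Pt z - \<rho>\<^sup>2 * indicator ?Ps z \<partial>?M)"
  proof (rule integral_mono_AE[OF Ev])
    show "integrable ?M (\<lambda>z. Eu z + a\<^sup>2 * indicator ?Pt z - \<rho>\<^sup>2 * indicator ?Ps z)"
      using Eu Pi by auto
    show "AE z in ?M. Ev z \<le> Eu z + a\<^sup>2 * indicator ?Pt z - \<rho>\<^sup>2 * indicator ?Ps z"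
      using gv_le AE_space
    proof eventually_elim
      case (elim z)
      then have zB: "z \<in> ?B"
        by simp
      \<comment> \<open>The gradient changes only where \<open>u\<close> exceeds the nonnegative
        barrier, hence inside the positivity set.\<close>
      have 1: "(norm (gv z))\<^sup>2 \<le> (norm (g z))\<^sup>2 + a\<^sup>2 * indicator ?Pt z"
      proof -
        have "0 \<le> (norm (g z))\<^sup>2" "0 \<le> a\<^sup>2 * indicator ?Pt z"
          by simp_all
        moreover have "indicator ?Pt z = (1 :: real)" if "u z > ?q z"
          using that q_nonneg[of z] zB by (auto simp: indicator_def)
        ultimately show ?thesis
          using elim(1) by (cases "u z > ?q z"; simp only: if_True if_False; simp)
      qed
      \<comment> \<open>On \<open>ball y s\<close> the barrier is 0, so the competitor is nowhere
        positive there; elsewhere \<open>v \<le> u\<close> suffices.\<close>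
      have 2: "(qp z)\<^sup>2 * indicator {z. v z > 0} z
          \<le> (qp z)\<^sup>2 * indicator {z. u z > 0} z - \<rho>\<^sup>2 * indicator ?Ps z"
      proof (cases "z \<in> ball y s")
        case True
        then have "(norm (z - y))\<^sup>2 \<le> s\<^sup>2"
          by (intro power_mono) (auto simp: dist_norm norm_minus_commute)
        then have "?q z = 0"
          using c by (simp add: barrier_def mult_nonneg_nonpos)
        moreover have "\<rho>\<^sup>2 \<le> (qp z)\<^sup>2"
          using \<rho> zB by (intro power_mono) auto
        ultimately show ?thesis
          using True by (auto simp: indicator_def v_def)
      next
        case False
        then show ?thesis
          by (auto simp: indicator_def v_def)
      qed
      \<comment> \<open>A nonnegative barrier leaves the negative phase untouched.\<close>
      have 3: "(qm z)\<^sup>2 * indicator {z. v z < 0} z = (qm z)\<^sup>2 * indicator {z. u z < 0} z"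
        using q_nonneg[of z] by (auto simp: indicator_def v_def)
      show ?case
        using 1 2 3 unfolding Ev_def Eu_def by linarith
    qed
  qed
  also have "\<dots> = (\<integral>z. Eu z \<partial>?M) + a\<^sup>2 * measure lebesgue ?Pt - \<rho>\<^sup>2 * measure lebesgue ?Ps"
  proof -
    have "?Pt \<inter> ?B = ?Pt" "?Ps \<inter> ?B = ?Ps"
      using sub by blast+
    then show ?thesis
      using Eu Pi P by simp
  qed
  finally have comparison: "J_fun qp qm y t v
      \<le> J_fun qp qm y t u + a\<^sup>2 * measure lebesgue ?Pt - \<rho>\<^sup>2 * measure lebesgue ?Ps"
    by (simp add: Ju Jv)
  \<comment> \<open>A bound for the energy density of \<open>v\<close>: the gradient is that of
    \<open>u\<close> or that of the barrier.\<close>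
  let ?K = "real DIM('a) * L\<^sup>2 + Mp\<^sup>2 + Mm\<^sup>2 + a\<^sup>2"
  have "(\<integral>z. Ev z \<partial>?M) \<le> (\<integral>z. ?K \<partial>?M)"
  proof (rule integral_mono_AE[OF Ev])
    show "AE z in ?M. Ev z \<le> ?K"
      using gv_bd qp(2) qm(2)
    proof eventually_elim
      case (elim z)
      have "(qp z)\<^sup>2 \<le> Mp\<^sup>2" "(qm z)\<^sup>2 \<le> Mm\<^sup>2"
        using elim by (auto simp: abs_le_square_iff[symmetric])
      then have "(qp z)\<^sup>2 * indicator {z. v z > 0} z \<le> Mp\<^sup>2" "(qm z)\<^sup>2 * indicator {z. v z < 0} z \<le> Mm\<^sup>2"
        by (auto simp: indicator_def)
      then show ?case
        using elim(1) unfolding Ev_def by linarith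
    qed
  qed simp
  also have "\<dots> = ?K * measure lebesgue ?B"
    using P(5) by simp
  finally have "J_fun qp qm y t v \<le> ?K * measure lebesgue ?B"
    by (simp add: Jv)
  \<comment> \<open>Almost minimality reads J(u) <= J(v) + k J(v). The first J(v) is estimated by
    the comparison with J(u), which then cancels; the second by the crude bound.\<close>
  from mult_left_mono[OF this k(1)]
  show ?thesis
    using J comparison by (simp add: algebra_simps)
qed

section \<open>Hausdorff measure\<close>

definition hausdorff_cover :: "real \<Rightarrow> 'a::metric_space set \<Rightarrow> (nat \<Rightarrow> 'a set) \<Rightarrow> bool" where
  "hausdorff_cover \<delta> A S \<longleftrightarrow> A \<subseteq> (\<Union>i. S i) \<and> (\<forall>i. bounded (S i) \<and> diameter (S i) \<le> \<delta>)"

lemma hausdorff_content_cover: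
  "hausdorff_content k \<delta> A = (INF S\<in>Collect (hausdorff_cover \<delta> A). \<Sum>i. hausdorff_gauge k (S i))"
  unfolding hausdorff_content_def hausdorff_cover_def by simp

lemma hausdorff_content_le:
  "hausdorff_cover \<delta> A S \<Longrightarrow> hausdorff_content k \<delta> A \<le> (\<Sum>i. hausdorff_gauge k (S i))"
  unfolding hausdorff_content_cover by (rule INF_lower) simp

lemma hausdorff_content_greatest:
  assumes "\<And>S. hausdorff_cover \<delta> A S \<Longrightarrow> x \<le> (\<Sum>i. hausdorff_gauge k (S i))"
  shows "x \<le> hausdorff_content k \<delta> A"
  unfolding hausdorff_content_cover using assms by (intro INF_greatest) simp

lemma hausdorff_content_close:
  assumes "hausdorff_content k \<delta> A < \<infinity>" "0 < e"
  obtains S where "hausdorff_cover \<delta> A S"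
    "(\<Sum>i. hausdorff_gauge k (S i)) \<le> hausdorff_content k \<delta> A + ennreal e"
proof -
  have "hausdorff_content k \<delta> A < hausdorff_content k \<delta> A + ennreal e"
    using ennreal_add_left_cancel_less[of "hausdorff_content k \<delta> A" 0 "ennreal e"] assms by simp
  then show ?thesis
    using that unfolding hausdorff_content_cover INF_less_iff by (auto intro: less_imp_le)
qed

lemma hausdorff_content_mono: "A \<subseteq> B \<Longrightarrow> hausdorff_content k \<delta> A \<le> hausdorff_content k \<delta> B"
  by (intro hausdorff_content_greatest hausdorff_content_le) (auto simp: hausdorff_cover_def)

lemma hausdorff_content_antimono:
  "\<delta> \<le> \<delta>' \<Longrightarrow> hausdorff_content k \<delta>' A \<le> hausdorff_content k \<delta> A"
  by (intro hausdorff_content_greatest hausdorff_content_le) (auto simp: hausdorff_cover_def intro: order_trans)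

lemma hausdorff_content_empty:
  assumes "0 < \<delta>" shows "hausdorff_content k \<delta> {} = 0"
proof -
  have "hausdorff_cover \<delta> {} (\<lambda>_. {})"
    using assms by (simp add: hausdorff_cover_def)
  from hausdorff_content_le[OF this, of k] show ?thesis
    by (simp add: hausdorff_gauge_def)
qed

lemma hausdorff_content_countably_subadditive:
  "hausdorff_content k \<delta> (\<Union>n. A n) \<le> (\<Sum>n. hausdorff_content k \<delta> (A n))"
proof (rule ennreal_le_epsilon)
  fix e :: real assume fin: "(\<Sum>n. hausdorff_content k \<delta> (A n)) < top" and e: "0 < e"
  have "hausdorff_content k \<delta> (A n) < \<infinity>" for n
    using fin by (metis ennreal_suminf_lessD infinity_ennreal_def)
  then have "\<exists>S. hausdorff_cover \<delta> (A n) S \<and> (\<Sum>i. hausdorff_gauge k (S i))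
      \<le> hausdorff_content k \<delta> (A n) + ennreal (e * (1 / 2) ^ Suc n)" for n
    using e by (metis hausdorff_content_close mult_pos_pos zero_less_power half_gt_zero zero_less_one)
  then obtain S where S: "\<And>n. hausdorff_cover \<delta> (A n) (S n)"
    "\<And>n. (\<Sum>i. hausdorff_gauge k (S n i)) \<le> hausdorff_content k \<delta> (A n) + ennreal (e * (1 / 2) ^ Suc n)"
    by metis
  have "hausdorff_cover \<delta> (\<Union>n. A n) (case_prod S \<circ> prod_decode)"
    unfolding hausdorff_cover_def
  proof (intro conjI allI subsetI)
    fix x assume "x \<in> (\<Union>n. A n)"
    then obtain n i where "x \<in> S n i"
      using S(1) unfolding hausdorff_cover_def by blast
    then have "x \<in> (case_prod S \<circ> prod_decode) (prod_encode (n, i))"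
      by simp
    then show "x \<in> (\<Union>i. (case_prod S \<circ> prod_decode) i)"
      by blast
  qed (use S(1) in \<open>auto simp: hausdorff_cover_def split: prod.splits\<close>)
  from hausdorff_content_le[OF this, of k]
  have "hausdorff_content k \<delta> (\<Union>n. A n) \<le> (\<Sum>i. hausdorff_gauge k ((case_prod S \<circ> prod_decode) i))" .
  also have "\<dots> = (\<Sum>n. \<Sum>i. hausdorff_gauge k (S n i))"
    using suminf_ennreal_2dimen[of "\<lambda>n. \<Sum>i. hausdorff_gauge k (S n i)"
        "\<lambda>p. hausdorff_gauge k (S (fst p) (snd p))"]
    by (simp add: comp_def case_prod_unfold)
  also have "\<dots> \<le> (\<Sum>n. hausdorff_content k \<delta> (A n) + ennreal (e * (1 / 2) ^ Suc n))"
    by (intro suminf_le S(2)) auto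
  also have "\<dots> = (\<Sum>n. hausdorff_content k \<delta> (A n)) + (\<Sum>n. ennreal (e * (1 / 2) ^ Suc n))"
    by (rule suminf_add[symmetric]) auto
  also have "(\<Sum>n. ennreal (e * (1 / 2) ^ Suc n)) = ennreal e"
    using sums_mult[OF power_half_series, of e] e
    by (intro suminf_ennreal_eq) auto
  finally show "hausdorff_content k \<delta> (\<Union>n. A n) \<le> (\<Sum>n. hausdorff_content k \<delta> (A n)) + ennreal e" .
qed

lemma hausdorff_content_le_outer: "0 < \<delta> \<Longrightarrow> hausdorff_content k \<delta> A \<le> hausdorff_outer k A"
  unfolding hausdorff_outer_def by (rule SUP_upper) simp

lemma hausdorff_outer_least:
  "(\<And>\<delta>. 0 < \<delta> \<Longrightarrow> hausdorff_content k \<delta> A \<le> x) \<Longrightarrow> hausdorff_outer k A \<le> x"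
  unfolding hausdorff_outer_def by (rule SUP_least) simp

lemma hausdorff_outer_mono: "A \<subseteq> B \<Longrightarrow> hausdorff_outer k A \<le> hausdorff_outer k B"
  by (intro hausdorff_outer_least order_trans[OF hausdorff_content_mono hausdorff_content_le_outer])

lemma hausdorff_outer_empty: "hausdorff_outer k {} = 0"
  using hausdorff_outer_least[of k "{}" 0] by (simp add: hausdorff_content_empty)

lemma hausdorff_outer_countably_subadditive:
  "hausdorff_outer k (\<Union>n. A n) \<le> (\<Sum>n. hausdorff_outer k (A n))"
  by (intro hausdorff_outer_least order_trans[OF hausdorff_content_countably_subadditive]
      suminf_le hausdorff_content_le_outer) auto

lemma hausdorff_outer_measure_space: "outer_measure_space UNIV (hausdorff_outer k)"
  unfolding outer_measure_space_def
  by (auto simp: positive_def increasing_def countably_subadditive_def hausdorff_outer_empty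
      hausdorff_outer_mono hausdorff_outer_countably_subadditive)

lemma hausdorff_outer_Un_le: "hausdorff_outer k (A \<union> B) \<le> hausdorff_outer k A + hausdorff_outer k B"
proof -
  have "hausdorff_outer k (A \<union> B) = hausdorff_outer k (\<Union>n. binaryset A B n)"
    by (simp add: UN_binaryset_eq)
  also have "\<dots> \<le> (\<Sum>n. hausdorff_outer k (binaryset A B n))"
    by (rule hausdorff_outer_countably_subadditive)
  also have "\<dots> = hausdorff_outer k A + hausdorff_outer k B"
    by (rule suminf_binaryset_eq) (rule hausdorff_outer_empty)
  finally show ?thesis .
qed

text \<open>A set of diameter below \<open>d\<close> meets at most one of \<open>A\<close> and
  \<open>B\<close>, so a cover of the union splits into a cover of each, with empty sets in the
  remaining places.\<close>

lemma hausdorff_content_separated: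
  assumes "\<delta> < d" "\<And>a b. a \<in> A \<Longrightarrow> b \<in> B \<Longrightarrow> d \<le> dist a b" "0 \<le> \<delta>"
  shows "hausdorff_content k \<delta> A + hausdorff_content k \<delta> B \<le> hausdorff_content k \<delta> (A \<union> B)"
proof (rule hausdorff_content_greatest)
  fix S assume S: "hausdorff_cover \<delta> (A \<union> B) S"
  let ?SA = "\<lambda>i. if S i \<inter> A = {} then {} else S i"
  let ?SB = "\<lambda>i. if S i \<inter> B = {} then {} else S i"
  have "hausdorff_cover \<delta> A ?SA" "hausdorff_cover \<delta> B ?SB"
    using S assms(3) unfolding hausdorff_cover_def by fastforce+
  then have "hausdorff_content k \<delta> A + hausdorff_content k \<delta> B
      \<le> (\<Sum>i. hausdorff_gauge k (?SA i)) + (\<Sum>i. hausdorff_gauge k (?SB i))"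
    by (intro add_mono hausdorff_content_le)
  also have "\<dots> = (\<Sum>i. hausdorff_gauge k (?SA i) + hausdorff_gauge k (?SB i))"
    by (rule suminf_add) auto
  also have "\<dots> \<le> (\<Sum>i. hausdorff_gauge k (S i))"
  proof (rule suminf_le)
    fix i
    have "S i \<inter> A = {} \<or> S i \<inter> B = {}"
    proof (rule ccontr)
      assume "\<not> ?thesis"
      then obtain a b where ab: "a \<in> S i" "a \<in> A" "b \<in> S i" "b \<in> B"
        by blast
      then have "dist a b \<le> diameter (S i)"
        using S by (intro diameter_bounded_bound) (auto simp: hausdorff_cover_def)
      moreover have "diameter (S i) \<le> \<delta>"
        using S by (simp add: hausdorff_cover_def)
      ultimately show False
        using assms(1) assms(2)[OF ab(2,4)] by linarith
    qed
    then show "hausdorff_gauge k (?SA i) + hausdorff_gauge k (?SB i) \<le> hausdorff_gauge k (S i)"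
      by (auto simp: hausdorff_gauge_def)
  qed auto
  finally show "hausdorff_content k \<delta> A + hausdorff_content k \<delta> B \<le> (\<Sum>i. hausdorff_gauge k (S i))" .
qed

lemma hausdorff_outer_separated:
  assumes "0 < d" "\<And>a b. a \<in> A \<Longrightarrow> b \<in> B \<Longrightarrow> d \<le> dist a b"
  shows "hausdorff_outer k A + hausdorff_outer k B \<le> hausdorff_outer k (A \<union> B)"
proof -
  have "hausdorff_content k \<delta>1 A + hausdorff_content k \<delta>2 B \<le> hausdorff_outer k (A \<union> B)"
    if "0 < \<delta>1" "0 < \<delta>2" for \<delta>1 \<delta>2
  proof -
    \<comment> \<open>A common scale below \<open>d\<close>; passing to a finer scale only increases
      the contents.\<close>
    define \<delta> where "\<delta> = min (min \<delta>1 \<delta>2) (d / 2)"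
    have \<delta>: "0 < \<delta>" "\<delta> < d" "\<delta> \<le> \<delta>1" "\<delta> \<le> \<delta>2"
      using that assms(1) by (auto simp: \<delta>_def min_def)
    have "hausdorff_content k \<delta>1 A + hausdorff_content k \<delta>2 B
        \<le> hausdorff_content k \<delta> A + hausdorff_content k \<delta> B"
      by (intro add_mono hausdorff_content_antimono \<delta>)
    also have "\<dots> \<le> hausdorff_content k \<delta> (A \<union> B)"
      using \<delta> assms by (intro hausdorff_content_separated) auto
    also have "\<dots> \<le> hausdorff_outer k (A \<union> B)"
      by (rule hausdorff_content_le_outer[OF \<delta>(1)])
    finally show ?thesis .
  qed
  then have "hausdorff_content k \<delta>1 A + hausdorff_outer k B \<le> hausdorff_outer k (A \<union> B)"
    if "0 < \<delta>1" for \<delta>1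
    unfolding hausdorff_outer_def[of k B] using that
    by (subst ennreal_SUP_add_right) (auto intro!: SUP_least)
  then show ?thesis
    unfolding hausdorff_outer_def[of k A]
    by (subst ennreal_SUP_add_left[symmetric]) (auto intro!: SUP_least)
qed

text \<open>Caratheodory's argument: \<open>A - F\<close> is exhausted by the parts \<open>E n\<close> at distance at least
  \<open>1 / (n + 1)\<close> from \<open>F\<close>, and every second of the shells \<open>R n\<close> is separated from the others of the same parity,
  so that the measures of the shells are summable.\<close>

lemma hausdorff_outer_closed_split:
  fixes F :: "'a::metric_space set"
  assumes "closed F"
  shows "hausdorff_outer k (A \<inter> F) + hausdorff_outer k (A - F) \<le> hausdorff_outer k A"
proof (cases "F = {} \<or> hausdorff_outer k A = \<infinity>")
  case True
  then show ?thesis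
    by (auto simp: hausdorff_outer_empty)
next
  case False
  then have F: "F \<noteq> {}" and fin: "hausdorff_outer k A < \<infinity>"
    by (auto simp: less_top)
  define E where "E n = {x \<in> A. 1 / real (Suc n) \<le> infdist x F}" for n
  define R where "R n = {x \<in> A. 1 / real (Suc (Suc n)) \<le> infdist x F \<and> infdist x F < 1 / real (Suc n)}" for n
  let ?f = "\<lambda>n. hausdorff_outer k (R n)"
  have dist_ge: "infdist x F - infdist y F \<le> dist x y" for x y
    using infdist_triangle[of x F y] by (simp add: dist_commute)
  have shells: "(\<Sum>i<n. ?f (2 * i + p)) \<le> hausdorff_outer k (\<Union>i<n. R (2 * i + p))" for n p
  proof (induction n)
    case (Suc n)
    \<comment> \<open>The width of the omitted shell \<open>R (2 * n + p - 1)\<close>. For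
      \<open>n = 0\<close> there is no earlier shell, and the formula could involve a division by 0;
      hence the case distinction.\<close>
    let ?d = "1 / real (2 * n + p) - 1 / real (2 * n + p + 1)"
    have "(\<Sum>i<Suc n. ?f (2 * i + p)) \<le> hausdorff_outer k (\<Union>i<n. R (2 * i + p)) + ?f (2 * n + p)"
      using Suc by (simp add: add_right_mono)
    also have "\<dots> \<le> hausdorff_outer k ((\<Union>i<n. R (2 * i + p)) \<union> R (2 * n + p))"
    proof (cases "n = 0")
      case False
      show ?thesis
      proof (rule hausdorff_outer_separated)
        show "0 < ?d"
        proof -
          have "0 < real (2 * n + p)"
            using False by simp
          then have "1 / (real (2 * n + p) + 1) < 1 / real (2 * n + p)"
            by (intro divide_strict_left_mono) (auto intro!: mult_pos_pos)
          then show ?thesis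
            by (simp only: of_nat_add of_nat_1)
        qed
        fix a b assume "a \<in> (\<Union>i<n. R (2 * i + p))" and b: "b \<in> R (2 * n + p)"
        then obtain i where i: "i < n" "a \<in> R (2 * i + p)"
          by auto
        have "1 / real (2 * n + p) \<le> 1 / real (Suc (Suc (2 * i + p)))"
          using i(1) by (intro divide_left_mono) auto
        also have "\<dots> \<le> infdist a F"
          using i(2) by (simp add: R_def)
        finally have "1 / real (2 * n + p) \<le> infdist a F" .
        moreover have "infdist b F < 1 / real (2 * n + p + 1)"
          using b by (simp add: R_def add.commute)
        ultimately show "?d \<le> dist a b"
          using dist_ge[of a b] by linarith
      qed
    qed (simp add: hausdorff_outer_empty)
    also have "(\<Union>i<n. R (2 * i + p)) \<union> R (2 * n + p) = (\<Union>i<Suc n. R (2 * i + p))"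
      by (auto simp: lessThan_Suc)
    finally show ?case .
  qed (simp add: hausdorff_outer_empty)
  have half: "(\<Sum>i<n. ?f (2 * i + p)) \<le> hausdorff_outer k A" for n p
    by (rule order_trans[OF shells]) (auto intro!: hausdorff_outer_mono simp: R_def)
  have "(\<Sum>i<n. ?f i) \<le> hausdorff_outer k A + hausdorff_outer k A" for n
  proof -
    have "(\<Sum>i<n. ?f i) \<le> (\<Sum>i<2 * n. ?f i)"
      by (intro sum_mono2) auto
    also have "\<dots> = (\<Sum>i<n. ?f (2 * i + 0)) + (\<Sum>i<n. ?f (2 * i + 1))"
      by (induction n) (auto simp: algebra_simps)
    also have "\<dots> \<le> hausdorff_outer k A + hausdorff_outer k A"
      by (intro add_mono half)
    finally show ?thesis .
  qed
  then have "suminf ?f \<le> hausdorff_outer k A + hausdorff_outer k A"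
    by (simp add: suminf_eq_SUP SUP_least)
  also have "\<dots> < top"
    using fin by simp
  finally have sum_fin: "suminf ?f < top" .
  have cover: "A - F \<subseteq> E n \<union> (\<Union>i. R (i + n))" for n
  proof
    fix x assume x: "x \<in> A - F"
    then have pos: "0 < infdist x F"
      using infdist_pos_not_in_closed[OF assms F] by auto
    show "x \<in> E n \<union> (\<Union>i. R (i + n))"
    proof (cases "x \<in> E n")
      case False
      obtain j where "1 / real (Suc j) < infdist x F"
        using nat_approx_posE[OF pos] by blast
      then have ex: "\<exists>j. 1 / real (Suc j) \<le> infdist x F"
        by (auto intro: less_imp_le)
      define m where "m = (LEAST j. 1 / real (Suc j) \<le> infdist x F)"
      have m: "1 / real (Suc m) \<le> infdist x F"
        unfolding m_def using LeastI_ex[OF ex] .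
      have m_least: "infdist x F < 1 / real (Suc j)" if "j < m" for j
        using not_less_Least[of j "\<lambda>j. 1 / real (Suc j) \<le> infdist x F"] that
        unfolding m_def by (simp add: not_le)
      have "n < m"
      proof (rule ccontr)
        assume "\<not> n < m"
        then have "1 / real (Suc n) \<le> 1 / real (Suc m)"
          by (intro divide_left_mono) auto
        then show False
          using m False x by (simp add: E_def)
      qed
      then obtain i where i: "m = Suc (i + n)"
        by (metis add.commute less_imp_Suc_add)
      then have "x \<in> R (i + n)"
        using m m_least[of "i + n"] x by (simp add: R_def)
      then show ?thesis
        by blast
    qed simp
  qed
  \<comment> \<open>Adding the first \<open>n\<close> shells on both sides avoids subtraction of
    extended reals. In the limit the whole sum stands on both sides and cancels, being
    finite.\<close>
  have "hausdorff_outer k (A \<inter> F) + hausdorff_outer k (A - F) + (\<Sum>i<n. ?f i)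
      \<le> hausdorff_outer k A + suminf ?f" for n
  proof -
    have "hausdorff_outer k (A - F) \<le> hausdorff_outer k (E n \<union> (\<Union>i. R (i + n)))"
      by (rule hausdorff_outer_mono[OF cover])
    also have "\<dots> \<le> hausdorff_outer k (E n) + (\<Sum>i. ?f (i + n))"
      by (rule order_trans[OF hausdorff_outer_Un_le])
        (intro add_left_mono hausdorff_outer_countably_subadditive)
    finally have "hausdorff_outer k (A \<inter> F) + hausdorff_outer k (A - F) + (\<Sum>i<n. ?f i)
        \<le> hausdorff_outer k (A \<inter> F) + (hausdorff_outer k (E n) + (\<Sum>i. ?f (i + n))) + (\<Sum>i<n. ?f i)"
      by (intro add_mono order_refl)
    also have "\<dots> = (hausdorff_outer k (A \<inter> F) + hausdorff_outer k (E n)) + ((\<Sum>i<n. ?f i) + (\<Sum>i. ?f (i + n)))"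
      by (simp add: ac_simps)
    also have "(\<Sum>i<n. ?f i) + (\<Sum>i. ?f (i + n)) = suminf ?f"
      using suminf_offset[of ?f n] by (simp add: add.commute)
    also have "hausdorff_outer k (A \<inter> F) + hausdorff_outer k (E n) \<le> hausdorff_outer k ((A \<inter> F) \<union> E n)"
    proof (rule hausdorff_outer_separated)
      show "0 < 1 / real (Suc n)"
        by simp
      fix a b assume "a \<in> A \<inter> F" "b \<in> E n"
      then show "1 / real (Suc n) \<le> dist a b"
        using dist_ge[of b a] by (simp add: E_def dist_commute)
    qed
    also have "hausdorff_outer k ((A \<inter> F) \<union> E n) \<le> hausdorff_outer k A"
      by (intro hausdorff_outer_mono) (auto simp: E_def)
    finally show ?thesis
      by (simp add: add_right_mono)
  qed
  then have "(SUP n. hausdorff_outer k (A \<inter> F) + hausdorff_outer k (A - F) + (\<Sum>i<n. ?f i))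
      \<le> hausdorff_outer k A + suminf ?f"
    by (rule SUP_least)
  then have "hausdorff_outer k (A \<inter> F) + hausdorff_outer k (A - F) + suminf ?f
      \<le> hausdorff_outer k A + suminf ?f"
    by (subst (asm) ennreal_SUP_add_right[symmetric]) (auto simp: suminf_eq_SUP)
  then show ?thesis
    using sum_fin by (auto simp: add.commute[of _ "suminf ?f"] ennreal_add_left_cancel_le)
qed

text \<open>The sets satisfying Caratheodory's condition form a sigma-algebra, and it contains the
  closed sets, which generate the Borel sets.\<close>

lemma borel_subset_lambda_system:
  "sets (borel :: 'a::metric_space measure) \<subseteq> lambda_system UNIV UNIV (hausdorff_outer k)"
proof -
  interpret sigma_algebra "UNIV :: 'a set" UNIV
    by (metis Pow_UNIV sigma_algebra_Pow)
  have ms: "measure_space UNIV (lambda_system UNIV UNIV (hausdorff_outer k :: 'a set \<Rightarrow> ennreal)) (hausdorff_outer k)"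
    by (rule caratheodory_lemma[OF hausdorff_outer_measure_space])
  then have sa: "sigma_algebra UNIV (lambda_system UNIV UNIV (hausdorff_outer k :: 'a set \<Rightarrow> ennreal))"
    by (simp add: measure_space_def)
  have "F \<in> lambda_system UNIV UNIV (hausdorff_outer k)" if "closed F" for F :: "'a set"
    unfolding lambda_system_def
  proof (clarsimp, rule antisym)
    fix A
    have "F \<inter> A = A \<inter> F" "(UNIV - F) \<inter> A = A - F"
      by auto
    then show "hausdorff_outer k (F \<inter> A) + hausdorff_outer k ((UNIV - F) \<inter> A) \<le> hausdorff_outer k A"
      using hausdorff_outer_closed_split[OF that, of k A] by simp
    have "hausdorff_outer k A \<le> hausdorff_outer k ((F \<inter> A) \<union> ((UNIV - F) \<inter> A))"
      by (intro hausdorff_outer_mono) auto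
    also have "\<dots> \<le> hausdorff_outer k (F \<inter> A) + hausdorff_outer k ((UNIV - F) \<inter> A)"
      by (rule hausdorff_outer_Un_le)
    finally show "hausdorff_outer k A \<le> hausdorff_outer k (F \<inter> A) + hausdorff_outer k ((UNIV - F) \<inter> A)" .
  qed
  then have "sigma_sets UNIV (Collect closed) \<subseteq> lambda_system UNIV UNIV (hausdorff_outer k :: 'a set \<Rightarrow> ennreal)"
    by (intro sigma_algebra.sigma_sets_subset[OF sa]) auto
  then show ?thesis
    by (simp add: borel_eq_closed)
qed

lemma sets_hausdorff_measure [simp]: "sets (hausdorff_measure k) = sets borel"
  using sets.sigma_sets_eq[of borel] by (simp add: hausdorff_measure_def)

lemma space_hausdorff_measure [simp]: "space (hausdorff_measure k) = UNIV"
  by (simp add: hausdorff_measure_def)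

text \<open>\<open>measure_of\<close> degenerates to the zero measure unless the given set function
  is a measure on the sigma-algebra; Caratheodory's theorem rules this out.\<close>

lemma emeasure_hausdorff_measure:
  fixes A :: "'a::metric_space set"
  assumes "A \<in> sets borel"
  shows "emeasure (hausdorff_measure k) A = hausdorff_outer k A"
proof -
  interpret sigma_algebra "UNIV :: 'a set" UNIV
    by (metis Pow_UNIV sigma_algebra_Pow)
  have "sigma_algebra UNIV (sets (borel :: 'a measure))"
    using sets.sigma_algebra_axioms[of "borel :: 'a measure"] by simp
  from measure_down[OF caratheodory_lemma[OF hausdorff_outer_measure_space] this borel_subset_lambda_system]
  have "positive (sets (borel :: 'a measure)) (hausdorff_outer k)"
    "countably_additive (sets (borel :: 'a measure)) (hausdorff_outer k)"
    by (simp_all add: measure_space_def)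
  then show ?thesis
    using assms by (intro emeasure_measure_of[OF hausdorff_measure_def]) simp_all
qed

section \<open>Spheres have finite and positive surface measure\<close>

lemma hausdorff_outer_image_le:
  fixes f :: "'a::real_normed_vector \<Rightarrow> 'a"
  assumes "\<And>x y. dist (f x) (f y) \<le> dist x y"
  shows "hausdorff_outer k (f ` A) \<le> hausdorff_outer k A"
proof -
  have "hausdorff_content k \<delta> (f ` A) \<le> hausdorff_content k \<delta> A" if "0 < \<delta>" for \<delta>
  proof (rule hausdorff_content_greatest)
    fix S assume S: "hausdorff_cover \<delta> A S"
    have b: "bounded (S i)" for i
      using S by (simp add: hausdorff_cover_def)
    have d: "diameter (f ` S i) \<le> diameter (S i)" for i
    proof (rule diameter_le)
      show "f ` S i \<noteq> {} \<or> 0 \<le> diameter (S i)"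
        using diameter_ge_0[OF b] by simp
      fix x y assume "x \<in> f ` S i" "y \<in> f ` S i"
      then obtain x' y' where "x = f x'" "y = f y'" "x' \<in> S i" "y' \<in> S i"
        by blast
      then show "norm (x - y) \<le> diameter (S i)"
        using order_trans[OF assms diameter_bounded_bound[OF b]] by (simp add: dist_norm[symmetric])
    qed
    have bf: "bounded (f ` S i)" for i
    proof -
      obtain c e where "\<forall>y\<in>S i. dist c y \<le> e"
        using b[of i] unfolding bounded_def by blast
      then have "\<forall>y\<in>f ` S i. dist (f c) y \<le> e"
        using assms order_trans by blast
      then show ?thesis
        unfolding bounded_def by blast
    qed
    have "f ` A \<subseteq> (\<Union>i. f ` S i)"
      using S unfolding hausdorff_cover_def by blast
    moreover have "diameter (f ` S i) \<le> \<delta>" for i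
      using d[of i] S order_trans unfolding hausdorff_cover_def by blast
    ultimately have "hausdorff_cover \<delta> (f ` A) (\<lambda>i. f ` S i)"
      using bf unfolding hausdorff_cover_def by blast
    then have "hausdorff_content k \<delta> (f ` A) \<le> (\<Sum>i. hausdorff_gauge k (f ` S i))"
      by (rule hausdorff_content_le)
    also have "\<dots> \<le> (\<Sum>i. hausdorff_gauge k (S i))"
    proof (rule suminf_le)
      fix i
      show "hausdorff_gauge k (f ` S i) \<le> hausdorff_gauge k (S i)"
        using d[of i] diameter_ge_0[OF bf[of i]] unfolding hausdorff_gauge_def
        by (auto intro!: ennreal_leI mult_left_mono power_mono)
    qed auto
    finally show "hausdorff_content k \<delta> (f ` A) \<le> (\<Sum>i. hausdorff_gauge k (S i))" .
  qed
  then show ?thesis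
    by (intro hausdorff_outer_least order_trans[OF _ hausdorff_content_le_outer])
qed

lemma power_diff_le:
  fixes a b :: real
  assumes "0 \<le> b" "b \<le> a"
  shows "a ^ n - b ^ n \<le> real n * a ^ (n - 1) * (a - b)"
proof (cases n)
  case (Suc m)
  have "(\<Sum>p\<le>m. a ^ p * b ^ (m - p)) \<le> (\<Sum>p\<le>m. a ^ m)"
  proof (rule sum_mono)
    fix p assume "p \<in> {..m}"
    then have "a ^ m = a ^ p * a ^ (m - p)"
      by (simp flip: power_add)
    then show "a ^ p * b ^ (m - p) \<le> a ^ m"
      using assms by (auto intro!: mult_left_mono power_mono)
  qed
  then have "(a - b) * (\<Sum>p\<le>m. a ^ p * b ^ (m - p)) \<le> (a - b) * (real (Suc m) * a ^ m)"
    using assms by (intro mult_left_mono) auto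
  moreover have "a ^ Suc m - b ^ Suc m = (a - b) * (\<Sum>p\<le>m. a ^ p * b ^ (m - p))"
    using power_diff_sumr2[of a "Suc m" b] by (simp add: lessThan_Suc_atMost mult_ac sum_distrib_left)
  ultimately show ?thesis
    using Suc by (simp add: mult_ac)
qed simp

text \<open>Packing: the balls of radius \<open>e / 2\<close> around the points of \<open>T\<close> are disjoint and contained
  in a shell of thickness \<open>e\<close> around the sphere.\<close>

lemma separated_card_le:
  fixes x :: "'a::euclidean_space"
  assumes T: "finite T" "T \<subseteq> sphere x r" "\<And>p q. p \<in> T \<Longrightarrow> q \<in> T \<Longrightarrow> p \<noteq> q \<Longrightarrow> e \<le> dist p q"
    and e: "0 < e" "e \<le> r"
  shows "real (card T) * e ^ (DIM('a) - 1) \<le> 2 ^ DIM('a) * real DIM('a) * (2 * r) ^ (DIM('a) - 1)"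
proof -
  let ?n = "DIM('a)" and ?\<omega> = "unit_ball_vol (real DIM('a))"
  have "(\<Union>p\<in>T. ball p (e / 2)) \<subseteq> cball x (r + e / 2) - ball x (r - e / 2)"
  proof clarify
    fix p y assume p: "p \<in> T" and y: "y \<in> ball p (e / 2)"
    have "dist x p = r" "dist p y < e / 2"
      using p y T(2) by (auto simp: mem_ball)
    then show "y \<in> cball x (r + e / 2) - ball x (r - e / 2)"
      using dist_triangle[of x y p] dist_triangle[of x p y] by (auto simp: dist_commute mem_ball mem_cball)
  qed
  moreover have "emeasure lborel (cball x (r + e / 2) - ball x (r - e / 2)) < \<infinity>"
    by (rule emeasure_bounded_finite[OF bounded_subset[OF bounded_cball Diff_subset]])
  ultimately have "measure lborel (\<Union>p\<in>T. ball p (e / 2)) \<le> measure lborel (cball x (r + e / 2) - ball x (r - e / 2))"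
    by (intro measure_mono_fmeasurable) (auto simp: fmeasurable_def intro!: borel_open open_UN)
  also have "\<dots> = measure lborel (cball x (r + e / 2)) - measure lborel (ball x (r - e / 2))"
  proof (rule measure_Diff)
    show "emeasure lborel (cball x (r + e / 2)) \<noteq> \<infinity>"
      using emeasure_bounded_finite[OF bounded_cball[of x "r + e / 2"]] by simp
    show "ball x (r - e / 2) \<subseteq> cball x (r + e / 2)"
      using e by (intro subset_trans[OF ball_subset_cball] subset_cball) simp
  qed simp_all
  also have "\<dots> = ?\<omega> * ((r + e / 2) ^ ?n - (r - e / 2) ^ ?n)"
    using e by (simp add: measure_def emeasure_cball emeasure_ball right_diff_distrib)
  also have "\<dots> \<le> ?\<omega> * (real ?n * (r + e / 2) ^ (?n - 1) * ((r + e / 2) - (r - e / 2)))"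
    using e by (intro mult_left_mono power_diff_le) auto
  also have "\<dots> \<le> ?\<omega> * (real ?n * (2 * r) ^ (?n - 1) * e)"
  proof -
    have "(r + e / 2) ^ (?n - 1) \<le> (2 * r) ^ (?n - 1)"
      by (intro power_mono) (use e in auto)
    then have "real ?n * (r + e / 2) ^ (?n - 1) * e \<le> real ?n * (2 * r) ^ (?n - 1) * e"
      using e by (intro mult_right_mono mult_left_mono) auto
    then show ?thesis
      by (intro mult_left_mono) simp_all
  qed
  finally have 1: "measure lborel (\<Union>p\<in>T. ball p (e / 2)) \<le> ?\<omega> * (real ?n * (2 * r) ^ (?n - 1) * e)" .
  have "measure lborel (\<Union>p\<in>T. ball p (e / 2)) = (\<Sum>p\<in>T. measure lborel (ball p (e / 2)))"
  proof (rule measure_finite_Union)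
    show "disjoint_family_on (\<lambda>p. ball p (e / 2)) T"
      unfolding disjoint_family_on_def
    proof (intro ballI impI)
      fix p q assume "p \<in> T" "q \<in> T" "p \<noteq> q"
      then have "e \<le> dist p q"
        by (rule T(3))
      then show "ball p (e / 2) \<inter> ball q (e / 2) = {}"
        by (intro disjoint_ballI) simp
    qed
    show "emeasure lborel (ball p (e / 2)) \<noteq> \<infinity>" for p :: 'a
      using emeasure_bounded_finite[OF bounded_ball[of p "e / 2"]] by simp
  qed (use T in auto)
  also have "\<dots> = real (card T) * (?\<omega> * (e / 2) ^ ?n)"
    using e by (simp add: measure_def emeasure_ball)
  finally have "real (card T) * (?\<omega> * (e / 2) ^ ?n) \<le> ?\<omega> * (real ?n * (2 * r) ^ (?n - 1) * e)"
    using 1 by simp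
  moreover have "(e / 2) ^ ?n = e * e ^ (?n - 1) / 2 ^ ?n"
    by (simp add: power_divide power_minus_mult flip: power_Suc)
  ultimately have "real (card T) * (?\<omega> * (e * e ^ (?n - 1) / 2 ^ ?n)) \<le> ?\<omega> * (real ?n * (2 * r) ^ (?n - 1) * e)"
    by (simp only:)
  moreover have "c * Y \<le> P * m * X"
    if "c * (w * (e * Y / P)) \<le> w * (m * X * e)" "0 < w" "0 < P" for c Y P m X w :: real
  proof -
    have "c * Y * (w * e) \<le> P * m * X * (w * e)"
      using that by (simp add: field_simps)
    then show ?thesis
      using that e by (simp add: mult_le_cancel_right_pos)
  qed
  ultimately show ?thesis
    by simp
qed

text \<open>The packing bound allows choosing a separated set of largest cardinality. A point of the
  sphere farther than \<open>e\<close> from it could be added, so none exists.\<close>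

lemma separated_net_exists:
  fixes x :: "'a::euclidean_space"
  assumes "0 < e" "e \<le> r"
  obtains T where "finite T" "T \<subseteq> sphere x r" "sphere x r \<subseteq> (\<Union>p\<in>T. cball p e)"
    "real (card T) * e ^ (DIM('a) - 1) \<le> 2 ^ DIM('a) * real DIM('a) * (2 * r) ^ (DIM('a) - 1)"
proof -
  let ?C = "2 ^ DIM('a) * real DIM('a) * (2 * r) ^ (DIM('a) - 1)"
  define P where "P T \<longleftrightarrow> finite T \<and> T \<subseteq> sphere x r \<and> (\<forall>p\<in>T. \<forall>q\<in>T. p \<noteq> q \<longrightarrow> e \<le> dist p q)" for T
  have bound: "real (card T) * e ^ (DIM('a) - 1) \<le> ?C" if "P T" for T
    using that assms unfolding P_def by (intro separated_card_le) auto
  have "card T < Suc (nat \<lceil>?C / e ^ (DIM('a) - 1)\<rceil>)" if "P T" for T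
  proof -
    have "real (card T) \<le> ?C / e ^ (DIM('a) - 1)"
      using bound[OF that] assms by (simp add: pos_le_divide_eq)
    then show ?thesis
      by linarith
  qed
  moreover have "P {}"
    by (simp add: P_def)
  ultimately obtain T where T: "P T" "\<And>T'. P T' \<Longrightarrow> card T' \<le> card T"
    using Lattices_Big.ex_has_greatest_nat[of P "{}" card "Suc (nat \<lceil>?C / e ^ (DIM('a) - 1)\<rceil>)"] by blast
  show ?thesis
  proof (rule that)
    show "finite T" "T \<subseteq> sphere x r"
      using T(1) by (auto simp: P_def)
    show "sphere x r \<subseteq> (\<Union>p\<in>T. cball p e)"
    proof (rule ccontr)
      assume "\<not> ?thesis"
      then obtain z where z: "z \<in> sphere x r" "\<And>p. p \<in> T \<Longrightarrow> e < dist p z"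
        by (force simp: mem_cball)
      then have "z \<notin> T"
        using assms by force
      have "P (insert z T)"
        using T(1) z by (force simp: P_def dist_commute)
      then show False
        using T(2)[of "insert z T"] \<open>z \<notin> T\<close> T(1) by (simp add: P_def)
    qed
    show "real (card T) * e ^ (DIM('a) - 1) \<le> ?C"
      by (rule bound[OF T(1)])
  qed
qed

text \<open>A net of mesh \<open>e\<close> has at most a constant times \<open>e\<close> to the
  power 1 - n many points, and each ball around them costs a constant times the inverse power. The
  total does not depend on \<delta>.\<close>

lemma hausdorff_outer_sphere_finite:
  fixes x :: "'a::euclidean_space"
  assumes "0 < r"
  shows "hausdorff_outer (DIM('a) - 1) (sphere x r) < \<infinity>"
proof -
  let ?k = "DIM('a) - 1"
  let ?C = "unit_ball_vol (real ?k) * (2 ^ DIM('a) * real DIM('a) * (2 * r) ^ ?k)"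
  have "hausdorff_outer ?k (sphere x r) \<le> ennreal ?C"
  proof (rule hausdorff_outer_least)
    fix \<delta> :: real assume \<delta>: "0 < \<delta>"
    define e where "e = min (\<delta> / 2) r"
    have e: "0 < e" "e \<le> r" "2 * e \<le> \<delta>"
      using \<delta> assms by (auto simp: e_def)
    obtain T where T: "finite T" "T \<subseteq> sphere x r" "sphere x r \<subseteq> (\<Union>p\<in>T. cball p e)"
      "real (card T) * e ^ ?k \<le> 2 ^ DIM('a) * real DIM('a) * (2 * r) ^ ?k"
      using separated_net_exists[OF e(1,2)] by blast
    obtain h where h: "bij_betw h {0..<card T} T"
      using ex_bij_betw_nat_finite[OF T(1)] by blast
    \<comment> \<open>Covers are sequences; the net is continued by empty sets, whose gauge is 0
      also for exponent 0.\<close>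
    define S where "S i = (if i < card T then cball (h i) e else {})" for i
    have diam: "diameter (cball p e) \<le> 2 * e" for p :: 'a
      using e(1) by simp
    have "hausdorff_cover \<delta> (sphere x r) S"
      unfolding hausdorff_cover_def
    proof (intro conjI allI subsetI)
      fix z assume "z \<in> sphere x r"
      then obtain p where "p \<in> T" "z \<in> cball p e"
        using T(3) by blast
      moreover have "p \<in> h ` {0..<card T}"
        using \<open>p \<in> T\<close> bij_betw_imp_surj_on[OF h] by simp
      ultimately obtain i where "i < card T" "z \<in> cball (h i) e"
        by auto
      then show "z \<in> (\<Union>i. S i)"
        unfolding S_def by auto
    qed (use e \<delta> diam in \<open>auto simp: S_def\<close>)
    then have "hausdorff_content ?k \<delta> (sphere x r) \<le> (\<Sum>i. hausdorff_gauge ?k (S i))"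
      by (rule hausdorff_content_le)
    also have "\<dots> = (\<Sum>i<card T. hausdorff_gauge ?k (S i))"
      by (rule suminf_finite) (auto simp: S_def hausdorff_gauge_def)
    also have "\<dots> \<le> (\<Sum>i<card T. ennreal (unit_ball_vol (real ?k) * e ^ ?k))"
    proof (rule sum_mono)
      fix i assume "i \<in> {..<card T}"
      then show "hausdorff_gauge ?k (S i) \<le> ennreal (unit_ball_vol (real ?k) * e ^ ?k)"
        using e by (auto simp: S_def hausdorff_gauge_def intro!: ennreal_leI mult_left_mono)
    qed
    also have "\<dots> = ennreal (\<Sum>i<card T. unit_ball_vol (real ?k) * e ^ ?k)"
      using e by (intro sum_ennreal) auto
    also have "(\<Sum>i<card T. unit_ball_vol (real ?k) * e ^ ?k) = unit_ball_vol (real ?k) * (real (card T) * e ^ ?k)"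
      by simp
    also have "ennreal \<dots> \<le> ennreal ?C"
      by (intro ennreal_leI mult_left_mono T(4)) simp
    finally show "hausdorff_content ?k \<delta> (sphere x r) \<le> ennreal ?C" .
  qed
  also have "\<dots> < \<infinity>"
    by simp
  finally show ?thesis .
qed

text \<open>Positivity by projecting along a basis vector \<open>i\<close>: the sphere projects onto a set containing a
  cube. In order to stay within Lebesgue measure on the whole space the projections are thickened by
  the unit interval in direction \<open>i\<close>.\<close>

definition slab :: "'a::euclidean_space \<Rightarrow> 'a \<Rightarrow> real \<Rightarrow> 'a set" where
  "slab i p d = cbox (\<Sum>b\<in>Basis. (if b = i then 0 else p \<bullet> b - d) *\<^sub>R b)
                     (\<Sum>b\<in>Basis. (if b = i then 1 else p \<bullet> b + d) *\<^sub>R b)"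

lemma mem_slab:
  "y \<in> slab i p d \<longleftrightarrow> (\<forall>b\<in>Basis. if b = i then 0 \<le> y \<bullet> b \<and> y \<bullet> b \<le> 1 else \<bar>y \<bullet> b - p \<bullet> b\<bar> \<le> d)"
  unfolding slab_def mem_box by (intro ball_cong refl) (auto simp: abs_le_iff algebra_simps)

lemma emeasure_slab:
  fixes i :: "'a::euclidean_space"
  assumes "i \<in> Basis" "0 \<le> d"
  shows "emeasure lborel (slab i p d) = ennreal ((2 * d) ^ (DIM('a) - 1))"
proof -
  have "emeasure lborel (slab i p d) = ennreal (\<Prod>b\<in>Basis. (if b = i then 1 else 2 * d))"
    unfolding slab_def emeasure_lborel_cbox_eq
    using assms(2) by (auto intro!: arg_cong[where f = ennreal] prod.cong simp: inner_diff_left)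
  also have "(\<Prod>b\<in>Basis. (if b = i then 1 else 2 * d)) = (2 * d) ^ (DIM('a) - 1)"
    using assms(1) by (subst prod.remove[of _ i]) (auto simp: card_Diff_singleton)
  finally show ?thesis .
qed

text \<open>The squares of the other n - 1 coordinates sum to at most \<open>r\<^sup>2 / n\<close>,
  so the coordinate along \<open>i\<close> can be solved for.\<close>

lemma sphere_projection:
  fixes x :: "'a::euclidean_space"
  assumes i: "i \<in> Basis" and r: "0 < r" and y: "\<And>b. b \<in> Basis \<Longrightarrow> b \<noteq> i \<Longrightarrow> \<bar>y \<bullet> b - x \<bullet> b\<bar> \<le> r / real DIM('a)"
  obtains z where "z \<in> sphere x r" "\<And>b. b \<in> Basis \<Longrightarrow> b \<noteq> i \<Longrightarrow> z \<bullet> b = y \<bullet> b"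
proof -
  define q where "q = (\<Sum>b\<in>Basis - {i}. (y \<bullet> b - x \<bullet> b)\<^sup>2)"
  have "q \<le> (\<Sum>b\<in>Basis - {i}. (r / real DIM('a))\<^sup>2)"
    unfolding q_def using y r by (intro sum_mono power2_le_iff_abs_le[THEN iffD2]) auto
  also have "\<dots> \<le> (\<Sum>b\<in>(Basis :: 'a set). (r / real DIM('a))\<^sup>2)"
    by (intro sum_mono2) auto
  also have "\<dots> = r\<^sup>2 / real DIM('a)"
    by (simp add: power2_eq_square)
  also have "\<dots> \<le> r\<^sup>2"
    using DIM_positive[where 'a = 'a] by (simp add: divide_le_eq mult_le_cancel_left1 Suc_leI)
  finally have q: "q \<le> r\<^sup>2" .
  define w where "w = (\<Sum>b\<in>Basis. (if b = i then sqrt (r\<^sup>2 - q) else y \<bullet> b - x \<bullet> b) *\<^sub>R b)"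
  have w: "w \<bullet> b = (if b = i then sqrt (r\<^sup>2 - q) else y \<bullet> b - x \<bullet> b)" if "b \<in> Basis" for b
    unfolding w_def using that by simp
  have "(norm w)\<^sup>2 = (\<Sum>b\<in>Basis. (w \<bullet> b)\<^sup>2)"
    unfolding power2_norm_eq_inner by (subst euclidean_inner) (simp add: power2_eq_square)
  also have "\<dots> = (sqrt (r\<^sup>2 - q))\<^sup>2 + q"
  proof -
    have "(\<Sum>b\<in>Basis - {i}. (w \<bullet> b)\<^sup>2) = q"
      unfolding q_def using w by (intro sum.cong) auto
    then show ?thesis
      using sum.remove[OF finite_Basis i, of "\<lambda>b. (w \<bullet> b)\<^sup>2"] w[OF i] by simp
  qed
  also have "\<dots> = r\<^sup>2"
    using q by simp
  finally have "norm w = r"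
    using r by (simp add: power2_eq_iff_nonneg)
  then show ?thesis
    using that[of "x + w"] w by (simp add: dist_norm inner_add_left)
qed

lemma hausdorff_outer_sphere_positive:
  fixes x :: "'a::euclidean_space"
  assumes "0 < r"
  shows "0 < hausdorff_outer (DIM('a) - 1) (sphere x r)"
proof (rule ccontr)
  let ?k = "DIM('a) - 1"
  let ?\<omega> = "unit_ball_vol (real ?k)"
  \<comment> \<open>The ratio between the volume of a slab of side \<open>2 * diameter (S j)\<close>
    and the gauge of \<open>S j\<close>, as twice the diameter is four times its half.\<close>
  let ?K = "4 ^ ?k / ?\<omega>"
  assume "\<not> ?thesis"
  then have "hausdorff_content ?k 1 (sphere x r) = 0"
    using hausdorff_content_le_outer[of 1 ?k "sphere x r"] by (simp add: not_gr_zero)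
  obtain i :: 'a where i: "i \<in> Basis"
    using nonempty_Basis by blast
  let ?E = "slab i x (r / real DIM('a))"
  define m where "m = (2 * (r / real DIM('a))) ^ ?k"
  have m: "emeasure lborel ?E = ennreal m" "0 < m"
    unfolding m_def using assms by (intro emeasure_slab[OF i], simp, simp)
  \<comment> \<open>A cover of gauge at most \<open>e\<close> would give slabs of total volume at
    most \<open>m / 2\<close>, too little for a set of volume \<open>m\<close>.\<close>
  define e where "e = m / (2 * ?K)"
  have K: "0 < ?K" and e: "0 < e"
    using m(2) by (auto simp: e_def intro!: divide_pos_pos mult_pos_pos)
  obtain S where S: "hausdorff_cover 1 (sphere x r) S" "(\<Sum>j. hausdorff_gauge ?k (S j)) \<le> ennreal e"
    using hausdorff_content_close[of ?k 1 "sphere x r" e] e \<open>hausdorff_content ?k 1 (sphere x r) = 0\<close> by auto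
  \<comment> \<open>The projection of \<open>S j\<close> lies in the cube of side twice the diameter
    centred at any of its points.\<close>
  define B where "B j = (if S j = {} then {} else slab i (SOME p. p \<in> S j) (diameter (S j)))" for j
  have "?E \<subseteq> (\<Union>j. B j)"
  proof
    fix y assume y: "y \<in> ?E"
    then obtain z where z: "z \<in> sphere x r" "\<And>b. b \<in> Basis \<Longrightarrow> b \<noteq> i \<Longrightarrow> z \<bullet> b = y \<bullet> b"
      using sphere_projection[OF i assms, of y x] unfolding mem_slab by metis
    then obtain j where j: "z \<in> S j"
      using S(1) unfolding hausdorff_cover_def by blast
    let ?p = "SOME p. p \<in> S j"
    have p: "?p \<in> S j"
      using j by (rule someI)
    have "\<bar>y \<bullet> b - ?p \<bullet> b\<bar> \<le> diameter (S j)" if "b \<in> Basis" "b \<noteq> i" for b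
    proof -
      have "\<bar>y \<bullet> b - ?p \<bullet> b\<bar> = \<bar>(z - ?p) \<bullet> b\<bar>"
        using z(2)[OF that] by (simp add: inner_diff_left)
      also have "\<dots> \<le> dist z ?p"
        unfolding dist_norm by (rule Basis_le_norm[OF that(1)])
      also have "\<dots> \<le> diameter (S j)"
        using S(1) j p by (intro diameter_bounded_bound) (auto simp: hausdorff_cover_def)
      finally show ?thesis .
    qed
    then have "y \<in> slab i ?p (diameter (S j))"
      using y i unfolding mem_slab by auto
    then show "y \<in> (\<Union>j. B j)"
      using j by (auto simp: B_def)
  qed
  then have "emeasure lborel ?E \<le> emeasure lborel (\<Union>j. B j)"
    by (intro emeasure_mono) (auto simp: B_def slab_def)
  also have "\<dots> \<le> (\<Sum>j. emeasure lborel (B j))"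
    by (intro emeasure_subadditive_countably) (auto simp: B_def slab_def)
  also have "\<dots> \<le> (\<Sum>j. ennreal ?K * hausdorff_gauge ?k (S j))"
  proof (rule suminf_le)
    fix j
    show "emeasure lborel (B j) \<le> ennreal ?K * hausdorff_gauge ?k (S j)"
    proof (cases "S j = {}")
      case False
      have d: "0 \<le> diameter (S j)"
        using S(1) by (intro diameter_ge_0) (auto simp: hausdorff_cover_def)
      have "emeasure lborel (B j) = ennreal ((2 * diameter (S j)) ^ ?k)"
        using False i d by (simp add: B_def emeasure_slab)
      also have "(2 * diameter (S j)) ^ ?k = ?K * (?\<omega> * (diameter (S j) / 2) ^ ?k)"
      proof -
        have "(2 * diameter (S j)) ^ ?k = (4 * (diameter (S j) / 2)) ^ ?k"
          by simp
        also have "\<dots> = 4 ^ ?k * (diameter (S j) / 2) ^ ?k"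
          by (rule power_mult_distrib)
        finally show ?thesis
          by (simp add: less_imp_neq[symmetric] unit_ball_vol_pos)
      qed
      also have "ennreal \<dots> = ennreal ?K * ennreal (?\<omega> * (diameter (S j) / 2) ^ ?k)"
        using K d by (intro ennreal_mult) auto
      also have "ennreal (?\<omega> * (diameter (S j) / 2) ^ ?k) = hausdorff_gauge ?k (S j)"
        using False by (simp add: hausdorff_gauge_def)
      finally show ?thesis
        by simp
    qed (simp add: B_def)
  qed auto
  also have "\<dots> = ennreal ?K * (\<Sum>j. hausdorff_gauge ?k (S j))"
    by simp
  also have "\<dots> \<le> ennreal ?K * ennreal e"
    by (intro mult_left_mono S(2)) simp
  also have "\<dots> = ennreal (?K * e)"
    using K e by (intro ennreal_mult[symmetric]) auto
  also have "?K * e = m / 2"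
  proof -
    have "c * (m / (2 * c)) = m / 2" if "0 < c" for c :: real
      using that by simp
    from this[OF K] show ?thesis
      unfolding e_def .
  qed
  finally show False
    using m by (simp add: ennreal_le_iff)
qed

section \<open>Caps, and the pointwise bound from a small average\<close>

lemma hausdorff_outer_finite_Un_le:
  "finite I \<Longrightarrow> hausdorff_outer k (\<Union>i\<in>I. A i) \<le> (\<Sum>i\<in>I. hausdorff_outer k (A i))"
proof (induction I rule: finite_induct)
  case (insert i I)
  then show ?case
    using hausdorff_outer_Un_le[of k "A i" "\<Union>i\<in>I. A i"] by (auto intro: order_trans add_left_mono)
qed (simp add: hausdorff_outer_empty)

text \<open>The sphere is covered by boundedly many caps, and all caps of the same size are congruent.\<close>

lemma hausdorff_outer_sphere_le_cap:
  assumes "0 < \<delta>"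
  obtains N :: nat where "0 < N" "\<And>(x :: real ^ 'n) r z. 0 < r \<Longrightarrow> z \<in> sphere x r \<Longrightarrow>
    hausdorff_outer k (sphere x r) \<le> of_nat N * hausdorff_outer k (sphere x r \<inter> cball z (\<delta> * r))"
proof -
  \<comment> \<open>The caps are chosen on the unit sphere and scaled afterwards, so their number
    depends neither on \<open>x\<close> nor on \<open>r\<close>.\<close>
  have cover: "sphere (0 :: real ^ 'n) 1 \<subseteq> (\<Union>\<zeta>\<in>sphere 0 1. ball \<zeta> \<delta>)"
    using assms by force
  obtain T where T: "T \<subseteq> sphere (0 :: real ^ 'n) 1" "finite T" "sphere 0 1 \<subseteq> (\<Union>\<zeta>\<in>T. ball \<zeta> \<delta>)"
    using compactE_image[OF compact_sphere open_ball cover] by blast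
  \<comment> \<open>\<open>Suc\<close> makes the constant positive.\<close>
  have "hausdorff_outer k (sphere x r) \<le> of_nat (Suc (card T)) * hausdorff_outer k (sphere x r \<inter> cball z (\<delta> * r))"
    if r: "0 < r" and z: "z \<in> sphere x r" for x z :: "real ^ 'n" and r
  proof -
    let ?cap = "\<lambda>z. sphere x r \<inter> cball z (\<delta> * r)"
    have "sphere x r \<subseteq> (\<Union>\<zeta>\<in>T. ?cap (x + r *\<^sub>R \<zeta>))"
    proof
      fix y assume y: "y \<in> sphere x r"
      then have "(1 / r) *\<^sub>R (y - x) \<in> sphere 0 1"
        using r by (simp add: dist_norm norm_minus_commute)
      then obtain \<zeta> where \<zeta>: "\<zeta> \<in> T" "(1 / r) *\<^sub>R (y - x) \<in> ball \<zeta> \<delta>"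
        using T(3) by blast
      have "dist (x + r *\<^sub>R \<zeta>) y = norm (r *\<^sub>R (\<zeta> - (1 / r) *\<^sub>R (y - x)))"
        using r by (simp add: dist_norm algebra_simps)
      also have "\<dots> \<le> \<delta> * r"
        using r \<zeta>(2) by (simp add: dist_norm mult.commute[of r])
      finally show "y \<in> (\<Union>\<zeta>\<in>T. ?cap (x + r *\<^sub>R \<zeta>))"
        using y \<zeta>(1) by auto
    qed
    then have "hausdorff_outer k (sphere x r) \<le> hausdorff_outer k (\<Union>\<zeta>\<in>T. ?cap (x + r *\<^sub>R \<zeta>))"
      by (rule hausdorff_outer_mono)
    also have "\<dots> \<le> (\<Sum>\<zeta>\<in>T. hausdorff_outer k (?cap (x + r *\<^sub>R \<zeta>)))"
      by (rule hausdorff_outer_finite_Un_le[OF T(2)])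
    also have "\<dots> \<le> (\<Sum>\<zeta>\<in>T. hausdorff_outer k (?cap z))"
    proof (rule sum_mono)
      fix \<zeta> assume "\<zeta> \<in> T"
      then have "norm (z - x) = norm (r *\<^sub>R \<zeta>)"
        using T(1) r z by (auto simp: dist_norm norm_minus_commute)
      then obtain f where f: "orthogonal_transformation f" "f (z - x) = r *\<^sub>R \<zeta>"
        by (rule orthogonal_transformation_exists)
      \<comment> \<open>An isometry fixing \<open>x\<close> that carries the cap at \<open>z\<close>
        onto the cap at \<open>x + r *\<^sub>R \<zeta>\<close>.\<close>
      define h where "h y = x + f (y - x)" for y
      have iso: "dist (h y) (h y') = dist y y'" for y y'
        using f(1) by (simp add: h_def orthogonal_transformation_isometry dist_norm[of "y - x"] dist_norm[of y])
      have "?cap (x + r *\<^sub>R \<zeta>) \<subseteq> h ` ?cap z"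
      proof
        fix y assume y: "y \<in> ?cap (x + r *\<^sub>R \<zeta>)"
        obtain w where w: "y - x = f w"
          using orthogonal_transformation_surj[OF f(1)] by (metis surjE)
        have hy: "h (x + w) = y"
          using w by (simp add: h_def algebra_simps)
        have "h x = x"
          using f(1) by (simp add: h_def orthogonal_transformation_linear linear_0)
        moreover have "h z = x + r *\<^sub>R \<zeta>"
          by (simp add: h_def f(2))
        ultimately have "x + w \<in> ?cap z"
          using y iso[of x "x + w"] iso[of z "x + w"] hy by simp
        then show "y \<in> h ` ?cap z"
          using hy by blast
      qed
      then have "hausdorff_outer k (?cap (x + r *\<^sub>R \<zeta>)) \<le> hausdorff_outer k (h ` ?cap z)"
        by (rule hausdorff_outer_mono)
      also have "\<dots> \<le> hausdorff_outer k (?cap z)"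
        by (rule hausdorff_outer_image_le) (simp add: iso)
      finally show "hausdorff_outer k (?cap (x + r *\<^sub>R \<zeta>)) \<le> hausdorff_outer k (?cap z)" .
    qed
    also have "\<dots> = of_nat (card T) * hausdorff_outer k (?cap z)"
      by simp
    also have "\<dots> \<le> of_nat (Suc (card T)) * hausdorff_outer k (?cap z)"
      by (intro mult_right_mono) auto
    finally show ?thesis .
  qed
  then show ?thesis
    using that[of "Suc (card T)"] by blast
qed

text \<open>If \<open>u z\<close> exceeds \<epsilon> r, then \<open>u\<close> is at least half of
  that on the cap of radius \<epsilon> r / (2 L) around \<open>z\<close>. The cap carries at least
  the fraction \<open>1 / N\<close> of the sphere, so the average is at least \<epsilon> r / (2 N),
  twice what \<eta> admits.\<close>

lemma sphere_average_small_imp_le: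
  assumes "0 < \<epsilon>" "0 < L"
  obtains \<eta> where "0 < \<eta>" "\<And>(x :: real ^ 'n) r u z. 0 < r \<Longrightarrow> L-lipschitz_on (cball x r) u \<Longrightarrow>
    sphere_average x r (\<lambda>y. max (u y) 0) \<le> r * \<eta> \<Longrightarrow> z \<in> sphere x r \<Longrightarrow> u z \<le> \<epsilon> * r"
proof -
  let ?k = "CARD('n) - 1"
  define \<delta> where "\<delta> = \<epsilon> / (2 * L)"
  have "0 < \<delta>"
    using assms by (simp add: \<delta>_def)
  then obtain N :: nat where N: "0 < N" "\<And>(x :: real ^ 'n) r z. 0 < r \<Longrightarrow> z \<in> sphere x r \<Longrightarrow>
    hausdorff_outer ?k (sphere x r) \<le> of_nat N * hausdorff_outer ?k (sphere x r \<inter> cball z (\<delta> * r))"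
    using hausdorff_outer_sphere_le_cap by blast
  show ?thesis
  proof (rule that)
    show "0 < \<epsilon> / (4 * real N)"
      using assms N(1) by simp
    fix x :: "real ^ 'n" and r u z
    assume r: "0 < r" and lip: "L-lipschitz_on (cball x r) u" and z: "z \<in> sphere x r"
      and avg: "sphere_average x r (\<lambda>y. max (u y) 0) \<le> r * (\<epsilon> / (4 * real N))"
    let ?H = "hausdorff_measure ?k :: (real ^ 'n) measure"
    let ?S = "sphere x r" and ?C = "sphere x r \<inter> cball z (\<delta> * r)"
    show "u z \<le> \<epsilon> * r"
    proof (rule ccontr)
      assume "\<not> u z \<le> \<epsilon> * r"
      then have uz: "\<epsilon> * r < u z"
        by simp
      have S: "emeasure ?H ?S = hausdorff_outer ?k ?S" "emeasure ?H ?C = hausdorff_outer ?k ?C"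
        by (auto intro!: emeasure_hausdorff_measure)
      have fin: "emeasure ?H ?S < \<infinity>"
        unfolding S using hausdorff_outer_sphere_finite[OF r, of x] by simp
      have fin': "emeasure ?H ?C < \<infinity>"
        using emeasure_mono[of ?C ?S ?H] fin by (auto intro: le_less_trans)
      \<comment> \<open>Both bounds on the sphere enter: infinite measure would be reported as 0,
        and the average would be a division by 0.\<close>
      have pos: "0 < measure ?H ?S"
      proof -
        have "0 < emeasure ?H ?S"
          unfolding S using hausdorff_outer_sphere_positive[OF r, of x] by simp
        then show ?thesis
          using fin by (simp add: measure_def enn2real_positive_iff)
      qed
      have "emeasure ?H ?S \<le> of_nat N * emeasure ?H ?C"
        unfolding S by (rule N(2)[OF r z])
      then have ratio: "measure ?H ?S \<le> real N * measure ?H ?C"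
        using fin fin' enn2real_mono[of "emeasure ?H ?S" "of_nat N * emeasure ?H ?C"]
        by (simp add: measure_def enn2real_mult ennreal_mult_less_top of_nat_less_top)
      have cont: "continuous_on ?S u"
        using lipschitz_on_continuous_on[OF lip] continuous_on_subset sphere_cball by blast
      define f where "f y = indicator ?S y *\<^sub>R max (u y) 0" for y
      have "f \<in> borel_measurable borel"
        unfolding f_def by (intro borel_measurable_continuous_on_indicator continuous_intros cont) auto
      then have f_meas: "f \<in> borel_measurable ?H"
        by (simp cong: measurable_cong_sets)
      obtain B where B: "\<forall>y\<in>?S. norm (u y) \<le> B"
        using compact_imp_bounded[OF compact_continuous_image[OF cont compact_sphere]]
        unfolding bounded_iff by auto
      have f_int: "integrable ?H f"
      proof (rule Bochner_Integration.integrable_bound[where f = "\<lambda>y. max B 0 * indicator ?S y"])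
        show "integrable ?H (\<lambda>y. max B 0 * indicator ?S y)"
          using fin by (intro integrable_mult_right integrable_real_indicator) auto
        show "AE y in ?H. norm (f y) \<le> norm (max B 0 * indicator ?S y)"
        proof (rule AE_I2)
          fix y
          show "norm (f y) \<le> norm (max B 0 * indicator ?S y)"
          proof (cases "y \<in> ?S")
            case True
            then have "\<bar>u y\<bar> \<le> B"
              using B by auto
            then have "0 \<le> B" "u y \<le> B"
              by linarith+
            then show ?thesis
              using True by (simp add: f_def)
          qed (simp add: f_def)
        qed
      qed (rule f_meas)
      have "(\<integral>y. (\<epsilon> * r / 2) * indicator ?C y \<partial>?H) \<le> (\<integral>y. f y \<partial>?H)"
      proof (rule integral_mono)
        show "integrable ?H (\<lambda>y. (\<epsilon> * r / 2) * indicator ?C y)"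
          using fin' by (intro integrable_mult_right integrable_real_indicator) auto
        fix y
        show "(\<epsilon> * r / 2) * indicator ?C y \<le> f y"
        proof (cases "y \<in> ?C")
          case True
          then have "y \<in> cball x r" "z \<in> cball x r"
            using z by auto
          then have "\<bar>u z - u y\<bar> \<le> L * dist z y"
            using lipschitz_onD[OF lip, of z y] by (simp add: dist_real_def)
          also have "\<dots> \<le> L * (\<delta> * r)"
            using True assms by (intro mult_left_mono) auto
          also have "\<dots> = \<epsilon> * r / 2"
            using assms by (simp add: \<delta>_def)
          finally have "\<epsilon> * r / 2 \<le> u y"
            using uz by linarith
          then show ?thesis
            using True by (simp add: f_def)
        next
          case False
          then have "indicator ?C y = (0 :: real)"
            by (rule indicator_simps(2))
          then show ?thesis
            by (simp only: f_def) simp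
        qed
      qed (rule f_int)
      then have "(\<epsilon> * r / 2) * measure ?H ?C \<le> (\<integral>y. f y \<partial>?H)"
        by simp
      also have "\<dots> = sphere_average x r (\<lambda>y. max (u y) 0) * measure ?H ?S"
        using pos by (simp add: sphere_average_def set_lebesgue_integral_def f_def)
      also have "\<dots> \<le> r * (\<epsilon> / (4 * real N)) * measure ?H ?S"
        using pos avg by (intro mult_right_mono) auto
      also have "\<dots> \<le> r * (\<epsilon> / (4 * real N)) * (real N * measure ?H ?C)"
        using ratio r assms by (intro mult_left_mono) auto
      also have "\<dots> = (\<epsilon> * r / 4) * measure ?H ?C"
        using N(1) by simp
      finally have "(\<epsilon> * r / 4) * measure ?H ?C \<le> 0"
        by (simp add: algebra_simps)
      moreover have "0 < measure ?H ?C"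
        using pos ratio N(1) by (auto simp: zero_less_mult_iff dest: less_le_trans)
      ultimately show False
        using assms r by (simp add: mult_le_0_iff)
    qed
  qed
qed

section \<open>Improvement on smaller balls\<close>

lemma lmeasurable_pos_set:
  fixes u :: "'a::euclidean_space \<Rightarrow> real"
  assumes "continuous_on (ball y t) u"
  shows "{z \<in> ball y t. u z > 0} \<in> lmeasurable"
proof -
  have "{z \<in> ball y t. u z > 0} = ball y t \<inter> u -` {0<..}"
    by auto
  also have "open \<dots>"
    using assms by (intro continuous_open_preimage) auto
  finally have "open {z \<in> ball y t. u z > 0}" .
  moreover have "bounded {z \<in> ball y t. u z > 0}"
    by (rule bounded_subset[OF bounded_ball]) auto
  ultimately show ?thesis
    by (intro lmeasurable_open)
qed

text \<open>Starting from \<open>a\<close> or more, a function with Lipschitz constant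
  \<open>L\<close> cannot reach 0 within distance \<open>a / L\<close>.\<close>

lemma pos_set_measure_ge:
  fixes u :: "'a::euclidean_space \<Rightarrow> real"
  assumes "L-lipschitz_on (ball y t) u" "0 < L" "0 < a" "a \<le> u z" "ball z (a / L) \<subseteq> ball y t"
  shows "unit_ball_vol (real DIM('a)) * (a / L) ^ DIM('a) \<le> measure lebesgue {w \<in> ball y t. u w > 0}"
proof -
  have "ball z (a / L) \<subseteq> {w \<in> ball y t. u w > 0}"
  proof
    fix w assume w: "w \<in> ball z (a / L)"
    have "z \<in> ball z (a / L)"
      using assms by simp
    then have "z \<in> ball y t" "w \<in> ball y t"
      using w assms(5) by blast+
    then have "\<bar>u z - u w\<bar> \<le> L * dist z w"
      using lipschitz_onD[OF assms(1), of z w] by (simp add: dist_real_def)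
    also have "\<dots> < a"
      using w assms(2) by (simp add: mem_ball pos_less_divide_eq mult.commute)
    finally show "w \<in> {w \<in> ball y t. u w > 0}"
      using w assms(4,5) by auto
  qed
  then have "measure lebesgue (ball z (a / L)) \<le> measure lebesgue {w \<in> ball y t. u w > 0}"
    using lmeasurable_pos_set[OF lipschitz_on_continuous_on[OF assms(1)]]
    by (intro measure_mono_fmeasurable) auto
  then show ?thesis
    using assms(2,3) by (simp add: measure_def emeasure_ball)
qed

text \<open>Separates the iteration from the variational problem, of which only \<open>decay\<close>
  is left: \<open>h\<close> is the gap between the radii and \<beta> the error per step, relative to
  the volume of the ball. The cap on \<open>2 * m / h\<close> bounds the barrier slope, so that one
  \<beta> serves every comparison; \<open>8 * real n\<close> is the slope for \<open>n\<close> steps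
  across a quarter of the radius when \<epsilon> is 1.\<close>

locale positivity_decay =
  fixes x :: "'a::euclidean_space" and r L \<rho> \<beta> \<omega> :: real and n :: nat and u :: "'a \<Rightarrow> real"
  assumes n_eq: "n = DIM('a)" and \<omega>_eq: "\<omega> = unit_ball_vol (real DIM('a))"
    and L: "1 \<le> L" and \<rho>: "0 < \<rho>" and \<beta>: "0 \<le> \<beta>"
    and lip: "L-lipschitz_on (cball x r) u"
    and decay: "\<And>y s t m h. \<lbrakk>0 < s; 0 < h; s + h \<le> t; cball y t \<subseteq> cball x r; 0 \<le> m;
        \<And>z. z \<in> sphere y t \<Longrightarrow> u z \<le> m; 2 * m / h \<le> 8 * real n\<rbrakk> \<Longrightarrow>
      measure lebesgue {z \<in> ball y s. u z > 0}
        \<le> (2 * m / h / \<rho>)\<^sup>2 * measure lebesgue {z \<in> ball y t. u z > 0}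
          + \<beta> * (\<omega> * t ^ n)"
begin

abbreviation P :: "'a \<Rightarrow> real \<Rightarrow> real" where "P y t \<equiv> measure lebesgue {z \<in> ball y t. u z > 0}"

lemma n_ge: "1 \<le> n" "1 \<le> real n"
  using DIM_positive[where 'a = 'a] by (simp_all add: n_eq Suc_leI)

lemma \<omega>_pos: "0 < \<omega>"
  by (simp add: \<omega>_eq)

lemma lip_ball: "cball y t \<subseteq> cball x r \<Longrightarrow> L-lipschitz_on (ball y t) u"
  using lipschitz_on_subset[OF lip] ball_subset_cball by blast

lemma P_le:
  assumes "cball y t \<subseteq> cball x r" "0 \<le> t"
  shows "P y t \<le> \<omega> * t ^ n"
proof -
  have "P y t \<le> measure lebesgue (ball y t)"
    using lmeasurable_pos_set[OF lipschitz_on_continuous_on[OF lip_ball[OF assms(1)]]]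
    by (intro measure_mono_fmeasurable) auto
  then show ?thesis
    using assms(2) by (simp add: measure_def emeasure_ball n_eq \<omega>_eq)
qed

lemma le_if_pos_set_small:
  assumes y: "cball y t \<subseteq> cball x r" and R: "0 < R" and \<epsilon>: "0 < \<epsilon>" "\<epsilon> \<le> 1"
    and small: "P y t \<le> c * (\<omega> * R ^ n)" "c < (\<epsilon> / (4 * L)) ^ n"
    and z: "dist y z + R / 4 \<le> t"
  shows "u z \<le> \<epsilon> * R / 4"
proof (rule ccontr)
  assume "\<not> u z \<le> \<epsilon> * R / 4"
  then have a: "\<epsilon> * R / 4 \<le> u z"
    by simp
  \<comment> \<open>From \<epsilon> <= 1 <= \<open>L\<close>: the ball forced into the positivity
    set stays inside \<open>ball y t\<close>.\<close>
  have aL: "\<epsilon> * R / 4 / L \<le> R / 4"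
  proof -
    have "\<epsilon> * R \<le> L * R"
      using \<epsilon> L R by (intro mult_right_mono) auto
    then show ?thesis
      using L by (simp add: divide_le_eq mult.commute)
  qed
  have "ball z (\<epsilon> * R / 4 / L) \<subseteq> ball y t"
  proof
    fix w assume "w \<in> ball z (\<epsilon> * R / 4 / L)"
    then show "w \<in> ball y t"
      using dist_triangle[of y w z] z aL unfolding mem_ball by linarith
  qed
  from pos_set_measure_ge[OF lip_ball[OF y] _ _ a this]
  have "\<omega> * (\<epsilon> * R / 4 / L) ^ n \<le> P y t"
    using \<epsilon> R L by (simp add: n_eq \<omega>_eq)
  also have "\<dots> \<le> c * (\<omega> * R ^ n)"
    by (rule small(1))
  also have "\<dots> < (\<epsilon> / (4 * L)) ^ n * (\<omega> * R ^ n)"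
    using small(2) R \<omega>_pos by (intro mult_strict_right_mono mult_pos_pos) auto
  also have "\<dots> = \<omega> * (\<epsilon> / (4 * L) * R) ^ n"
    by (simp only: power_mult_distrib mult_ac)
  also have "\<epsilon> / (4 * L) * R = \<epsilon> * R / 4 / L"
    by simp
  finally show False
    by simp
qed

text \<open>Each of the \<open>n\<close> comparisons gains a factor quadratic in \<epsilon>, which
  the hypothesis converts into the linear factor \<epsilon> / (8 L). Its n-th power is then below
  the density threshold \<open>(\<epsilon> / (4 * L)) ^ n\<close>, with room for the accumulated
  errors.\<close>

lemma halving_step:
  assumes \<epsilon>: "0 < \<epsilon>" "\<epsilon> \<le> 1" and \<theta>: "(8 * real n * \<epsilon> / \<rho>)\<^sup>2 \<le> \<epsilon> / (8 * L)"
    and \<beta>_small: "real n * \<beta> < (\<epsilon> / (4 * L)) ^ n / 2"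
    and R: "0 < R" "cball y R \<subseteq> cball x r" and u: "\<And>z. z \<in> cball y R \<Longrightarrow> u z \<le> \<epsilon> * R"
    and z: "z \<in> cball y (R / 2)"
  shows "u z \<le> \<epsilon> * (R / 2)"
proof -
  define \<theta>' where "\<theta>' = (8 * real n * \<epsilon> / \<rho>)\<^sup>2"
  \<comment> \<open>From \<open>R\<close> down to \<open>3 / 4 * R\<close> in \<open>n\<close> equal
    steps. The remaining distance \<open>R / 4\<close> to the half ball is where the ball around a
    putative bad point has to fit.\<close>
  define t where "t j = R * (1 - real j / (4 * real n))" for j :: nat
  have n: "1 \<le> real n"
    by (rule n_ge(2))
  have \<theta>'_bounds: "0 \<le> \<theta>'" "\<theta>' \<le> 1"
  proof -
    have "\<epsilon> / (8 * L) \<le> 1"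
      using \<epsilon> L by simp
    then show "0 \<le> \<theta>'" "\<theta>' \<le> 1"
      using \<theta> by (auto simp: \<theta>'_def)
  qed
  have "P y (t j) \<le> (\<theta>' ^ j + real j * \<beta>) * (\<omega> * R ^ n)" if "j \<le> n" for j
    using that
  proof (induction j)
    case 0
    then show ?case
      using P_le[OF R(2)] R(1) by (simp add: t_def)
  next
    case (Suc j)
    let ?h = "R / (4 * real n)"
    have t_Suc: "t (Suc j) + ?h = t j"
      by (simp add: t_def algebra_simps add_divide_distrib)
    have "real (Suc j) / (4 * real n) \<le> 1 / 4"
      using Suc.prems n by (simp add: divide_le_eq)
    then have "R * (3 / 4) \<le> t (Suc j)"
      unfolding t_def using R(1) by (intro mult_left_mono) auto
    then have t_pos: "0 < t (Suc j)"
      using R(1) by simp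
    have tR: "t j \<le> R"
      unfolding t_def using R(1) by (simp add: mult_left_le)
    then have sub: "cball y (t j) \<subseteq> cball y R"
      by (simp add: subset_cball)
    have h: "2 * (\<epsilon> * R) / ?h = 8 * real n * \<epsilon>"
      using R(1) n by simp
    have "P y (t (Suc j)) \<le> (2 * (\<epsilon> * R) / ?h / \<rho>)\<^sup>2 * P y (t j) + \<beta> * (\<omega> * t j ^ n)"
    proof (rule decay)
      show "0 < ?h"
        using R(1) n by simp
      show "2 * (\<epsilon> * R) / ?h \<le> 8 * real n"
        unfolding h using \<epsilon> n by (simp add: mult_left_le)
      show "u z \<le> \<epsilon> * R" if "z \<in> sphere y (t j)" for z
        using that tR by (intro u) simp
    qed (use t_pos t_Suc sub R \<epsilon> in auto)
    also have "\<dots> = \<theta>' * P y (t j) + \<beta> * (\<omega> * t j ^ n)"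
      by (simp only: h \<theta>'_def)
    also have "\<dots> \<le> \<theta>' * ((\<theta>' ^ j + real j * \<beta>) * (\<omega> * R ^ n)) + \<beta> * (\<omega> * R ^ n)"
    proof (intro add_mono mult_left_mono)
      have "0 < ?h"
        using R(1) n by simp
      then have "0 \<le> t j"
        using t_pos t_Suc by linarith
      then show "t j ^ n \<le> R ^ n"
        using tR by (intro power_mono)
      show "P y (t j) \<le> (\<theta>' ^ j + real j * \<beta>) * (\<omega> * R ^ n)"
        using Suc by simp
      show "0 \<le> \<theta>'" "0 \<le> \<omega>" "0 \<le> \<beta>"
        using \<theta>'_bounds \<omega>_pos \<beta> by simp_all
    qed
    also have "\<dots> = (\<theta>' ^ Suc j + \<theta>' * (real j * \<beta>) + \<beta>) * (\<omega> * R ^ n)"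
      by (simp add: algebra_simps)
    \<comment> \<open>As \<theta>' is at most 1, earlier errors are not amplified and add up
      linearly.\<close>
    also have "\<dots> \<le> (\<theta>' ^ Suc j + 1 * (real j * \<beta>) + \<beta>) * (\<omega> * R ^ n)"
      using \<theta>'_bounds \<beta> R(1) \<omega>_pos by (intro mult_right_mono add_mono order_refl) auto
    finally show ?case
      by (simp add: algebra_simps)
  qed
  from this[of n] have "P y (t n) \<le> (\<theta>' ^ n + real n * \<beta>) * (\<omega> * R ^ n)"
    by simp
  moreover have "t n = 3 / 4 * R"
    using n by (simp add: t_def)
  moreover have "\<theta>' ^ n + real n * \<beta> < (\<epsilon> / (4 * L)) ^ n"
  proof -
    \<comment> \<open>The spare factor 1 / 2 in \<epsilon> / (8 L) leaves at least half of the
      threshold to the errors.\<close>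
    have "\<theta>' ^ n \<le> (\<epsilon> / (4 * L) * (1 / 2)) ^ n"
      using \<theta> \<theta>'_bounds by (intro power_mono) (auto simp: \<theta>'_def)
    also have "\<dots> = (\<epsilon> / (4 * L)) ^ n * (1 / 2) ^ n"
      by (rule power_mult_distrib)
    also have "\<dots> \<le> (\<epsilon> / (4 * L)) ^ n * (1 / 2)"
    proof (rule mult_left_mono)
      show "(1 / 2 :: real) ^ n \<le> 1 / 2"
        using power_decreasing[of 1 n "1 / 2 :: real"] n_ge(1) by simp
      show "0 \<le> (\<epsilon> / (4 * L)) ^ n"
        using \<epsilon> L by simp
    qed
    finally show ?thesis
      using \<beta>_small by simp
  qed
  moreover have "cball y (3 / 4 * R) \<subseteq> cball x r"
    using subset_cball[of "3 / 4 * R" R y] R by simp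
  moreover have "dist y z + R / 4 \<le> 3 / 4 * R"
    using z by simp
  ultimately have "u z \<le> \<epsilon> * R / 4"
    using le_if_pos_set_small[OF _ R(1) \<epsilon>, of y "3 / 4 * R" "\<theta>' ^ n + real n * \<beta>" z] by simp
  also have "\<dots> \<le> \<epsilon> * (R / 2)"
    using R(1) \<epsilon> by simp
  finally show ?thesis .
qed

text \<open>A single comparison starts the scheme, because \<epsilon>' may be chosen after
  \<epsilon>, as small as the density threshold for \<epsilon> demands. Halving around
  \<open>y\<close> then squeezes \<open>u y\<close> below a null sequence.\<close>

lemma nonpos_on_quarter_ball:
  assumes \<epsilon>: "0 < \<epsilon>" "\<epsilon> \<le> 1" and \<theta>: "(8 * real n * \<epsilon> / \<rho>)\<^sup>2 \<le> \<epsilon> / (8 * L)"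
    and \<beta>_small: "real n * \<beta> < (\<epsilon> / (4 * L)) ^ n / 2"
    and \<epsilon>': "0 \<le> \<epsilon>'" "\<epsilon>' \<le> 1" "(8 * \<epsilon>' / \<rho>)\<^sup>2 \<le> (\<epsilon> / (4 * L)) ^ n / 2"
    and r: "0 < r" and sphere: "\<And>z. z \<in> sphere x r \<Longrightarrow> u z \<le> \<epsilon>' * r" and y: "y \<in> ball x (r / 4)"
  shows "u y \<le> 0"
proof -
  have n: "1 \<le> real n"
    by (rule n_ge(2))
  have h: "2 * (\<epsilon>' * r) / (r / 4) = 8 * \<epsilon>'"
    using r by simp
  have "P x (3 / 4 * r) \<le> (2 * (\<epsilon>' * r) / (r / 4) / \<rho>)\<^sup>2 * P x r + \<beta> * (\<omega> * r ^ n)"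
  proof (rule decay)
    show "2 * (\<epsilon>' * r) / (r / 4) \<le> 8 * real n"
      unfolding h using \<epsilon>' n by simp
  qed (use r \<epsilon>' sphere in auto)
  also have "\<dots> \<le> (8 * \<epsilon>' / \<rho>)\<^sup>2 * (\<omega> * r ^ n) + \<beta> * (\<omega> * r ^ n)"
    unfolding h using r \<beta> \<omega>_pos by (intro add_mono mult_left_mono P_le) auto
  also have "\<dots> = ((8 * \<epsilon>' / \<rho>)\<^sup>2 + \<beta>) * (\<omega> * r ^ n)"
    by (simp add: algebra_simps)
  finally have P_small: "P x (3 / 4 * r) \<le> ((8 * \<epsilon>' / \<rho>)\<^sup>2 + \<beta>) * (\<omega> * r ^ n)" .
  have "\<beta> \<le> real n * \<beta>"
    using n \<beta> mult_right_mono[of 1 "real n" \<beta>] by simp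
  then have c: "(8 * \<epsilon>' / \<rho>)\<^sup>2 + \<beta> < (\<epsilon> / (4 * L)) ^ n"
    using \<epsilon>'(3) \<beta>_small by linarith
  \<comment> \<open>Such \<open>z\<close> have distance at most \<open>r / 2\<close> from
    \<open>x\<close>, which leaves \<open>r / 4\<close> up to the radius \<open>3 / 4 * r\<close> of
    the small positivity set.\<close>
  have start: "u z \<le> \<epsilon> * (r / 4)" if "z \<in> cball y (r / 4)" for z
  proof -
    have "dist x z + r / 4 \<le> 3 / 4 * r"
      using that y dist_triangle[of x z y] by simp
    moreover have "cball x (3 / 4 * r) \<subseteq> cball x r"
      using r by (intro subset_cball) simp
    ultimately have "u z \<le> \<epsilon> * r / 4"
      using r \<epsilon> P_small c by (intro le_if_pos_set_small[where t = "3 / 4 * r"]) auto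
    then show ?thesis
      by simp
  qed
  have sub: "cball y (r / 4) \<subseteq> cball x r"
  proof
    fix z assume "z \<in> cball y (r / 4)"
    then show "z \<in> cball x r"
      using y dist_triangle[of x z y] r by simp
  qed
  have iter: "\<forall>z\<in>cball y (r / 4 * (1 / 2) ^ k). u z \<le> \<epsilon> * (r / 4 * (1 / 2) ^ k)" for k
  proof (induction k)
    case (Suc k)
    let ?R = "r / 4 * (1 / 2) ^ k"
    have "?R \<le> r / 4"
      using r power_le_one[of "1 / 2 :: real" k] by (simp add: mult_left_le)
    then have "cball y ?R \<subseteq> cball x r"
      using sub subset_cball[of ?R "r / 4" y] by blast
    then have "u z \<le> \<epsilon> * (?R / 2)" if "z \<in> cball y (?R / 2)" for z
      using that r Suc by (intro halving_step[OF \<epsilon> \<theta> \<beta>_small]) auto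
    then show ?case
      by simp
  qed (use start in simp)
  have "u y \<le> \<epsilon> * (r / 4 * (1 / 2) ^ k)" for k
    using iter[of k] r by simp
  moreover have "(\<lambda>k. \<epsilon> * (r / 4 * (1 / 2) ^ k)) \<longlonglongrightarrow> \<epsilon> * (r / 4 * 0)"
    by (intro tendsto_intros LIMSEQ_realpow_zero) auto
  ultimately show ?thesis
    using LIMSEQ_le_const[of "\<lambda>k. \<epsilon> * (r / 4 * (1 / 2) ^ k)" 0 "u y"] by simp
qed

end

section \<open>Almost minimizers satisfy the decay inequality; choice of the constants\<close>

lemma J_plus_eq_J_fun: "J_plus qp x r v = J_fun qp (\<lambda>_. 0) x r v"
  by (simp add: J_plus_def J_fun_def)

lemma Linf_norm_AE_le:
  assumes "Linf_norm U q = ereal M"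
  shows "AE z in lebesgue_on U. \<bar>q z\<bar> \<le> M"
  using esssup_AE[of "\<lambda>z. ereal \<bar>q z\<bar>" "lebesgue_on U"] assms by (simp add: Linf_norm_def)

lemma lebesgue_on_subset:
  assumes "open U" "open V" "V \<subseteq> U"
  shows "f \<in> borel_measurable (lebesgue_on U) \<Longrightarrow> f \<in> borel_measurable (lebesgue_on V)"
    and "(AE z in lebesgue_on U. Q z) \<Longrightarrow> AE z in lebesgue_on V. Q z"
proof -
  show "f \<in> borel_measurable (lebesgue_on V)" if "f \<in> borel_measurable (lebesgue_on U)"
    using measurable_restrict_space1[OF that, of V] assms
    by (simp add: restrict_restrict_space inf.absorb2)
  show "AE z in lebesgue_on V. Q z" if "AE z in lebesgue_on U. Q z"
    using that assms by (auto simp: AE_restrict_space_iff elim!: eventually_mono)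
qed

text \<open>Applies to almost minimizers of \<open>J\<^sup>+\<close> as well, with \<open>qm = 0\<close>.\<close>

lemma almost_minimizer_decay:
  fixes u :: "'a::euclidean_space \<Rightarrow> real"
  assumes \<Omega>: "open \<Omega>" "cball y t \<subseteq> \<Omega>" and u: "u \<in> K_loc \<Omega>" "continuous_on \<Omega> u"
    and qp: "qp \<in> borel_measurable (lebesgue_on \<Omega>)" "AE z in lebesgue_on \<Omega>. \<bar>qp z\<bar> \<le> Mp"
    and qm: "qm \<in> borel_measurable (lebesgue_on \<Omega>)" "AE z in lebesgue_on \<Omega>. \<bar>qm z\<bar> \<le> Mm"
    and min: "\<And>v. competitor u y t v \<Longrightarrow> J_fun qp qm y t u \<le> (1 + k) * J_fun qp qm y t v"
    and k: "0 \<le> k" "k * (real DIM('a) * L\<^sup>2 + Mp\<^sup>2 + Mm\<^sup>2 + E\<^sup>2) \<le> \<beta> * \<rho>\<^sup>2"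
    and lip: "L-lipschitz_on (ball y t) u" and \<rho>: "0 < \<rho>" "\<And>z. z \<in> ball y t \<Longrightarrow> \<rho> \<le> qp z"
    and s: "0 < s" "0 < h" "s + h \<le> t" and m: "0 \<le> m" "\<And>z. z \<in> sphere y t \<Longrightarrow> u z \<le> m" "2 * m / h \<le> E"
  shows "measure lebesgue {z \<in> ball y s. u z > 0}
    \<le> (2 * m / h / \<rho>)\<^sup>2 * measure lebesgue {z \<in> ball y t. u z > 0}
      + \<beta> * (unit_ball_vol (real DIM('a)) * t ^ DIM('a))"
proof -
  let ?a = "2 * m * t / (t\<^sup>2 - s\<^sup>2)"
  have t: "0 < t" "s < t"
    using s by auto
  have sub: "ball y t \<subseteq> \<Omega>"
    using \<Omega>(2) ball_subset_cball by blast
  obtain g0 where g0: "has_weak_gradient (ball y t) u g0"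
    using u(1) sub t(1) unfolding K_loc_def gradient_in_L2_def by blast
  have a: "0 \<le> ?a" "?a \<le> 2 * m / h"
  proof -
    \<comment> \<open>Factoring the difference of squares gives
      \<open>t\<^sup>2 - s\<^sup>2 \<ge> h * t\<close>; this trades the barrier slope for the
      simpler \<open>2 * m / h\<close>.\<close>
    have "h * t \<le> (t - s) * (t + s)"
      using s t by (intro mult_mono) auto
    also have "\<dots> = t\<^sup>2 - s\<^sup>2"
      by (simp add: power2_eq_square algebra_simps)
    finally have ht: "h * t \<le> t\<^sup>2 - s\<^sup>2" .
    moreover have "0 < h * t"
      using s t by simp
    ultimately have pos: "0 < t\<^sup>2 - s\<^sup>2"
      by linarith
    then show "0 \<le> ?a"
      using m t by simp
    have "?a \<le> 2 * m * t / (h * t)"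
      using ht m t \<open>0 < h * t\<close> pos by (intro divide_left_mono) auto
    then show "?a \<le> 2 * m / h"
      using t by simp
  qed
  then have a2: "?a\<^sup>2 \<le> (2 * m / h)\<^sup>2" "?a\<^sup>2 \<le> E\<^sup>2"
    using m(3) by (auto intro!: power_mono)
  have "\<rho>\<^sup>2 * measure lebesgue {z \<in> ball y s. u z > 0}
      \<le> ?a\<^sup>2 * measure lebesgue {z \<in> ball y t. u z > 0}
        + k * (real DIM('a) * L\<^sup>2 + Mp\<^sup>2 + Mm\<^sup>2 + ?a\<^sup>2) * measure lebesgue (ball y t)"
    using \<rho> lebesgue_on_subset[OF \<Omega>(1) open_ball sub] qp qm
    by (intro positivity_set_decay[OF s(1) t(2) m(1) lip continuous_on_subset[OF u(2) \<Omega>(2)] m(2) g0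
          _ _ _ _ _ _ k(1) min]) auto
  also have "\<dots> \<le> (2 * m / h)\<^sup>2 * measure lebesgue {z \<in> ball y t. u z > 0}
        + \<beta> * \<rho>\<^sup>2 * measure lebesgue (ball y t)"
  proof (intro add_mono mult_right_mono a2)
    have "k * (real DIM('a) * L\<^sup>2 + Mp\<^sup>2 + Mm\<^sup>2 + ?a\<^sup>2) \<le> k * (real DIM('a) * L\<^sup>2 + Mp\<^sup>2 + Mm\<^sup>2 + E\<^sup>2)"
      using k(1) a2(2) by (intro mult_left_mono add_left_mono)
    then show "k * (real DIM('a) * L\<^sup>2 + Mp\<^sup>2 + Mm\<^sup>2 + ?a\<^sup>2) \<le> \<beta> * \<rho>\<^sup>2"
      using k(2) by linarith
  qed auto
  also have "\<dots> = \<rho>\<^sup>2 * ((2 * m / h / \<rho>)\<^sup>2 * measure lebesgue {z \<in> ball y t. u z > 0}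
      + \<beta> * measure lebesgue (ball y t))"
    using \<rho>(1) by (simp add: power_divide algebra_simps)
  finally have "measure lebesgue {z \<in> ball y s. u z > 0}
      \<le> (2 * m / h / \<rho>)\<^sup>2 * measure lebesgue {z \<in> ball y t. u z > 0} + \<beta> * measure lebesgue (ball y t)"
    using \<rho>(1) by (simp add: mult_le_cancel_left_pos)
  also have "measure lebesgue (ball y t) = unit_ball_vol (real DIM('a)) * t ^ DIM('a)"
    using t by (simp add: measure_def emeasure_ball)
  finally show ?thesis .
qed

theorem theorem10p1:
  fixes \<kappa> \<alpha> \<rho>0 L Mp Mm :: real
  assumes "CARD('n::finite) \<ge> 2"
    and "0 < \<kappa>" and "0 < \<alpha>" and "\<alpha> \<le> 1"
    and "0 < \<rho>0" and "1 \<le> L"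
  shows "\<exists>\<eta>0 r0. 0 < \<eta>0 \<and> 0 < r0 \<and>
    (\<forall>(\<Omega> :: (real ^ 'n) set) qp qm u.
       open \<Omega> \<and>
       qp \<in> Linf \<Omega> \<and> Linf_norm \<Omega> qp = ereal Mp \<and>
       qm \<in> Linf \<Omega> \<and> Linf_norm \<Omega> qm = ereal Mm \<and>
       (almost_minimizer_J \<kappa> \<alpha> qp qm \<Omega> u \<or> almost_minimizer_J_plus \<kappa> \<alpha> qp \<Omega> u) \<and>
       continuous_on \<Omega> u \<longrightarrow>
       (\<forall>x\<in>\<Omega>. \<forall>r. 0 < r \<and> r \<le> r0 \<and> cball x r \<subseteq> \<Omega> \<and>
          sphere_average x r (\<lambda>y. max (u y) 0) \<le> r * \<eta>0 \<and>
          lipschitz_on L (ball x r) u \<and>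
          (\<forall>y\<in>ball x r. \<rho>0 \<le> qp y) \<longrightarrow>
          (\<forall>y\<in>ball x (r / 4). u y \<le> 0)))"
proof -
  define n where "n = CARD('n)"
  have n: "1 \<le> real n"
    using assms(1) by (simp add: n_def)
  \<comment> \<open>Solves the smallness condition of the halving step: 512 is 8 squared times
    8.\<close>
  define \<epsilon> where "\<epsilon> = min 1 (\<rho>0\<^sup>2 / (512 * (real n)\<^sup>2 * L))"
  define q where "q = (\<epsilon> / (4 * L)) ^ n"
  \<comment> \<open>Makes the square of \<open>8 * \<epsilon>' / \<rho>0\<close> at most half the
    density threshold \<open>q\<close>.\<close>
  define \<epsilon>' where "\<epsilon>' = min 1 (\<rho>0 / 8 * sqrt (q / 2))"
  \<comment> \<open>Bounds the energy density of every competitor, with \<open>8 * real n\<close> as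
    the largest barrier slope.\<close>
  define K where "K = real n * L\<^sup>2 + Mp\<^sup>2 + Mm\<^sup>2 + (8 * real n)\<^sup>2"
  \<comment> \<open>Then \<open>n\<close> errors amount to \<open>q / 4\<close>, strictly less than
    the \<open>q / 2\<close> available.\<close>
  define \<beta> where "\<beta> = q / (4 * real n)"
  \<comment> \<open>The radius at which the almost minimality error reaches the admissible
    \<beta>.\<close>
  define r0 where "r0 = (\<beta> * \<rho>0\<^sup>2 / (\<kappa> * K)) powr (1 / \<alpha>)"
  have \<epsilon>: "0 < \<epsilon>" "\<epsilon> \<le> 1"
    using assms n by (auto simp: \<epsilon>_def)
  have q: "0 < q"
    using \<epsilon> assms by (simp add: q_def)
  have \<epsilon>': "0 < \<epsilon>'" "\<epsilon>' \<le> 1"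
    using q assms by (auto simp: \<epsilon>'_def)
  have \<beta>: "0 < \<beta>"
    using q n by (simp add: \<beta>_def)
  have K: "0 < K"
    unfolding K_def using n by (intro add_nonneg_pos) auto
  have r0: "0 < r0"
    using \<beta> K assms by (simp add: r0_def)
  have r0_powr: "\<kappa> * r0 powr \<alpha> * K = \<beta> * \<rho>0\<^sup>2"
    using \<beta> K assms by (simp add: r0_def powr_powr)
  have \<theta>: "(8 * real n * \<epsilon> / \<rho>0)\<^sup>2 \<le> \<epsilon> / (8 * L)"
  proof -
    have "\<epsilon> \<le> \<rho>0\<^sup>2 / (512 * (real n)\<^sup>2 * L)"
      by (simp add: \<epsilon>_def)
    then have "\<epsilon> * (512 * (real n)\<^sup>2 * L) \<le> \<rho>0\<^sup>2"
      using n assms by (subst (asm) pos_le_divide_eq) auto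
    then have "\<epsilon> * (\<epsilon> * (512 * (real n)\<^sup>2 * L)) \<le> \<epsilon> * \<rho>0\<^sup>2"
      using \<epsilon> by (intro mult_left_mono) auto
    then show ?thesis
      using assms by (simp add: power_divide power_mult_distrib power2_eq_square field_simps)
  qed
  have \<epsilon>'_small: "(8 * \<epsilon>' / \<rho>0)\<^sup>2 \<le> q / 2"
  proof -
    have "\<epsilon>' \<le> \<rho>0 / 8 * sqrt (q / 2)"
      by (simp add: \<epsilon>'_def)
    then have "8 * \<epsilon>' / \<rho>0 \<le> sqrt (q / 2)"
      using assms by (simp add: pos_divide_le_eq mult.commute)
    then have "(8 * \<epsilon>' / \<rho>0)\<^sup>2 \<le> (sqrt (q / 2))\<^sup>2"
      using \<epsilon>' assms by (intro power_mono) auto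
    then show ?thesis
      using q by simp
  qed
  obtain \<eta> where \<eta>: "0 < \<eta>" "\<And>(x :: real ^ 'n) r u z. 0 < r \<Longrightarrow> L-lipschitz_on (cball x r) u \<Longrightarrow>
    sphere_average x r (\<lambda>y. max (u y) 0) \<le> r * \<eta> \<Longrightarrow> z \<in> sphere x r \<Longrightarrow> u z \<le> \<epsilon>' * r"
    by (rule sphere_average_small_imp_le[where 'n = 'n, OF \<epsilon>'(1), of L]) (use assms(6) in auto)
  have main: "u y \<le> 0"
    if \<Omega>: "open \<Omega>" and qp: "qp \<in> Linf \<Omega>" "Linf_norm \<Omega> qp = ereal Mp"
      and qm: "qm \<in> Linf \<Omega>" "Linf_norm \<Omega> qm = ereal Mm"
      and min: "almost_minimizer_J \<kappa> \<alpha> qp qm \<Omega> u \<or> almost_minimizer_J_plus \<kappa> \<alpha> qp \<Omega> u"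
      and cont: "continuous_on \<Omega> u"
      and r: "0 < r" "r \<le> r0" "cball x r \<subseteq> \<Omega>"
      and avg: "sphere_average x r (\<lambda>y. max (u y) 0) \<le> r * \<eta>"
      and lip: "L-lipschitz_on (ball x r) u" and \<rho>: "\<forall>y\<in>ball x r. \<rho>0 \<le> qp y"
      and y: "y \<in> ball x (r / 4)"
    for \<Omega> :: "(real ^ 'n) set" and qp qm u x r y
  proof -
    \<comment> \<open>Treats both kinds of minimizers at once: \<open>qm'\<close> is
      \<open>qm\<close> for J and 0 for J^+, and only balls whose closure lies in \<Omega> are
      compared. The absolute value of \<open>Mm\<close> is a bound valid for the zero function
      too.\<close>
    obtain qm' where qm': "qm' \<in> borel_measurable (lebesgue_on \<Omega>)" "AE z in lebesgue_on \<Omega>. \<bar>qm' z\<bar> \<le> \<bar>Mm\<bar>"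
      and min': "\<And>y t v. 0 < t \<Longrightarrow> cball y t \<subseteq> \<Omega> \<Longrightarrow> competitor u y t v \<Longrightarrow>
        J_fun qp qm' y t u \<le> (1 + \<kappa> * t powr \<alpha>) * J_fun qp qm' y t v"
      and u: "u \<in> K_loc \<Omega>"
    proof (cases "almost_minimizer_J \<kappa> \<alpha> qp qm \<Omega> u")
      case True
      have "AE z in lebesgue_on \<Omega>. \<bar>qm z\<bar> \<le> \<bar>Mm\<bar>"
        using Linf_norm_AE_le[OF qm(2)] by eventually_elim linarith
      moreover have "ball y t \<subseteq> \<Omega>" if "cball y t \<subseteq> \<Omega>" for y t
        using that ball_subset_cball by blast
      ultimately show ?thesis
        using True qm(1) by (intro that[of qm]) (auto simp: almost_minimizer_J_def Linf_def)
    next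
      case False
      then have "almost_minimizer_J_plus \<kappa> \<alpha> qp \<Omega> u"
        using min by simp
      then show ?thesis
        by (intro that[of "\<lambda>_. 0"])
          (auto simp: almost_minimizer_J_plus_def K_loc_plus_def J_plus_eq_J_fun)
    qed
    have lip': "L-lipschitz_on (cball x r) u"
      using lipschitz_on_closure[OF lip] continuous_on_subset[OF cont r(3)] r(1) by simp
    interpret positivity_decay x r L \<rho>0 \<beta> "unit_ball_vol (real DIM(real ^ 'n))" "DIM(real ^ 'n)" u
    proof
      fix y :: "real ^ 'n" and s t m h :: real
      assume s: "0 < s" "0 < h" "s + h \<le> t" and sub: "cball y t \<subseteq> cball x r"
        and m: "0 \<le> m" "\<And>z. z \<in> sphere y t \<Longrightarrow> u z \<le> m" "2 * m / h \<le> 8 * real DIM(real ^ 'n)"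
      have "t \<le> r"
        using sub s zero_le_dist[of y x] unfolding cball_subset_cball_iff by linarith
      have ball_sub: "ball y t \<subseteq> ball x r"
        using interior_mono[OF sub] by simp
      \<comment> \<open>Every ball of the iteration has radius at most \<open>r0\<close>, so the
        error \<beta> is uniform over all scales.\<close>
      have "t powr \<alpha> \<le> r0 powr \<alpha>"
        using s \<open>t \<le> r\<close> r assms by (intro powr_mono2) auto
      then have "\<kappa> * t powr \<alpha> * K \<le> \<kappa> * r0 powr \<alpha> * K"
        using assms K by (intro mult_right_mono mult_left_mono) auto
      then have "\<kappa> * t powr \<alpha> * (real DIM(real ^ 'n) * L\<^sup>2 + Mp\<^sup>2 + \<bar>Mm\<bar>\<^sup>2 + (8 * real DIM(real ^ 'n))\<^sup>2) \<le> \<beta> * \<rho>0\<^sup>2"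
        unfolding r0_powr by (simp add: K_def n_def)
      then show "measure lebesgue {z \<in> ball y s. 0 < u z}
        \<le> (2 * m / h / \<rho>0)\<^sup>2 * measure lebesgue {z \<in> ball y t. 0 < u z}
          + \<beta> * (unit_ball_vol (real DIM(real ^ 'n)) * t ^ DIM(real ^ 'n))"
        using s sub r ball_sub qp(1) Linf_norm_AE_le[OF qp(2)] assms \<rho>
        by (intro almost_minimizer_decay[OF \<Omega> _ u cont _ _ qm' min' _ _ lipschitz_on_subset[OF lip] _ _ s m])
          (auto simp: Linf_def)
    qed (use assms \<beta> lip' in auto)
    have nn: "DIM(real ^ 'n) = n"
      by (simp add: n_def)
    show ?thesis
    proof (rule nonpos_on_quarter_ball[of \<epsilon> \<epsilon>' y])
      show "real DIM(real ^ 'n) * \<beta> < (\<epsilon> / (4 * L)) ^ DIM(real ^ 'n) / 2"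
        unfolding nn q_def[symmetric] using q n by (simp add: \<beta>_def)
      show "(8 * \<epsilon>' / \<rho>0)\<^sup>2 \<le> (\<epsilon> / (4 * L)) ^ DIM(real ^ 'n) / 2"
        unfolding nn q_def[symmetric] by (rule \<epsilon>'_small)
      show "(8 * real DIM(real ^ 'n) * \<epsilon> / \<rho>0)\<^sup>2 \<le> \<epsilon> / (8 * L)"
        unfolding nn by (rule \<theta>)
      show "u z \<le> \<epsilon>' * r" if "z \<in> sphere x r" for z
        by (rule \<eta>(2)[OF r(1) lip' avg that])
    qed (use \<epsilon> \<epsilon>' r y in auto)
  qed
  show ?thesis
    by (intro exI[of _ \<eta>] exI[of _ r0] conjI \<eta>(1) r0 allI impI ballI, elim conjE, rule main; assumption)
qed

end
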